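(* Let $\mathcal{M}$ be a factor of type ${\rm II}_1$ with normalized trace $\tau$. Let $\alpha:[0,1]\to[0,1]$ be a monotone increasing continuous function with $\alpha(0)=0$ and $\alpha(1)=1$, and let $\varphi_\alpha$ be the non-linear trace of the Choquet type associated with $\alpha$. Let $(a_n)_{n\ge1}$ be an operator norm bounded sequence in $\mathcal{M}_{s.a.}$ with a constant $m\in\mathbb{R}$ such that $m=\varphi_\alpha(a_n)$ for all $n=1,2,\dots$, and put $s_n=a_1+a_2+\cdots+a_n$. (1) If $\alpha$ is concave and the sequence $(a_n)_n$ is subindependent with respect to $\varphi_\alpha$, then for any fixed $k\in\{1,2,3,\dots\}$, $$\limsup_{n\to\infty}\varphi_\alpha\Big(\big(\tfrac{s_n}{n}\big)^k\Big)\le m^k .$$ (2) If $\alpha$ is convex and the sequence $(a_n)_n$ is superindependent with respect to $\varphi_\alpha$, then for any fixed $k\in\{1,2,3,\dots\}$, $$\liminf_{n\to\infty}\varphi_\alpha\Big(\big(\tfrac{s_n}{n}\big)^k\Big)\ge m^k .$$ (3) Suppose that $\alpha$ is concave, that $(a_n)_n$ is subindependent with respect to $\varphi_\alpha$, and that $(a_n)_n$ is superindependent with respect to $\varphi_{\overline\alpha}$ with a constant $\overline m\in\mathbb{R}$ such that $\overline m=\varphi_{\overline\alpha}(a_n)$ for all $n=1,2,\dots$. Then for any fixed $k\in\{1,2,3,\dots\}$, $$\overline m^{\,k}\le \liminf_{n\to\infty}\varphi_{\overline\alpha}\Big(\big(\tfrac{s_n}{n}\big)^k\Big)\le \liminf_{n\to\infty}\varphi_{\alpha}\Big(\big(\tfrac{s_n}{n}\big)^k\Big)\le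 \limsup_{n\to\infty}\varphi_{\alpha}\Big(\big(\tfrac{s_n}{n}\big)^k\Big)\le m^k .$$ Moreover, any accumulation point of the sequence $\big(\varphi_\alpha((\frac{s_n}{n})^k)\big)_n$ is in the interval $[\overline m^{\,k},m^k]$.
   Context: $\tau$ is the faithful normal tracial state on the type ${\rm II}_1$ factor $\mathcal{M}$, so $\tau(I)=1$. $\mathcal{M}_{s.a.}$ is the set of self-adjoint operators in $\mathcal{M}$, $\mathcal{M}^+$ the set of positive operators. $\mathrm{Re}(x)=\frac12(x+x^* )$. For $\alpha$ monotone increasing and continuous on $[0,1]$ with $\alpha(0)=0,\alpha(1)=1$, the dual weight is $\overline\alpha(t)=1-\alpha(1-t)$, which is again monotone increasing and continuous with $\overline\alpha(0)=0$, $\overline\alpha(1)=1$. For $a\in\mathcal{M}^+$, $e_{(s,\infty)}(a)$ denotes the spectral projection of $a$ for $(s,\infty)$, and $\varphi_\alpha(a):=\int_0^\infty \alpha(\tau(e_{(s,\infty)}(a)))\,ds$. For $a\in\mathcal{M}_{s.a.}$, $\varphi_\alpha(a)$ denotes the translatable extension: choose a real number $c$ with $a+cI\ge 0$ and put $\varphi_\alpha(a):=\varphi_\alpha(a+cI)-c$; this does not depend on the choice of $c$ and agrees with the previous definition on $\mathcal{M}^+$. $\varphi_{\overline\alpha}$ is defined in the same way from $\overline\alpha$. A sequence $(a_n)_n$ in $\mathcal{M}_{s.a.}$ is subindependent with respect to $\varphi_\alpha$ if for every $m=1,2,3,\dots$ and any mutually different $i_1,\dots,i_m$, $$\varphi_\alpha(\mathrm{Re}(a_{i_1}a_{i_2}\cdots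 a_{i_m}))\le \varphi_\alpha(a_{i_1})\varphi_\alpha(a_{i_2})\cdots\varphi_\alpha(a_{i_m}),$$ and superindependent with respect to $\varphi_\alpha$ if the same holds with $\ge$ in place of $\le$. *)

theory Defs
  imports "HOL-Analysis.Analysis"
begin

text \<open>The distribution only has real inner product spaces. The underlying real inner product is
  the real part of the complex one, which is conjugate-linear in its first argument; hence norm and
  completeness are the inherited ones.\<close>

class chilbert_space = real_inner + complete_space +
  fixes scaleC :: "complex \<Rightarrow> 'a \<Rightarrow> 'a" (infixr \<open>*\<^sub>C\<close> 75)
    and cinner :: "'a \<Rightarrow> 'a \<Rightarrow> complex"
  assumes scaleC_add_right: "c *\<^sub>C (x + y) = c *\<^sub>C x + c *\<^sub>C y"
    and scaleC_add_left: "(c + d) *\<^sub>C x = c *\<^sub>C x + d *\<^sub>C x"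
    and scaleC_scaleC: "c *\<^sub>C d *\<^sub>C x = (c * d) *\<^sub>C x"
    and scaleC_of_real: "complex_of_real r *\<^sub>C x = r *\<^sub>R x"
    and cinner_commute: "cinner x y = cnj (cinner y x)"
    and cinner_add_right: "cinner x (y + z) = cinner x y + cinner x z"
    and cinner_scaleC_right: "cinner x (c *\<^sub>C y) = c * cinner x y"
    and inner_eq_Re_cinner: "inner x y = Re (cinner x y)"

lemma norm_scaleC: "norm (c *\<^sub>C x) = cmod c * norm (x::'a::chilbert_space)"
proof -
  have "cinner (c *\<^sub>C x) (c *\<^sub>C x) = c * cnj (c * cinner x x)"
    using cinner_scaleC_right[of "c *\<^sub>C x" c x] cinner_commute[of "c *\<^sub>C x" x]
      cinner_scaleC_right[of x c x] by simp
  also have "\<dots> = complex_of_real ((cmod c)\<^sup>2) * cinner x x"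
    using cinner_commute[of x x] by (simp add: complex_norm_square del: of_real_power)
  finally have "inner (c *\<^sub>C x) (c *\<^sub>C x) = (cmod c)\<^sup>2 * inner x x"
    by (simp add: inner_eq_Re_cinner)
  then show ?thesis
    by (simp add: norm_eq_sqrt_inner real_sqrt_mult)
qed

text \<open>Operators are elements of \<open>'h \<Rightarrow>\<^sub>L 'h\<close>, the real-linear bounded maps with the operator norm;
  the complex-linear ones form \<open>bounded_ops\<close>.\<close>

type_synonym 'h oper = "'h \<Rightarrow>\<^sub>L 'h"

definition bounded_ops :: "'h::chilbert_space oper set" where
  "bounded_ops = {a :: 'h oper. \<forall>c x. a (c *\<^sub>C x) = c *\<^sub>C a x}"

lift_definition scaleC_op :: "complex \<Rightarrow> 'h::chilbert_space oper \<Rightarrow> 'h oper" is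
  "\<lambda>c f x. c *\<^sub>C f x"
proof -
  fix c :: complex and f :: "'h \<Rightarrow> 'h"
  assume f: "bounded_linear f"
  have "bounded_linear (\<lambda>x::'h. c *\<^sub>C x)"
  proof
    show "c *\<^sub>C (r *\<^sub>R x) = r *\<^sub>R (c *\<^sub>C x)" for r and x :: 'h
      by (metis mult.commute scaleC_of_real scaleC_scaleC)
    show "\<exists>K. \<forall>x::'h. norm (c *\<^sub>C x) \<le> norm x * K"
      by (metis norm_scaleC mult.commute order_refl)
  qed (rule scaleC_add_right)
  then show "bounded_linear (\<lambda>x. c *\<^sub>C f x)"
    using f by (rule bounded_linear_compose)
qed

definition adj :: "'h::chilbert_space oper \<Rightarrow> 'h oper" where
  "adj a = (THE b :: 'h oper. \<forall>x y. cinner (a x) y = cinner x (b y))"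

definition re_op :: "'h::chilbert_space oper \<Rightarrow> 'h oper" where
  "re_op x = (1/2) *\<^sub>R (x + adj x)"

definition selfadjoint :: "'h::chilbert_space oper \<Rightarrow> bool" where
  "selfadjoint a \<longleftrightarrow> a \<in> bounded_ops \<and> adj a = a"

definition positive_op :: "'h::chilbert_space oper \<Rightarrow> bool" where
  "positive_op a \<longleftrightarrow> a \<in> bounded_ops \<and> (\<forall>x. cinner x (a x) \<in> \<real>\<^sub>\<ge>\<^sub>0)"

definition projection :: "'h::chilbert_space oper \<Rightarrow> bool" where
  "projection p \<longleftrightarrow> selfadjoint p \<and> p o\<^sub>L p = p"

definition op_prod :: "'h::chilbert_space oper list \<Rightarrow> 'h oper" where
  "op_prod xs = foldr (o\<^sub>L) xs id_blinfun"

definition op_power :: "'h::chilbert_space oper \<Rightarrow> nat \<Rightarrow> 'h oper" where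
  "op_power x k = op_prod (replicate k x)"

definition commutant :: "'h::chilbert_space oper set \<Rightarrow> 'h oper set" where
  "commutant S = {b \<in> bounded_ops. \<forall>a\<in>S. a o\<^sub>L b = b o\<^sub>L a}"

definition von_neumann_algebra :: "'h::chilbert_space oper set \<Rightarrow> bool" where
  "von_neumann_algebra M \<longleftrightarrow>
     M \<subseteq> bounded_ops \<and> (\<forall>a\<in>M. adj a \<in> M) \<and> commutant (commutant M) = M"

definition factor :: "'h::chilbert_space oper set \<Rightarrow> bool" where
  "factor M \<longleftrightarrow> von_neumann_algebra M \<and> (id_blinfun :: 'h oper) \<noteq> 0 \<and>
     M \<inter> commutant M = range (\<lambda>c. scaleC_op c id_blinfun)"

definition abelian_projection :: "'h::chilbert_space oper set \<Rightarrow> 'h oper \<Rightarrow> bool" where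
  "abelian_projection M e \<longleftrightarrow> e \<in> M \<and> projection e \<and>
     (\<forall>x\<in>M. \<forall>y\<in>M. (e o\<^sub>L x o\<^sub>L e) o\<^sub>L (e o\<^sub>L y o\<^sub>L e) = (e o\<^sub>L y o\<^sub>L e) o\<^sub>L (e o\<^sub>L x o\<^sub>L e))"

text \<open>Finite in the sense of Murray and von Neumann: the identity is not equivalent to a proper
  subprojection.\<close>

definition finite_vna :: "'h::chilbert_space oper set \<Rightarrow> bool" where
  "finite_vna M \<longleftrightarrow> (\<forall>u\<in>M. adj u o\<^sub>L u = id_blinfun \<longrightarrow> u o\<^sub>L adj u = id_blinfun)"

definition type_II1_factor :: "'h::chilbert_space oper set \<Rightarrow> bool" where
  "type_II1_factor M \<longleftrightarrow>
     factor M \<and> finite_vna M \<and> (\<forall>e. abelian_projection M e \<longrightarrow> e = 0)"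

definition op_le :: "'h::chilbert_space oper \<Rightarrow> 'h oper \<Rightarrow> bool" where
  "op_le a b \<longleftrightarrow> positive_op (b - a)"

definition sa_part :: "'h::chilbert_space oper set \<Rightarrow> 'h oper set" where
  "sa_part M = {a \<in> M. selfadjoint a}"

definition op_directed :: "'h::chilbert_space oper set \<Rightarrow> bool" where
  "op_directed D \<longleftrightarrow> D \<noteq> {} \<and> (\<forall>a\<in>D. \<forall>b\<in>D. \<exists>c\<in>D. op_le a c \<and> op_le b c)"

definition op_is_lub :: "'h::chilbert_space oper set \<Rightarrow> 'h oper set \<Rightarrow> 'h oper \<Rightarrow> bool" where
  "op_is_lub M D b \<longleftrightarrow> b \<in> sa_part M \<and> (\<forall>a\<in>D. op_le a b) \<and>
     (\<forall>c\<in>sa_part M. (\<forall>a\<in>D. op_le a c) \<longrightarrow> op_le b c)"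

definition positive_functional_on ::
    "'h::chilbert_space oper set \<Rightarrow> ('h oper \<Rightarrow> complex) \<Rightarrow> bool" where
  "positive_functional_on M \<tau> \<longleftrightarrow>
     (\<forall>x\<in>M. \<forall>y\<in>M. \<tau> (x + y) = \<tau> x + \<tau> y) \<and>
     (\<forall>c. \<forall>x\<in>M. \<tau> (scaleC_op c x) = c * \<tau> x) \<and>
     (\<forall>x\<in>M. positive_op x \<longrightarrow> \<tau> x \<in> \<real>\<^sub>\<ge>\<^sub>0)"

definition normal_on :: "'h::chilbert_space oper set \<Rightarrow> ('h oper \<Rightarrow> complex) \<Rightarrow> bool" where
  "normal_on M \<tau> \<longleftrightarrow>
     (\<forall>D b. D \<subseteq> sa_part M \<longrightarrow> op_directed D \<longrightarrow> op_is_lub M D b \<longrightarrow>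
        Re (\<tau> b) = (SUP a\<in>D. Re (\<tau> a)))"

definition faithful_normal_tracial_state ::
    "'h::chilbert_space oper set \<Rightarrow> ('h oper \<Rightarrow> complex) \<Rightarrow> bool" where
  "faithful_normal_tracial_state M \<tau> \<longleftrightarrow>
     positive_functional_on M \<tau> \<and> \<tau> id_blinfun = 1 \<and>
     (\<forall>x\<in>M. \<forall>y\<in>M. \<tau> (x o\<^sub>L y) = \<tau> (y o\<^sub>L x)) \<and>
     (\<forall>x\<in>M. \<tau> (adj x o\<^sub>L x) = 0 \<longrightarrow> x = 0) \<and>
     normal_on M \<tau>"

definition projection_valued_measure :: "(real set \<Rightarrow> 'h::chilbert_space oper) \<Rightarrow> bool" where
  "projection_valued_measure E \<longleftrightarrow>
     (\<forall>B\<in>sets borel. projection (E B)) \<and> E UNIV = id_blinfun \<and>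
     (\<forall>A\<in>sets borel. \<forall>B\<in>sets borel. E (A \<inter> B) = E A o\<^sub>L E B) \<and>
     (\<forall>B::nat \<Rightarrow> real set. range B \<subseteq> sets borel \<longrightarrow> disjoint_family B \<longrightarrow>
        (\<forall>x. (\<lambda>n. E (B n) x) sums E (\<Union>n. B n) x))"

definition diagonal_measure ::
    "(real set \<Rightarrow> 'h::chilbert_space oper) \<Rightarrow> 'h \<Rightarrow> real measure" where
  "diagonal_measure E x = measure_of UNIV (sets borel) (\<lambda>B. ennreal (Re (cinner x (E B x))))"

text \<open>\<open>a = \<integral>\<lambda> dE(\<lambda>)\<close> in the weak sense; by polarization it suffices to test on the diagonal.\<close>

definition spectral_measure_of ::
    "'h::chilbert_space oper \<Rightarrow> (real set \<Rightarrow> 'h oper) \<Rightarrow> bool" where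
  "spectral_measure_of a E \<longleftrightarrow> projection_valued_measure E \<and>
     (\<forall>x. integrable (diagonal_measure E x) (\<lambda>t. t) \<and>
          cinner x (a x) = complex_of_real (LINT t|diagonal_measure E x. t))"

text \<open>The spectral measure of a self-adjoint operator is unique on the Borel sets (its values
  elsewhere are unconstrained), so this is only meaningful for Borel \<open>B\<close>.\<close>

definition spectral_projection :: "'h::chilbert_space oper \<Rightarrow> real set \<Rightarrow> 'h oper" where
  "spectral_projection a B = (THE p. \<exists>E. spectral_measure_of a E \<and> p = E B)"

definition choquet_trace_pos ::
    "('h::chilbert_space oper \<Rightarrow> complex) \<Rightarrow> (real \<Rightarrow> real) \<Rightarrow> 'h oper \<Rightarrow> real" where
  "choquet_trace_pos \<tau> \<alpha> a = (LBINT s:{0..}. \<alpha> (Re (\<tau> (spectral_projection a {s<..}))))"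

text \<open>The value does not depend on the \<open>c\<close> chosen; on positive operators it is
  \<open>choquet_trace_pos\<close>.\<close>

definition choquet_trace ::
    "('h::chilbert_space oper \<Rightarrow> complex) \<Rightarrow> (real \<Rightarrow> real) \<Rightarrow> 'h oper \<Rightarrow> real" where
  "choquet_trace \<tau> \<alpha> a =
     (let c = (SOME c. positive_op (a + c *\<^sub>R id_blinfun))
      in choquet_trace_pos \<tau> \<alpha> (a + c *\<^sub>R id_blinfun) - c)"

definition dual_weight :: "(real \<Rightarrow> real) \<Rightarrow> real \<Rightarrow> real" where
  "dual_weight \<alpha> t = 1 - \<alpha> (1 - t)"

text \<open>Sequences \<open>a\<close> are indexed from 1; the value \<open>a 0\<close> is irrelevant.\<close>

definition subindependent :: "('h::chilbert_space oper \<Rightarrow> real) \<Rightarrow> (nat \<Rightarrow> 'h oper) \<Rightarrow> bool" where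
  "subindependent \<phi> a \<longleftrightarrow>
     (\<forall>is. is \<noteq> [] \<longrightarrow> distinct is \<longrightarrow> set is \<subseteq> {1..} \<longrightarrow>
        \<phi> (re_op (op_prod (map a is))) \<le> prod_list (map (\<lambda>i. \<phi> (a i)) is))"

definition superindependent :: "('h::chilbert_space oper \<Rightarrow> real) \<Rightarrow> (nat \<Rightarrow> 'h oper) \<Rightarrow> bool" where
  "superindependent \<phi> a \<longleftrightarrow>
     (\<forall>is. is \<noteq> [] \<longrightarrow> distinct is \<longrightarrow> set is \<subseteq> {1..} \<longrightarrow>
        \<phi> (re_op (op_prod (map a is))) \<ge> prod_list (map (\<lambda>i. \<phi> (a i)) is))"

definition seq_mean :: "(nat \<Rightarrow> 'h::chilbert_space oper) \<Rightarrow> nat \<Rightarrow> 'h oper" where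
  "seq_mean a n = (1 / real n) *\<^sub>R (\<Sum>i=1..n. a i)"

definition accumulation_point :: "(nat \<Rightarrow> real) \<Rightarrow> real \<Rightarrow> bool" where
  "accumulation_point X l \<longleftrightarrow> (\<forall>U. open U \<longrightarrow> l \<in> U \<longrightarrow> infinite {n. X n \<in> U})"

end

theory Submission
  imports Defs
begin

text \<open>Write \<open>F\<^sub>a(s) = \<tau>(e\<^bsub>(s,\<infinity>)\<^esub>(a))\<close>, so that
  \<open>\<phi>\<^sub>\<alpha>(a) = \<integral> (\<alpha>(F\<^sub>a(s)) - 1\<^bsub>s < 0\<^esub>) ds\<close>. For \<open>\<alpha>(t) = min t r\<close> this is the minimum
  over \<open>l\<close> of \<open>r l + \<tau>((a - l)\<^sub>+)\<close>, and \<open>\<tau>((a - l)\<^sub>+)\<close> is the maximum of \<open>\<tau>(q(a - l))\<close> over the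
  projections \<open>q\<close>; hence \<open>\<phi>\<^sub>\<alpha>\<close> is subadditive for these \<open>\<alpha>\<close>. A continuous concave weight is a uniform
  limit of sums of a linear term, whose functional is the additive \<open>\<tau>\<close>, and nonnegative multiples
  of such minima, so \<open>\<phi>\<^sub>\<alpha>\<close> is subadditive for every concave \<open>\<alpha>\<close>, and superadditive for convex
  \<open>\<alpha>\<close>. Expanding \<open>(s\<^sub>n / n)\<^sup>k\<close> into products, those with distinct indices are controlled by
  subindependence, and the proportion of the others tends to 0.\<close>

section \<open>Projections cut out by a symmetric operator\<close>

text \<open>The obstacle is that \<open>spectral_projection\<close> is a definite description over
  all spectral measures of an operator, so \<open>choquet_trace\<close> cannot be evaluated before
  both existence and uniqueness of the spectral measure are known. Everything rests on
  \<open>upcut a s\<close>, the projection for the open half-line above s, which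
  \<open>cut_proj\<close> characterises by quadratic forms alone. It commutes with whatever commutes
  with a; this one property makes it complex-linear, places it in the von Neumann algebra by the
  bicommutant condition, and allows cuts at different levels to be compared. Integration by parts is
  replaced by a squeeze: F determines the increments of any T with (u - l) F u \<le> T l - T u \<le>
  (u - l) F l. Applied to the forms of the positive parts of a - s, this recovers a from its
  measures; applied to their traces, it writes \<open>excess\<close> as an integral of the
  distribution function. For the weights min t r the Choquet integral is a minimum of expressions
  that are themselves maxima over projections, and inserting competitors in both is all that
  subadditivity takes.\<close>

instance chilbert_space \<subseteq> banach ..

lemma norm_add_sqr: "norm (x + y)^2 = norm x^2 + 2 * inner x y + norm (y::'a::real_inner)^2"
  by (simp add: power2_norm_eq_inner inner_add inner_commute)

lemma norm_diff_sqr: "norm (x - y)^2 = norm x^2 - 2 * inner x y + norm (y::'a::real_inner)^2"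
  by (simp add: power2_norm_eq_inner inner_diff inner_commute)

text \<open>First-order condition at the minimum t = 0. It serves as the variational step for the
  Riesz minimiser and for null vectors of a positive form.\<close>

lemma quadratic_nonneg_imp_linear_zero:
  fixes c d :: real
  assumes "\<And>t. 0 \<le> t * c + t^2 * d"
  shows "c = 0"
proof (rule ccontr)
  assume c: "c \<noteq> 0"
  define D where "D = \<bar>d\<bar> + 1"
  have D: "D > 0" "d < D" by (auto simp: D_def)
  have "0 \<le> (- c / D) * c + (- c / D)^2 * d" by (rule assms)
  also have "\<dots> = c^2 / D^2 * (d - D)"
    using D by (simp add: field_simps power2_eq_square)
  also have "\<dots> < 0"
    using D c by (intro mult_pos_neg divide_pos_pos) auto
  finally show False by simp
qed

interpretation blinfun_compose: bounded_bilinear "(o\<^sub>L)"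
  by (rule bounded_bilinear_blinfun_compose)

text \<open>Direct method: the representing vector is the minimiser of |x|^2 - 2 f x. The
  parallelogram law makes minimising sequences Cauchy, and the first variation at the limit u is the
  desired identity.\<close>

lemma riesz_representation:
  fixes f :: "'a::{real_inner,banach} \<Rightarrow> real"
  assumes f: "bounded_linear f"
  shows "\<exists>u. \<forall>x. f x = inner u x"
proof -
  interpret f: bounded_linear f by (rule f)
  define J where "J x = norm x^2 - 2 * f x" for x
  obtain K where K: "\<And>x. norm (f x) \<le> norm x * K" "K \<ge> 0"
    using f.nonneg_bounded by blast
  have lower: "- (K^2) \<le> J x" for x
  proof -
    have "f x \<le> norm x * K" using K(1)[of x] by simp
    moreover have "0 \<le> (norm x - K)^2" by simp
    ultimately show ?thesis by (simp add: J_def power2_diff)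
  qed
  define I where "I = (INF x. J x)"
  have bdd: "bdd_below (range J)" using lower by (intro bdd_belowI2) auto
  have I: "I \<le> J x" for x unfolding I_def using bdd by (intro cINF_lower) auto
  have "\<exists>x. J x < I + inverse (real (Suc n))" for n
  proof -
    have "I < I + inverse (real (Suc n))" by simp
    then show ?thesis using cINF_less_iff[OF _ bdd, of "I + inverse (real (Suc n))"] by (simp add: I_def)
  qed
  then obtain X where X: "\<And>n. J (X n) < I + inverse (real (Suc n))" by metis
  have par: "norm (x - y)^2 = 2 * J x + 2 * J y - 4 * J ((1/2) *\<^sub>R (x + y))" for x y
    by (simp add: J_def f.scaleR f.add power_mult_distrib power_divide norm_add_sqr norm_diff_sqr field_simps)
  have "Cauchy X"
  proof (rule metric_CauchyI)
    fix e :: real assume e: "e > 0"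
    \<comment> \<open>The midpoint in \<open>par\<close> has value at least I, so |X i - X j|^2 is
      below 2/(i+1) + 2/(j+1), hence below 4/(N+1).\<close>
    then obtain N where N: "inverse (real (Suc N)) < e^2 / 4"
      using reals_Archimedean[of "e^2/4"] by auto
    have "dist (X i) (X j) < e" if "i \<ge> N" "j \<ge> N" for i j
    proof -
      have inv: "inverse (real (Suc i)) \<le> inverse (real (Suc N))" "inverse (real (Suc j)) \<le> inverse (real (Suc N))"
        using that by (auto intro!: le_imp_inverse_le)
      have "norm (X i - X j)^2 < e^2"
        unfolding par using X[of i] X[of j] I[of "(1/2) *\<^sub>R (X i + X j)"] inv N by linarith
      then show ?thesis using e power2_less_imp_less[of _ e] by (simp add: dist_norm)
    qed
    then show "\<exists>M. \<forall>i\<ge>M. \<forall>j\<ge>M. dist (X i) (X j) < e" by blast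
  qed
  then obtain u where u: "X \<longlonglongrightarrow> u" by (auto simp: Cauchy_convergent_iff convergent_def)
  have "(\<lambda>n. J (X n)) \<longlonglongrightarrow> J u"
    unfolding J_def by (intro tendsto_intros u f.tendsto)
  moreover have "(\<lambda>n. I + inverse (real (Suc n))) \<longlonglongrightarrow> I + 0"
    by (intro tendsto_intros LIMSEQ_inverse_real_of_nat)
  ultimately have "J u \<le> I + 0"
    using X by (intro LIMSEQ_le[where X="\<lambda>n. J (X n)"]) (auto intro: less_imp_le)
  then have min: "J u \<le> J x" for x using I[of x] by simp
  have "f v = inner u v" for v
  proof -
    have "0 \<le> t * (2 * (inner u v - f v)) + t^2 * norm v^2" for t
      using min[of "u + t *\<^sub>R v"]
      by (simp add: J_def norm_add_sqr f.add f.scaleR power_mult_distrib algebra_simps)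
    from quadratic_nonneg_imp_linear_zero[OF this] show ?thesis by simp
  qed
  then show ?thesis by blast
qed

text \<open>Symmetry for the real inner product only. For complex-linear operators it is the same as
  self-adjointness (\<open>selfadjoint_iff\<close>), so the constructions below can ignore the
  complex structure and recover it later from commutation.\<close>

definition symmetric_op :: "('a::real_inner \<Rightarrow>\<^sub>L 'a) \<Rightarrow> bool" where
  "symmetric_op a \<longleftrightarrow> (\<forall>x y. inner (a x) y = inner x (a y))"

lemma symmetric_opD: "symmetric_op a \<Longrightarrow> inner (blinfun_apply a x) y = inner x (blinfun_apply a y)"
  by (simp add: symmetric_op_def)

lemma norm_blinfun_contraction: "norm z \<le> 1 \<Longrightarrow> norm (blinfun_apply z x) \<le> norm x"
  using norm_blinfun[of z x] mult_right_mono[of "norm z" 1 "norm x"] by simp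

lemma symmetric_op_add: "symmetric_op a \<Longrightarrow> symmetric_op b \<Longrightarrow> symmetric_op (a + b)"
  and symmetric_op_diff: "symmetric_op a \<Longrightarrow> symmetric_op b \<Longrightarrow> symmetric_op (a - b)"
  and symmetric_op_scaleR: "symmetric_op a \<Longrightarrow> symmetric_op (r *\<^sub>R a)"
  and symmetric_op_id: "symmetric_op id_blinfun"
  by (simp_all add: symmetric_op_def blinfun.bilinear_simps inner_add inner_diff)

lemma commute_opD: "a o\<^sub>L b = b o\<^sub>L a \<Longrightarrow> blinfun_apply a (blinfun_apply b x) = blinfun_apply b (blinfun_apply a x)"
  by (metis blinfun_apply_blinfun_compose)

definition orth_proj :: "('a::real_inner \<Rightarrow>\<^sub>L 'a) \<Rightarrow> bool" where
  "orth_proj p \<longleftrightarrow> symmetric_op p \<and> p o\<^sub>L p = p"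

lemma orth_projD:
  assumes "orth_proj p"
  shows "blinfun_apply p (blinfun_apply p x) = blinfun_apply p x"
    and "inner (blinfun_apply p x) y = inner x (blinfun_apply p y)"
  using assms by (metis orth_proj_def blinfun_apply_blinfun_compose, simp add: orth_proj_def symmetric_op_def)

lemma orth_proj_compl: "orth_proj p \<Longrightarrow> orth_proj (id_blinfun - p)"
  unfolding orth_proj_def[of "id_blinfun - p"]
  by (auto simp: symmetric_op_def blinfun.bilinear_simps inner_diff orth_projD intro!: blinfun_eqI)

lemma orth_proj_norm_sqr: "orth_proj p \<Longrightarrow> norm (blinfun_apply p x)^2 = inner x (blinfun_apply p x)"
  by (metis orth_projD power2_norm_eq_inner)

lemma orth_proj_norm_le: "orth_proj p \<Longrightarrow> norm (blinfun_apply p x) \<le> norm x"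
proof -
  assume p: "orth_proj p"
  have "norm (p x)^2 \<le> norm x * norm (p x)"
    unfolding orth_proj_norm_sqr[OF p] by (rule norm_cauchy_schwarz)
  then show ?thesis
    by (cases "p x = 0") (auto simp: power2_eq_square)
qed

lemma orth_proj_pythagoras:
  "orth_proj p \<Longrightarrow> norm x^2 = norm (blinfun_apply p x)^2 + norm (x - blinfun_apply p x)^2"
  by (simp add: norm_diff_sqr orth_proj_norm_sqr)

text \<open>The powers of the positive contraction \<open>1 - z\<^sup>2\<close> decrease strongly to the projection onto
  the kernel of \<open>z\<close>.\<close>

lemma kernel_projection_contraction:
  fixes z :: "'a::{real_inner,banach} \<Rightarrow>\<^sub>L 'a"
  assumes z: "symmetric_op z" and nz: "norm z \<le> 1"
  shows "\<exists>e. orth_proj e \<and> (\<forall>x. z x = 0 \<longleftrightarrow> e x = x) \<and> (\<forall>b. b o\<^sub>L z = z o\<^sub>L b \<longrightarrow> b o\<^sub>L e = e o\<^sub>L b)"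
proof -
  define c where "c = id_blinfun - (z o\<^sub>L z)"
  have c: "c x = x - z (z x)" for x by (simp add: c_def blinfun.bilinear_simps)
  have zle: "norm (z x) \<le> norm x" for x
    by (rule norm_blinfun_contraction[OF nz])
  have csym: "inner (c x) y = inner x (c y)" for x y
    by (simp add: c inner_diff symmetric_opD[OF z])
  define P where "P n x = (blinfun_apply c ^^ n) x" for n x
  have P0: "P 0 x = x" and PS: "P (Suc n) x = c (P n x)" for n x by (auto simp: P_def)
  have PS': "P (Suc n) x = P n (c x)" for n x by (simp add: P_def funpow_swap1)
  have Padd: "P (i + j) x = P i (P j x)" for i j x by (simp add: P_def funpow_add)
  have Plin: "P n (x + y) = P n x + P n y" "P n (x - y) = P n x - P n y" "P n (r *\<^sub>R x) = r *\<^sub>R P n x" for n x y r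
    by (induction n) (simp_all add: P0 PS blinfun.bilinear_simps)
  have Psym: "inner (P n x) y = inner x (P n y)" for n x y
  proof (induction n arbitrary: x y)
    case (Suc n)
    show ?case by (metis Suc PS PS' csym)
  qed (simp add: P0)
  have czero: "inner x (c x) \<ge> 0" for x
  proof -
    have "inner x (c x) = norm x^2 - norm (z x)^2"
      by (simp add: c inner_diff power2_norm_eq_inner symmetric_opD[OF z])
    then show ?thesis using zle[of x] by (simp add: power_mono)
  qed
  have split: "inner x (P (i + j) x) = inner (P i x) (P j x)" for i j x
    by (simp only: Padd Psym)
  \<comment> \<open>An even power is a square, and an odd one is the positive operator c between two
    equal powers.\<close>
  have dpos: "inner x (P n x) \<ge> 0" for n x
  proof (cases "even n")
    case True
    then obtain k where "n = k + k" by (metis evenE mult_2)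
    then show ?thesis by (simp add: split)
  next
    case False
    then obtain k where "n = k + Suc k" by (metis oddE mult_2 add_Suc_right Suc_eq_plus1)
    then have "inner x (P n x) = inner (P k x) (c (P k x))" by (simp only: split PS)
    then show ?thesis using czero by simp
  qed
  have Pz: "P n (z x) = z (P n x)" for n x
    by (induction n) (simp_all add: P0 PS c blinfun.bilinear_simps)
  \<comment> \<open>The drop from n to n + 1 is the form of \<open>P n\<close> at
    \<open>z x\<close>, which \<open>dpos\<close> makes nonnegative.\<close>
  have ddec: "inner x (P (Suc n) x) \<le> inner x (P n x)" for n x
    using dpos[of "z x" n] by (simp add: PS' c Plin inner_diff Pz symmetric_opD[OF z])
  have dconv: "convergent (\<lambda>n. inner x (P n x))" for x
  proof (rule Bseq_monoseq_convergent)
    have le: "inner x (P n x) \<le> inner x x" for n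
      by (induction n) (auto simp: P0 intro: order_trans[OF ddec])
    show "Bseq (\<lambda>n. inner x (P n x))"
      by (rule BseqI'[where K="inner x x"]) (simp add: dpos le)
    show "monoseq (\<lambda>n. inner x (P n x))"
      by (rule decseq_imp_monoseq) (auto intro!: decseq_SucI ddec)
  qed
  have "Cauchy (\<lambda>n. P n x)" for x
  proof (rule metric_CauchyI)
    fix e :: real assume e: "e > 0"
    define d where "d = (\<lambda>n. inner x (P n x))"
    \<comment> \<open>By symmetry the inner product of \<open>P i x\<close> and \<open>P j x\<close>
      depends only on i + j, so strong convergence reduces to that of the scalar sequence d.\<close>
    have dd: "norm (P i x - P j x)^2 = (d (i+i) - d (i+j)) + (d (j+j) - d (i+j))" for i j
    proof -
      have *: "inner (P i x) (P j x) = d (i + j)" for i j by (simp only: d_def split)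
      show ?thesis unfolding norm_diff_sqr unfolding power2_norm_eq_inner * by simp
    qed
    have "Cauchy d" using dconv[of x] by (simp add: d_def Cauchy_convergent_iff)
    then obtain N where N: "\<And>i j. i \<ge> N \<Longrightarrow> j \<ge> N \<Longrightarrow> dist (d i) (d j) < e^2/2"
      using e metric_CauchyD[of d "e^2/2"] by auto
    have "dist (P i x) (P j x) < e" if "i \<ge> N" "j \<ge> N" for i j
    proof -
      have "norm (P i x - P j x)^2 < e^2"
      proof -
        have "dist (d (i+i)) (d (i+j)) < e^2/2" "dist (d (j+j)) (d (i+j)) < e^2/2"
          using N[of "i+i" "i+j"] N[of "j+j" "i+j"] that by simp_all
        then show ?thesis unfolding dd dist_real_def by linarith
      qed
      then show ?thesis using e power2_less_imp_less[of _ e] by (simp add: dist_norm)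
    qed
    then show "\<exists>M. \<forall>i\<ge>M. \<forall>j\<ge>M. dist (P i x) (P j x) < e" by blast
  qed
  then have "\<exists>l. (\<lambda>n. P n x) \<longlonglongrightarrow> l" for x by (simp add: Cauchy_convergent_iff convergent_def)
  then obtain L where L: "\<And>x. (\<lambda>n. P n x) \<longlonglongrightarrow> L x" by metis
  have Pn: "norm (P n x) \<le> norm x" for n x
  proof -
    have "inner y (P n y) \<le> inner y y" for n y
      by (induction n) (auto simp: P0 intro: order_trans[OF ddec])
    from this[of x "n+n"] show ?thesis
      by (simp add: split norm_le)
  qed
  have Ladd: "L (x + y) = L x + L y" for x y
    by (rule LIMSEQ_unique[OF L]) (auto simp: Plin intro!: tendsto_intros L)
  have Lsc: "L (r *\<^sub>R x) = r *\<^sub>R L x" for x r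
    by (rule LIMSEQ_unique[OF L]) (auto simp: Plin intro!: tendsto_intros L)
  have Ln: "norm (L x) \<le> norm x" for x
    by (rule LIMSEQ_le_const2[OF tendsto_norm[OF L]]) (auto simp: Pn)
  have bl: "bounded_linear L"
    by (rule bounded_linear_intro[where K=1]) (auto simp: Ladd Lsc Ln)
  define e where "e = Blinfun L"
  have e: "e x = L x" for x by (simp add: e_def bounded_linear_Blinfun_apply[OF bl])
  have cL: "c (L x) = L x" for x
  proof (rule LIMSEQ_unique)
    show "(\<lambda>n. c (P n x)) \<longlonglongrightarrow> c (L x)" by (intro tendsto_intros L)
    show "(\<lambda>n. c (P n x)) \<longlonglongrightarrow> L x" using LIMSEQ_Suc[OF L[of x]] by (simp add: PS)
  qed
  have fixL: "L x = x" if "c x = x" for x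
  proof -
    have "P n x = x" for n by (induction n) (auto simp: P0 PS that)
    then show ?thesis using L[of x] by (simp add: LIMSEQ_const_iff)
  qed
  have zc: "z x = 0 \<longleftrightarrow> c x = x" for x
  proof
    assume "c x = x"
    then have "inner x (z (z x)) = 0" by (simp add: c)
    then show "z x = 0" using symmetric_opD[OF z, of x "z x"] by simp
  qed (simp add: c blinfun.bilinear_simps)
  have "orth_proj e"
    unfolding orth_proj_def symmetric_op_def
  proof safe
    show "inner (e x) y = inner x (e y)" for x y
    proof (rule LIMSEQ_unique)
      show "(\<lambda>n. inner (P n x) y) \<longlonglongrightarrow> inner (e x) y" unfolding e by (intro tendsto_intros L)
      show "(\<lambda>n. inner (P n x) y) \<longlonglongrightarrow> inner x (e y)" unfolding e Psym by (intro tendsto_intros L)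
    qed
    show "e o\<^sub>L e = e" by (intro blinfun_eqI) (simp add: e fixL cL)
  qed
  moreover have "z x = 0 \<longleftrightarrow> e x = x" for x
    by (metis zc e cL fixL)
  moreover have "b o\<^sub>L e = e o\<^sub>L b" if bz: "b o\<^sub>L z = z o\<^sub>L b" for b
  proof (rule blinfun_eqI)
    fix x
    have "b (c x) = c (b x)" for x
      by (simp add: c blinfun.bilinear_simps commute_opD[OF bz])
    then have "b (P n x) = P n (b x)" for n by (induction n) (auto simp: P0 PS)
    then have "(\<lambda>n. b (P n x)) \<longlonglongrightarrow> L (b x)" using L[of "b x"] by simp
    moreover have "(\<lambda>n. b (P n x)) \<longlonglongrightarrow> b (L x)" by (intro tendsto_intros L)
    ultimately show "(b o\<^sub>L e) x = (e o\<^sub>L b) x" by (simp add: e LIMSEQ_unique)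
  qed
  ultimately show ?thesis by blast
qed

lemma ex_unit_scaling: "\<exists>r>0. norm (r *\<^sub>R (z::'a::real_normed_vector)) \<le> 1"
proof (cases "z = 0")
  case False
  then show ?thesis by (intro exI[of _ "inverse (norm z)"]) auto
qed (auto intro: exI[of _ 1])

lemma kernel_projection:
  fixes z :: "'a::{real_inner,banach} \<Rightarrow>\<^sub>L 'a"
  assumes z: "symmetric_op z"
  obtains e where "orth_proj e" "\<And>x. z x = 0 \<longleftrightarrow> e x = x"
    "\<And>b. b o\<^sub>L z = z o\<^sub>L b \<Longrightarrow> b o\<^sub>L e = e o\<^sub>L b"
proof -
  obtain r where r: "r > 0" "norm (r *\<^sub>R z) \<le> 1" using ex_unit_scaling by blast
  obtain e where e: "orth_proj e" "\<And>x. (r *\<^sub>R z) x = 0 \<longleftrightarrow> e x = x"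
    "\<And>b. b o\<^sub>L (r *\<^sub>R z) = (r *\<^sub>R z) o\<^sub>L b \<Longrightarrow> b o\<^sub>L e = e o\<^sub>L b"
    using kernel_projection_contraction[OF symmetric_op_scaleR[OF z] r(2)] by blast
  show ?thesis
    using r(1) e(2) by (intro that[OF e(1)] e(3)) (auto simp: blinfun.bilinear_simps blinfun_compose.scaleR_left blinfun_compose.scaleR_right)
qed

text \<open>\<open>\<bar>b\<bar> = 1 - w\<close> where \<open>w\<close> is the fixed point of \<open>w \<mapsto> (1 - b\<^sup>2 + w\<^sup>2) / 2\<close>; the scalar
  iteration \<open>r \<mapsto> (1 + r\<^sup>2) / 2\<close> is a convergent majorant.\<close>

lemma absolute_value_contraction:
  fixes b :: "'a::{real_inner,banach} \<Rightarrow>\<^sub>L 'a"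
  assumes b: "symmetric_op b" and nb: "norm b \<le> 1"
  shows "\<exists>y. symmetric_op y \<and> (\<forall>x. inner x (y x) \<ge> 0) \<and> y o\<^sub>L y = b o\<^sub>L b
    \<and> (\<forall>t. t o\<^sub>L b = b o\<^sub>L t \<longrightarrow> t o\<^sub>L y = y o\<^sub>L t)"
proof -
  define x where "x = id_blinfun - (b o\<^sub>L b)"
  have x: "x v = v - b (b v)" for v by (simp add: x_def blinfun.bilinear_simps)
  have ble: "norm (b v) \<le> norm v" for v
    by (rule norm_blinfun_contraction[OF nb])
  have nx: "norm x \<le> 1"
  proof (rule norm_blinfun_bound)
    fix v
    have "norm (x v)^2 = norm v^2 - 2 * norm (b v)^2 + norm (b (b v))^2"
      unfolding x norm_diff_sqr by (simp add: symmetric_opD[OF b] power2_norm_eq_inner)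
    also have "\<dots> \<le> norm v^2" using power_mono[OF ble[of "b v"] norm_ge_zero, of 2] zero_le_power2[of "norm (b v)"] by linarith
    finally show "norm (x v) \<le> 1 * norm v" using power2_le_imp_le[OF _ norm_ge_zero] by simp
  qed simp
  define w :: "nat \<Rightarrow> 'a \<Rightarrow>\<^sub>L 'a" where "w = rec_nat 0 (\<lambda>_ u. (1/2) *\<^sub>R (x + (u o\<^sub>L u)))"
  have w0: "w 0 = 0" and wS: "w (Suc n) = (1/2) *\<^sub>R (x + (w n o\<^sub>L w n))" for n by (simp_all add: w_def)
  define r :: "nat \<Rightarrow> real" where "r = rec_nat 0 (\<lambda>_ u. (1 + u^2) / 2)"
  have r0: "r 0 = 0" and rS: "r (Suc n) = (1 + r n^2) / 2" for n by (simp_all add: r_def)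
  have r01: "0 \<le> r n \<and> r n \<le> 1" for n
    by (induction n) (simp_all add: r0 rS power_le_one)
  have rinc: "r n \<le> r (Suc n)" for n
    unfolding rS using zero_le_power2[of "1 - r n"] by (simp add: power2_diff)
  have comm: "t o\<^sub>L w n = w n o\<^sub>L t" if tb: "t o\<^sub>L b = b o\<^sub>L t" for n t
  proof (induction n)
    case (Suc n)
    show ?case
      by (rule blinfun_eqI)
        (simp add: wS blinfun.bilinear_simps x commute_opD[OF Suc] commute_opD[OF tb])
  qed (auto intro: blinfun_eqI simp: w0 blinfun.bilinear_simps)
  have bw: "b o\<^sub>L w n = w n o\<^sub>L b" for n by (rule comm) simp
  have ww: "w i o\<^sub>L w j = w j o\<^sub>L w i" for i j by (rule comm, rule bw[symmetric])
  have nw: "norm (w n) \<le> r n" for n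
  proof (induction n)
    case (Suc n)
    have "norm (w n o\<^sub>L w n) \<le> norm (w n) * norm (w n)" by (rule norm_blinfun_compose)
    also have "\<dots> \<le> r n * r n" using Suc r01[of n] by (intro mult_mono) auto
    finally show ?case using norm_triangle_ineq[of x "w n o\<^sub>L w n"] nx
      by (simp add: wS rS power2_eq_square)
  qed (simp add: w0 r0)
  have step: "norm (w (Suc n) - w n) \<le> r (Suc n) - r n" for n
  proof (induction n)
    case (Suc n)
    \<comment> \<open>Since the iterates commute, the difference of squares factors; the scalar
      sequence r satisfies the same identity, so it keeps dominating.\<close>
    have eq: "w (Suc (Suc n)) - w (Suc n) = (1/2) *\<^sub>R ((w (Suc n) - w n) o\<^sub>L (w (Suc n) + w n))"
      unfolding wS[of "Suc n"] wS[of n, symmetric]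
      apply (subst (3) wS[of n])
      by (rule blinfun_eqI) (simp add: blinfun.bilinear_simps commute_opD[OF ww[of n "Suc n"]] algebra_simps)
    have "norm (w (Suc n) + w n) \<le> r (Suc n) + r n"
      by (rule order_trans[OF norm_triangle_ineq]) (intro add_mono nw)
    then have "norm ((w (Suc n) - w n) o\<^sub>L (w (Suc n) + w n)) \<le> (r (Suc n) - r n) * (r (Suc n) + r n)"
      using Suc r01[of n] r01[of "Suc n"] rinc[of n]
      by (intro order_trans[OF norm_blinfun_compose] mult_mono) auto
    then have "norm (w (Suc (Suc n)) - w (Suc n)) \<le> (r (Suc n) - r n) * (r (Suc n) + r n) / 2"
      by (simp add: eq)
    also have "\<dots> = r (Suc (Suc n)) - r (Suc n)"
      unfolding rS[of "Suc n"] using rS[of n] by (simp add: power2_eq_square field_simps)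
    finally show ?case .
  qed (use nx in \<open>simp add: wS w0 r0 rS\<close>)
  have dist_w: "norm (w (n + k) - w n) \<le> r (n + k) - r n" for n k
  proof (induction k)
    case (Suc k)
    have "w (n + Suc k) - w n = (w (Suc (n + k)) - w (n + k)) + (w (n + k) - w n)" by simp
    then have "norm (w (n + Suc k) - w n) \<le> norm (w (Suc (n + k)) - w (n + k)) + norm (w (n + k) - w n)"
      using norm_triangle_ineq by metis
    then show ?case using step[of "n+k"] Suc by simp
  qed simp
  have "convergent r"
  proof (rule Bseq_monoseq_convergent)
    show "Bseq r" by (rule BseqI'[where K=1]) (use r01 in auto)
    show "monoseq r" by (intro incseq_imp_monoseq incseq_SucI rinc)
  qed
  then have "Cauchy r" by (simp add: Cauchy_convergent_iff)
  have "Cauchy w"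
  proof (rule CauchyI')
    fix e :: real assume "e > 0"
    then obtain N where N: "\<And>i j. i \<ge> N \<Longrightarrow> j \<ge> N \<Longrightarrow> norm (r i - r j) < e"
      using CauchyD[OF \<open>Cauchy r\<close>] by blast
    have "norm (w i - w j) < e" if "i \<ge> N" "j > i" for i j
      using N[of j i] dist_w[of i "j - i"] that by (simp add: norm_minus_commute)
    then show "\<exists>M. \<forall>m\<ge>M. \<forall>n>m. dist (w m) (w n) < e"
      unfolding dist_norm by blast
  qed
  then obtain W where W: "w \<longlonglongrightarrow> W" by (auto simp: Cauchy_convergent_iff convergent_def)
  have Wv: "(\<lambda>n. w n v) \<longlonglongrightarrow> W v" for v by (rule blinfun.tendsto[OF W tendsto_const])
  have fp: "W = (1/2) *\<^sub>R (x + (W o\<^sub>L W))"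
  proof (rule LIMSEQ_unique)
    show "(\<lambda>n. w (Suc n)) \<longlonglongrightarrow> W" by (rule LIMSEQ_Suc[OF W])
    show "(\<lambda>n. w (Suc n)) \<longlonglongrightarrow> (1/2) *\<^sub>R (x + (W o\<^sub>L W))"
      unfolding wS by (intro tendsto_intros W bounded_bilinear.tendsto[OF bounded_bilinear_blinfun_compose])
  qed
  have WW: "W v + W v = x v + W (W v)" for v
    using arg_cong[OF fp, of "\<lambda>T. 2 *\<^sub>R blinfun_apply T v"] by (simp add: blinfun.bilinear_simps scaleR_2)
  have Wn: "norm W \<le> 1"
    by (rule LIMSEQ_le_const2[OF tendsto_norm[OF W]]) (meson nw r01 order_trans)
  have wsym: "symmetric_op (w n)" for n
    by (induction n) (simp_all add: w0 wS symmetric_op_def blinfun.bilinear_simps inner_add x inner_diff symmetric_opD[OF b])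
  have Wsym: "symmetric_op W"
    unfolding symmetric_op_def
  proof safe
    fix u v
    show "inner (W u) v = inner u (W v)"
    proof (rule LIMSEQ_unique)
      show "(\<lambda>n. inner (w n u) v) \<longlonglongrightarrow> inner (W u) v" by (intro tendsto_intros Wv)
      show "(\<lambda>n. inner (w n u) v) \<longlonglongrightarrow> inner u (W v)"
        unfolding symmetric_opD[OF wsym] by (intro tendsto_intros Wv)
    qed
  qed
  have "symmetric_op (id_blinfun - W)" by (intro symmetric_op_diff symmetric_op_id Wsym)
  moreover have "inner v ((id_blinfun - W) v) \<ge> 0" for v
  proof -
    have "inner v (W v) \<le> norm v * norm (W v)" by (rule norm_cauchy_schwarz)
    also have "\<dots> \<le> norm v * (1 * norm v)"
      by (intro mult_left_mono order_trans[OF norm_blinfun] mult_right_mono Wn) auto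
    finally show ?thesis by (simp add: blinfun.bilinear_simps inner_diff power2_norm_eq_inner[symmetric] power2_eq_square)
  qed
  moreover have "(id_blinfun - W) o\<^sub>L (id_blinfun - W) = b o\<^sub>L b"
  proof (rule blinfun_eqI)
    fix v show "((id_blinfun - W) o\<^sub>L (id_blinfun - W)) v = (b o\<^sub>L b) v"
      using WW[of v] by (simp add: blinfun.bilinear_simps x algebra_simps)
  qed
  moreover have "t o\<^sub>L (id_blinfun - W) = (id_blinfun - W) o\<^sub>L t" if tb: "t o\<^sub>L b = b o\<^sub>L t" for t
  proof (rule blinfun_eqI)
    fix v
    have "t (W v) = W (t v)"
    proof (rule LIMSEQ_unique)
      show "(\<lambda>n. t (w n v)) \<longlonglongrightarrow> t (W v)" by (intro tendsto_intros Wv)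
      show "(\<lambda>n. t (w n v)) \<longlonglongrightarrow> W (t v)" using Wv[of "t v"] by (simp add: commute_opD[OF comm[OF tb]])
    qed
    then show "(t o\<^sub>L (id_blinfun - W)) v = ((id_blinfun - W) o\<^sub>L t) v" by (simp add: blinfun.bilinear_simps)
  qed
  ultimately show ?thesis by blast
qed

lemma absolute_value:
  fixes b :: "'a::{real_inner,banach} \<Rightarrow>\<^sub>L 'a"
  assumes b: "symmetric_op b"
  obtains y where "symmetric_op y" "\<And>x. inner x (y x) \<ge> 0" "y o\<^sub>L y = b o\<^sub>L b"
    "\<And>t. t o\<^sub>L b = b o\<^sub>L t \<Longrightarrow> t o\<^sub>L y = y o\<^sub>L t"
proof -
  obtain r where r: "r > 0" "norm (r *\<^sub>R b) \<le> 1" using ex_unit_scaling by blast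
  obtain y where y: "symmetric_op y" "\<And>x. inner x (y x) \<ge> 0" "y o\<^sub>L y = (r *\<^sub>R b) o\<^sub>L (r *\<^sub>R b)"
    "\<And>t. t o\<^sub>L (r *\<^sub>R b) = (r *\<^sub>R b) o\<^sub>L t \<Longrightarrow> t o\<^sub>L y = y o\<^sub>L t"
    using absolute_value_contraction[OF symmetric_op_scaleR[OF b] r(2)] by blast
  show ?thesis
  proof
    show "symmetric_op (inverse r *\<^sub>R y)" by (rule symmetric_op_scaleR[OF y(1)])
    show "inner x ((inverse r *\<^sub>R y) x) \<ge> 0" for x
      using r(1) y(2)[of x] by (simp add: blinfun.bilinear_simps)
    show "(inverse r *\<^sub>R y) o\<^sub>L (inverse r *\<^sub>R y) = b o\<^sub>L b"
    proof -
      have "inverse r * (inverse r * (r * r)) = 1" using r(1) by (simp add: field_simps)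
      then show ?thesis by (simp add: blinfun_compose.scaleR_left blinfun_compose.scaleR_right y(3))
    qed
    show "t o\<^sub>L (inverse r *\<^sub>R y) = (inverse r *\<^sub>R y) o\<^sub>L t" if "t o\<^sub>L b = b o\<^sub>L t" for t
      using y(4)[of t] that by (simp add: blinfun_compose.scaleR_left blinfun_compose.scaleR_right)
  qed
qed

text \<open>The form of y is minimal at x, so its first variation in the direction
  \<open>y x\<close> vanishes; that variation is 2 |y x|^2.\<close>

lemma positive_form_zero:
  fixes y :: "'a::real_inner \<Rightarrow>\<^sub>L 'a"
  assumes y: "symmetric_op y" and pos: "\<And>x. inner x (y x) \<ge> 0" and 0: "inner x (y x) = 0"
  shows "y x = 0"
proof -
  have "0 \<le> t * (2 * inner (y x) (y x)) + t^2 * inner (y x) (y (y x))" for t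
    using pos[of "x + t *\<^sub>R y x"] 0
    by (simp add: blinfun.bilinear_simps inner_add symmetric_opD[OF y] algebra_simps power2_eq_square)
  from quadratic_nonneg_imp_linear_zero[OF this] show ?thesis by simp
qed

text \<open>Describes the spectral projection of (s, infinity) without a spectral measure. The weak
  inequality on the kernel and the strict one on the range put eigenvectors for s into the kernel,
  which is what makes the half-line open.\<close>

definition cut_proj :: "('a::real_inner \<Rightarrow>\<^sub>L 'a) \<Rightarrow> real \<Rightarrow> ('a \<Rightarrow>\<^sub>L 'a) \<Rightarrow> bool" where
  "cut_proj a s p \<longleftrightarrow> orth_proj p \<and> p o\<^sub>L a = a o\<^sub>L p \<and>
     (\<forall>x. p x = 0 \<longrightarrow> inner x (a x) \<le> s * inner x x) \<and>
     (\<forall>x. p x = x \<longrightarrow> x \<noteq> 0 \<longrightarrow> inner x (a x) > s * inner x x)"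

text \<open>If \<open>e\<close> projects onto the kernel of \<open>\<bar>b\<bar> + b\<close> for \<open>b = a - s\<close>, then
  \<open>eb = - e\<bar>b\<bar>\<close> and \<open>(1 - e)b = (1 - e)\<bar>b\<bar>\<close>, because \<open>(\<bar>b\<bar> + b)(\<bar>b\<bar> - b) = 0\<close>.\<close>

lemma cut_proj_exists:
  fixes a :: "'a::{real_inner,banach} \<Rightarrow>\<^sub>L 'a"
  assumes a: "symmetric_op a"
  shows "\<exists>p. cut_proj a s p \<and> (\<forall>t. t o\<^sub>L a = a o\<^sub>L t \<longrightarrow> t o\<^sub>L p = p o\<^sub>L t)"
proof -
  define b where "b = a - s *\<^sub>R id_blinfun"
  have bx: "b x = a x - s *\<^sub>R x" for x by (simp add: b_def blinfun.bilinear_simps)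
  have b: "symmetric_op b" by (simp add: b_def symmetric_op_diff symmetric_op_scaleR symmetric_op_id a)
  have tb: "t o\<^sub>L b = b o\<^sub>L t" if "t o\<^sub>L a = a o\<^sub>L t" for t
    by (rule blinfun_eqI) (simp add: bx blinfun.bilinear_simps commute_opD[OF that])
  obtain y where y: "symmetric_op y" "\<And>x. inner x (y x) \<ge> 0" "y o\<^sub>L y = b o\<^sub>L b"
    "\<And>t. t o\<^sub>L b = b o\<^sub>L t \<Longrightarrow> t o\<^sub>L y = y o\<^sub>L t"
    using absolute_value[OF b] by blast
  obtain e where e: "orth_proj e" "\<And>x. (y + b) x = 0 \<longleftrightarrow> e x = x"
    "\<And>t. t o\<^sub>L (y + b) = (y + b) o\<^sub>L t \<Longrightarrow> t o\<^sub>L e = e o\<^sub>L t"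
    using kernel_projection[OF symmetric_op_add[OF y(1) b]] by blast
  have te: "t o\<^sub>L e = e o\<^sub>L t" if "t o\<^sub>L a = a o\<^sub>L t" for t
    using e(3)[of t] y(4)[OF tb[OF that]] tb[OF that]
    by (simp add: blinfun_compose.add_left blinfun_compose.add_right)
  have b_y: "b (y x) = y (b x)" for x using y(4)[of b] by (simp add: commute_opD)
  have yy: "y (y x) = b (b x)" for x using y(3) by (metis blinfun_apply_blinfun_compose)
  have ker: "(y + b) (y x - b x) = 0" for x
    by (simp add: blinfun.bilinear_simps yy b_y)
  define p where "p = id_blinfun - e"
  have px: "p x = x - e x" for x by (simp add: p_def blinfun.bilinear_simps)
  have tp: "t o\<^sub>L p = p o\<^sub>L t" if "t o\<^sub>L a = a o\<^sub>L t" for t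
    by (rule blinfun_eqI) (simp add: px blinfun.bilinear_simps commute_opD[OF te[OF that]])
  have pp: "orth_proj p" unfolding p_def by (rule orth_proj_compl[OF e(1)])
  have low: "inner x (b x) \<le> 0" if "p x = 0" for x
  proof -
    have "(y + b) x = 0" using that by (simp add: e(2) px)
    then have "b x = - y x" by (simp add: blinfun.bilinear_simps add_eq_0_iff)
    then show ?thesis using y(2)[of x] by simp
  qed
  have up: "inner x (b x) > 0" if "p x = x" "x \<noteq> 0" for x
  proof -
    have ex: "e x = 0" using that by (simp add: px)
    have "inner x (y x - b x) = inner x (e (y x - b x))" using ker[of x] e(2) by metis
    also have "\<dots> = 0" using ex by (simp add: orth_projD(2)[OF e(1), symmetric])
    finally have eq: "inner x (b x) = inner x (y x)" by (simp add: inner_diff)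
    \<comment> \<open>If the form vanished, both y and b would kill x, so x would lie in the kernel
      of y + b, that is, in the range of e, although \<open>e x = 0\<close>.\<close>
    have "inner x (y x) \<noteq> 0"
    proof
      assume "inner x (y x) = 0"
      then have yx: "y x = 0" using positive_form_zero[OF y(1,2)] by blast
      then have "inner x (b (b x)) = 0" by (simp add: yy[symmetric])
      then have "b x = 0" using symmetric_opD[OF b, of x "b x"] by simp
      then show False using yx e(2)[of x] ex that by (simp add: blinfun.bilinear_simps)
    qed
    then show ?thesis using y(2)[of x] eq by simp
  qed
  have "cut_proj a s p"
    unfolding cut_proj_def using pp tp[of a] low up by (auto simp: bx inner_diff)
  then show ?thesis using tp by blast
qed

text \<open>For \<open>s = t\<close> this gives uniqueness, for \<open>s < t\<close> monotonicity.\<close>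

lemma cut_proj_le:
  assumes p: "cut_proj a s p" and q: "cut_proj a t q" and st: "s \<le> t" and comm: "p o\<^sub>L q = q o\<^sub>L p"
  shows "p o\<^sub>L q = q"
proof (rule blinfun_eqI)
  fix x
  \<comment> \<open>v lies in the range of q and in the kernel of p, so a nonzero v would have form
    both above t |v|^2 and at most s |v|^2.\<close>
  define v where "v = q x - p (q x)"
  have P: "orth_proj p" "orth_proj q" using p q by (auto simp: cut_proj_def)
  have "q v = v" by (simp add: v_def blinfun.bilinear_simps commute_opD[OF comm, symmetric] orth_projD(1)[OF P(2)])
  moreover have "p v = 0" by (simp add: v_def blinfun.bilinear_simps orth_projD(1)[OF P(1)])
  moreover have "s * inner v v \<le> t * inner v v" using st by (simp add: mult_right_mono)
  ultimately have "v = 0" using p q unfolding cut_proj_def by force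
  then show "(p o\<^sub>L q) x = q x" by (simp add: v_def)
qed

definition upcut :: "('a::real_inner \<Rightarrow>\<^sub>L 'a) \<Rightarrow> real \<Rightarrow> ('a \<Rightarrow>\<^sub>L 'a)" where
  "upcut a s = (THE p. cut_proj a s p)"

text \<open>The projection built above commutes with everything commuting with a, in particular with
  any other cut projection at s; \<open>cut_proj_le\<close> then applies in both directions and
  gives uniqueness.\<close>

lemma
  fixes a :: "'a::{real_inner,banach} \<Rightarrow>\<^sub>L 'a"
  assumes a: "symmetric_op a"
  shows cut_proj_cut: "cut_proj a s (upcut a s)"
    and cut_eqI: "cut_proj a s q \<Longrightarrow> upcut a s = q"
    and cut_commute: "t o\<^sub>L a = a o\<^sub>L t \<Longrightarrow> t o\<^sub>L upcut a s = upcut a s o\<^sub>L t"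
proof -
  obtain p where p: "cut_proj a s p" "\<And>t. t o\<^sub>L a = a o\<^sub>L t \<Longrightarrow> t o\<^sub>L p = p o\<^sub>L t"
    using cut_proj_exists[OF a] by blast
  have uniq: "q = p" if q: "cut_proj a s q" for q
  proof -
    have "q o\<^sub>L p = p o\<^sub>L q" using q p(2) by (auto simp: cut_proj_def)
    then show ?thesis using cut_proj_le[OF q p(1)] cut_proj_le[OF p(1) q] by simp
  qed
  have c: "upcut a s = p" unfolding upcut_def using p(1) uniq by (rule the_equality)
  show "cut_proj a s (upcut a s)" "t o\<^sub>L a = a o\<^sub>L t \<Longrightarrow> t o\<^sub>L upcut a s = upcut a s o\<^sub>L t"
    unfolding c by (fact p)+
  show "upcut a s = q" if "cut_proj a s q" using uniq[OF that] c by simp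
qed

section \<open>Adjoints and self-adjoint operators\<close>

lemma inner_scaleC_i: "inner x (\<i> *\<^sub>C y) = - Im (cinner x y)"
  by (simp add: inner_eq_Re_cinner cinner_scaleC_right)

lemma inner_scaleC_i_left: "inner (\<i> *\<^sub>C x) y = Im (cinner x y)"
  by (metis cinner_commute complex_cnj inner_commute inner_scaleC_i complex.sel(2) complex_surj minus_minus)

text \<open>The imaginary part of the complex inner product is the real inner product taken after
  multiplying the left vector by i, so two real identities suffice.\<close>

lemma cinner_eqI:
  assumes "inner x y = inner x' y'" "inner (\<i> *\<^sub>C x) y = inner (\<i> *\<^sub>C x') y'"
  shows "cinner x y = cinner x' y'"
  using assms by (simp add: complex_eq_iff inner_eq_Re_cinner[symmetric] inner_scaleC_i_left)

lemma scaleC_i_i: "\<i> *\<^sub>C \<i> *\<^sub>C x = - (x :: 'a::chilbert_space)"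
  by (metis scaleC_scaleC complex_i_mult_minus i_squared mult.right_neutral of_real_1 of_real_minus
      scaleC_of_real scaleR_minus1_left)

lemma inner_scaleC_i_both: "inner (\<i> *\<^sub>C x) (\<i> *\<^sub>C y) = inner x y"
  by (simp only: inner_scaleC_i_left cinner_scaleC_right) (simp add: inner_eq_Re_cinner)

lemma eq_if_inner_eq: "(\<And>x. inner x (u::'a::real_inner) = inner x v) \<Longrightarrow> u = v"
  by (metis inner_diff_right inner_eq_zero_iff right_minus_eq)

lemma bounded_opsD: "a \<in> bounded_ops \<Longrightarrow> blinfun_apply a (c *\<^sub>C x) = c *\<^sub>C blinfun_apply a x"
  by (simp add: bounded_ops_def)

lemma adjoint_exists:
  assumes a: "a \<in> bounded_ops"
  shows "\<exists>b :: 'h::chilbert_space oper. \<forall>x y. inner (a x) y = inner x (b y)"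
proof -
  have "\<exists>u. \<forall>x. inner (a x) y = inner u x" for y
    by (rule riesz_representation)
       (intro bounded_linear_intros)
  then obtain B where B: "\<And>x y. inner (a x) y = inner (B y) x" by metis
  have "bounded_linear B"
  proof (rule bounded_linear_intro)
    show "B (y + z) = B y + B z" for y z
      by (rule eq_if_inner_eq) (simp add: inner_add B[symmetric] inner_commute[of _ "B _"])
    show "B (r *\<^sub>R y) = r *\<^sub>R B y" for r y
      by (rule eq_if_inner_eq) (simp add: B[symmetric] inner_commute[of _ "B _"])
    show "norm (B y) \<le> norm y * norm a" for y
    proof -
      have "norm (B y)^2 = inner (a (B y)) y" by (simp add: B power2_norm_eq_inner)
      also have "\<dots> \<le> norm (a (B y)) * norm y" by (rule norm_cauchy_schwarz)
      also have "\<dots> \<le> (norm a * norm (B y)) * norm y" by (intro mult_right_mono norm_blinfun) simp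
      finally show ?thesis by (cases "B y = 0") (auto simp: power2_eq_square algebra_simps)
    qed
  qed
  then have "\<forall>x y. inner (a x) y = inner x (Blinfun B y)"
    by (metis bounded_linear_Blinfun_apply B inner_commute)
  then show ?thesis by blast
qed

text \<open>The real adjoint supplied by the Riesz theorem is the complex one: complex linearity of
  a lets the real identity be tested at i times x as well.\<close>

lemma
  fixes a :: "'h::chilbert_space oper"
  assumes a: "a \<in> bounded_ops"
  shows inner_adj: "inner (a x) y = inner x (adj a y)"
    and adj_eqI: "(\<And>x y. inner (a x) y = inner x (blinfun_apply b y)) \<Longrightarrow> adj a = b"
proof -
  obtain b :: "'h oper" where b: "\<And>x y. inner (a x) y = inner x (b y)"
    using adjoint_exists[OF a] by blast
  have "adj a = b"
    unfolding adj_def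
  proof (rule the_equality)
    show "\<forall>x y. cinner (a x) y = cinner x (b y)"
    proof (intro allI)
      fix x y
      have "inner (\<i> *\<^sub>C a x) y = inner (\<i> *\<^sub>C x) (b y)"
        by (metis b bounded_opsD[OF a])
      then show "cinner (a x) y = cinner x (b y)" by (rule cinner_eqI[OF b])
    qed
    show "c = b" if "\<forall>x y. cinner (a x) y = cinner x (blinfun_apply c y)" for c
    proof (rule blinfun_eqI, rule eq_if_inner_eq)
      show "inner x (c y) = inner x (b y)" for x y
        using that b by (metis inner_eq_Re_cinner)
    qed
  qed
  then show *: "inner (a x) y = inner x (adj a y)" for x y by (simp add: b)
  show "adj a = b'" if "\<And>x y. inner (a x) y = inner x (blinfun_apply b' y)" for b'
    by (rule blinfun_eqI, rule eq_if_inner_eq) (metis * that)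
qed

lemma selfadjoint_iff: "selfadjoint a \<longleftrightarrow> a \<in> bounded_ops \<and> symmetric_op a"
  unfolding selfadjoint_def symmetric_op_def using inner_adj[of a] adj_eqI[of a a] by metis

text \<open>On a complex space positivity forces symmetry. The imaginary part of the form vanishes
  identically; polarising this and replacing one vector by i times another yields the symmetry of
  a.\<close>

lemma positive_op_iff:
  fixes a :: "'h::chilbert_space oper"
  shows "positive_op a \<longleftrightarrow> selfadjoint a \<and> (\<forall>x. inner x (a x) \<ge> 0)"
proof
  assume a: "positive_op a"
  then have bo: "a \<in> bounded_ops" by (simp add: positive_op_def)
  have pos: "inner x (a x) \<ge> 0" and "Im (cinner x (a x)) = 0" for x
    using a by (auto simp: positive_op_def inner_eq_Re_cinner complex_nonneg_Reals_iff)
  then have im: "inner x (\<i> *\<^sub>C a x) = 0" for x by (simp add: inner_scaleC_i)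
  have "inner x (\<i> *\<^sub>C a y) + inner y (\<i> *\<^sub>C a x) = 0" for x y
    using im[of "x + y"] im[of x] im[of y]
    by (simp add: blinfun.bilinear_simps scaleC_add_right inner_add)
  from this[of _ "\<i> *\<^sub>C _"] have "inner x (a z) = inner z (a x)" for x z
    by (simp add: bounded_opsD[OF bo] scaleC_i_i inner_scaleC_i_both)
  then show "selfadjoint a \<and> (\<forall>x. inner x (a x) \<ge> 0)"
    using bo pos by (auto simp: selfadjoint_iff symmetric_op_def inner_commute)
next
  assume a: "selfadjoint a \<and> (\<forall>x. inner x (a x) \<ge> 0)"
  then have bo: "a \<in> bounded_ops" and s: "symmetric_op a" by (auto simp: selfadjoint_iff)
  have "inner x (\<i> *\<^sub>C a x) = - inner (\<i> *\<^sub>C x) (a x)" for x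
    by (simp add: inner_scaleC_i inner_scaleC_i_left)
  moreover have "inner x (\<i> *\<^sub>C a x) = inner (\<i> *\<^sub>C x) (a x)" for x
    using symmetric_opD[OF s, of x "\<i> *\<^sub>C x"] by (simp add: bounded_opsD[OF bo] inner_commute)
  ultimately have "Im (cinner x (a x)) = 0" for x
    using inner_scaleC_i[of x "a x"] by (metis add.inverse_neutral equal_neg_zero minus_minus)
  then show "positive_op a"
    using a bo by (simp add: positive_op_def inner_eq_Re_cinner complex_nonneg_Reals_iff)
qed

lemma projection_iff: "projection p \<longleftrightarrow> p \<in> bounded_ops \<and> orth_proj p"
  by (auto simp: projection_def selfadjoint_iff orth_proj_def)

lemma scaleC_op_apply [simp]: "blinfun_apply (scaleC_op c a) x = c *\<^sub>C blinfun_apply a x"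
  by (simp add: scaleC_op.rep_eq)

lemma scaleC_op_of_real: "scaleC_op (of_real r) a = r *\<^sub>R a"
  by (rule blinfun_eqI) (simp add: scaleC_of_real blinfun.bilinear_simps)

text \<open>Turns complex linearity into a commutation relation, so a projection commuting with
  everything that commutes with a complex-linear a is complex-linear itself.\<close>

lemma bounded_ops_iff_commute:
  "a \<in> bounded_ops \<longleftrightarrow> (\<forall>c. scaleC_op c id_blinfun o\<^sub>L a = a o\<^sub>L scaleC_op c id_blinfun)"
proof
  assume "a \<in> bounded_ops"
  then show "\<forall>c. scaleC_op c id_blinfun o\<^sub>L a = a o\<^sub>L scaleC_op c id_blinfun"
    by (auto intro!: blinfun_eqI simp: bounded_opsD)
next
  assume *: "\<forall>c. scaleC_op c id_blinfun o\<^sub>L a = a o\<^sub>L scaleC_op c id_blinfun"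
  have "a (c *\<^sub>C x) = c *\<^sub>C a x" for c x
    using commute_opD[of "scaleC_op c id_blinfun" a x] * by simp
  then show "a \<in> bounded_ops" by (simp add: bounded_ops_def)
qed

lemma cut_bounded_ops:
  fixes a :: "'h::chilbert_space oper"
  shows "selfadjoint a \<Longrightarrow> upcut a s \<in> bounded_ops"
  by (auto simp: selfadjoint_iff bounded_ops_iff_commute cut_commute)

lemma cut_eq_0:
  fixes a :: "'a::{real_inner,banach} \<Rightarrow>\<^sub>L 'a"
  assumes "symmetric_op a" "\<And>x. inner x (a x) \<le> s * inner x x"
  shows "upcut a s = 0"
  using assms(2) by (intro cut_eqI[OF assms(1)])
    (auto simp: cut_proj_def orth_proj_def symmetric_op_def blinfun.bilinear_simps)

lemma cut_eq_id:
  fixes a :: "'a::{real_inner,banach} \<Rightarrow>\<^sub>L 'a"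
  assumes "symmetric_op a" "\<And>x. x \<noteq> 0 \<Longrightarrow> s * inner x x < inner x (a x)"
  shows "upcut a s = id_blinfun"
  using assms(2) by (intro cut_eqI[OF assms(1)])
    (auto simp: cut_proj_def orth_proj_def symmetric_op_id intro!: blinfun_eqI)

lemma abs_inner_blinfun_le: "\<bar>inner x (blinfun_apply a x)\<bar> \<le> norm a * inner x (x::'a::real_inner)"
proof -
  have "\<bar>inner x (a x)\<bar> \<le> norm x * norm (a x)" by (rule Cauchy_Schwarz_ineq2)
  also have "\<dots> \<le> norm x * (norm a * norm x)" by (intro mult_left_mono norm_blinfun) simp
  finally show ?thesis by (simp add: power2_norm_eq_inner[symmetric] power2_eq_square algebra_simps)
qed

lemma cut_above_norm:
  fixes a :: "'a::{real_inner,banach} \<Rightarrow>\<^sub>L 'a"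
  assumes a: "symmetric_op a" and s: "norm a \<le> s"
  shows "upcut a s = 0"
proof (rule cut_eq_0[OF a])
  fix x show "inner x (a x) \<le> s * inner x x"
    using abs_inner_blinfun_le[of x a] mult_right_mono[OF s inner_ge_zero[of x]] by linarith
qed

lemma cut_below_norm:
  fixes a :: "'a::{real_inner,banach} \<Rightarrow>\<^sub>L 'a"
  assumes a: "symmetric_op a" and s: "s < - norm a"
  shows "upcut a s = id_blinfun"
proof (rule cut_eq_id[OF a])
  fix x :: 'a assume "x \<noteq> 0"
  then have "s * inner x x < - norm a * inner x x" using s by (intro mult_strict_right_mono) auto
  then show "s * inner x x < inner x (a x)" using abs_inner_blinfun_le[of x a] by simp
qed

lemma
  fixes a :: "'a::{real_inner,banach} \<Rightarrow>\<^sub>L 'a"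
  assumes a: "symmetric_op a"
  shows orth_proj_cut: "orth_proj (upcut a s)"
    and cut_commute_self: "upcut a s o\<^sub>L a = a o\<^sub>L upcut a s"
    and cut_zero_le: "upcut a s x = 0 \<Longrightarrow> inner x (a x) \<le> s * inner x x"
    and cut_fix_gt: "upcut a s x = x \<Longrightarrow> x \<noteq> 0 \<Longrightarrow> s * inner x x < inner x (a x)"
    and cut_antimono: "s \<le> t \<Longrightarrow> upcut a s o\<^sub>L upcut a t = upcut a t"
proof -
  note c = cut_proj_cut[OF a]
  show "orth_proj (upcut a s)" and 1: "upcut a s o\<^sub>L a = a o\<^sub>L upcut a s" for s
    using c[of s] by (auto simp: cut_proj_def)
  have 2: "upcut a s o\<^sub>L upcut a t = upcut a t o\<^sub>L upcut a s"
    by (rule cut_commute[OF a 1])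
  show "upcut a s x = 0 \<Longrightarrow> inner x (a x) \<le> s * inner x x"
    and "upcut a s x = x \<Longrightarrow> x \<noteq> 0 \<Longrightarrow> s * inner x x < inner x (a x)"
    using c[of s] by (auto simp: cut_proj_def)
  show "upcut a s o\<^sub>L upcut a t = upcut a t" if "s \<le> t"
    by (rule cut_proj_le[OF c c that 2])
qed

section \<open>Order, orthogonality and limits of orthogonal projections\<close>

lemma orth_proj_le_commute:
  assumes "orth_proj p" "orth_proj q" "p o\<^sub>L q = q"
  shows "q o\<^sub>L p = q"
proof (rule blinfun_eqI, rule eq_if_inner_eq)
  fix x y
  have "p (q x) = q x" for x using assms(3) by (metis blinfun_apply_blinfun_compose)
  then show "inner y ((q o\<^sub>L p) x) = inner y (q x)"
    by (simp add: orth_projD(2)[OF assms(1), symmetric] orth_projD(2)[OF assms(2), symmetric])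
qed

lemma orth_proj_diff:
  assumes "orth_proj p" "orth_proj q" "p o\<^sub>L q = q"
  shows "orth_proj (p - q)" and "norm (p x - q x)^2 = norm (p x)^2 - norm (q x)^2"
proof -
  have *: "p (q x) = q x" "q (p x) = q x" for x
    using assms(3) orth_proj_le_commute[OF assms] by (metis blinfun_apply_blinfun_compose)+
  show P: "orth_proj (p - q)"
    using assms(1,2) by (auto simp: orth_proj_def[of "p - q"] blinfun.bilinear_simps * orth_projD(1)
        intro!: blinfun_eqI symmetric_op_diff) (simp_all add: orth_proj_def)
  show "norm (p x - q x)^2 = norm (p x)^2 - norm (q x)^2"
    using orth_proj_norm_sqr[OF P, of x] orth_proj_norm_sqr[OF assms(1), of x] orth_proj_norm_sqr[OF assms(2), of x]
    by (simp add: blinfun.bilinear_simps inner_diff)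
qed

text \<open>Equal norms mean that q kills the kernel of p, so q (p x) = q x; Pythagoras for q at p x
  then leaves no room for a difference. Projections can thus be identified from scalar measures
  alone.\<close>

lemma orth_proj_eqI:
  fixes p q :: "'a::real_inner \<Rightarrow>\<^sub>L 'a"
  assumes "orth_proj p" "orth_proj q" "\<And>x. norm (p x) = norm (q x)"
  shows "p = q"
proof (rule blinfun_eqI)
  fix x
  have "q y = 0" if "p y = 0" for y using assms(3)[of y] that by simp
  from this[of "x - p x"] have 1: "q (p x) = q x"
    by (simp add: blinfun.bilinear_simps orth_projD(1)[OF assms(1)])
  have "norm (p x)^2 = norm (q (p x))^2 + norm (p x - q (p x))^2"
    by (rule orth_proj_pythagoras[OF assms(2)])
  then show "p x = q x" using 1 assms(3)[of x] by simp
qed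

text \<open>At the vector p x the first summand already exhausts the right-hand side.\<close>

lemma orth_proj_orthogonal:
  assumes "orth_proj p" "orth_proj q" "\<And>x. norm (p x)^2 + norm (q x)^2 \<le> norm x^2"
  shows "q (p x) = 0"
  using assms(3)[of "p x"] by (simp add: orth_projD(1)[OF assms(1)])

text \<open>The squared norms of S n x increase and stay below |x|^2, and the squared distance of
  two terms is the difference of their squared norms, so S n x is Cauchy.\<close>

lemma increasing_projections_converge:
  fixes S :: "nat \<Rightarrow> 'a::{real_inner,banach} \<Rightarrow>\<^sub>L 'a"
  assumes S: "\<And>n. orth_proj (S n)" and le: "\<And>n m. n \<le> m \<Longrightarrow> S m o\<^sub>L S n = S n"
  obtains P where "orth_proj P" "\<And>x. (\<lambda>n. S n x) \<longlonglongrightarrow> P x"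
    "\<And>t. (\<And>n. t o\<^sub>L S n = S n o\<^sub>L t) \<Longrightarrow> t o\<^sub>L P = P o\<^sub>L t" "\<And>n. S n o\<^sub>L P = S n"
proof -
  have d: "norm (S m x - S n x)^2 = norm (S m x)^2 - norm (S n x)^2" if "n \<le> m" for n m x
    by (rule orth_proj_diff[OF S S le[OF that]])
  have "convergent (\<lambda>n. S n x)" for x
  proof -
    have mono: "norm (S n x)^2 \<le> norm (S m x)^2" if "n \<le> m" for n m
      using d[OF that, of x] zero_le_power2[of "norm (S m x - S n x)"] by linarith
    have "convergent (\<lambda>n. norm (S n x)^2)"
    proof (rule Bseq_monoseq_convergent)
      show "Bseq (\<lambda>n. norm (S n x)^2)"
        by (rule BseqI'[where K="norm x^2"]) (auto intro: power_mono orth_proj_norm_le S)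
      show "monoseq (\<lambda>n. norm (S n x)^2)" unfolding monoseq_def using mono by blast
    qed
    then have C: "Cauchy (\<lambda>n. norm (S n x)^2)" by (simp add: Cauchy_convergent_iff)
    have "Cauchy (\<lambda>n. S n x)"
    proof (rule CauchyI')
      fix e :: real assume e: "e > 0"
      then obtain N where N: "\<And>i j. i \<ge> N \<Longrightarrow> j \<ge> N \<Longrightarrow> norm (norm (S i x)^2 - norm (S j x)^2) < e^2"
        using CauchyD[OF C, of "e^2"] by auto
      have "dist (S m x) (S n x) < e" if "m \<ge> N" "n > m" for m n
      proof -
        have "norm (S n x - S m x)^2 < e^2"
          using N[of n m] that d[of m n x] by simp
        then show ?thesis using e power2_less_imp_less[of _ e] by (simp add: dist_norm norm_minus_commute)
      qed
      then show "\<exists>M. \<forall>m\<ge>M. \<forall>n>m. dist (S m x) (S n x) < e" by blast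
    qed
    then show ?thesis by (simp add: Cauchy_convergent_iff)
  qed
  then obtain L where L: "\<And>x. (\<lambda>n. S n x) \<longlonglongrightarrow> L x" unfolding convergent_def by metis
  have "bounded_linear L"
  proof (rule bounded_linear_intro[where K=1])
    show "L (x + y) = L x + L y" for x y
      by (rule LIMSEQ_unique[OF L]) (auto simp: blinfun.bilinear_simps intro!: tendsto_intros L)
    show "L (r *\<^sub>R x) = r *\<^sub>R L x" for x r
      by (rule LIMSEQ_unique[OF L]) (auto simp: blinfun.bilinear_simps intro!: tendsto_intros L)
    show "norm (L x) \<le> norm x * 1" for x
      by (rule LIMSEQ_le_const2[OF tendsto_norm[OF L]]) (auto simp: orth_proj_norm_le S)
  qed
  then have P: "Blinfun L x = L x" for x by (simp add: bounded_linear_Blinfun_apply)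
  have sym: "inner (L x) y = inner x (L y)" for x y
  proof (rule LIMSEQ_unique)
    show "(\<lambda>n. inner (S n x) y) \<longlonglongrightarrow> inner (L x) y" by (intro tendsto_intros L)
    show "(\<lambda>n. inner (S n x) y) \<longlonglongrightarrow> inner x (L y)"
      unfolding orth_projD(2)[OF S] by (intro tendsto_intros L)
  qed
  have SL: "S n (L x) = S n x" for n x
  proof (rule LIMSEQ_unique)
    show "(\<lambda>m. S n (S m x)) \<longlonglongrightarrow> S n (L x)" by (intro tendsto_intros L)
    have "\<forall>\<^sub>F m in sequentially. S n x = S n (S m x)"
    proof (rule eventually_sequentiallyI)
      show "S n x = S n (S m x)" if "n \<le> m" for m
        using orth_proj_le_commute[OF S S le[OF that]] by (metis blinfun_apply_blinfun_compose)
    qed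
    then show "(\<lambda>m. S n (S m x)) \<longlonglongrightarrow> S n x"
      by (rule Lim_transform_eventually[OF tendsto_const])
  qed
  have LL: "L (L x) = L x" for x
    using L[of "L x"] L[of x] by (simp add: SL LIMSEQ_unique)
  show ?thesis
  proof
    show "orth_proj (Blinfun L)"
      by (auto simp: orth_proj_def symmetric_op_def P sym LL intro!: blinfun_eqI)
    show "(\<lambda>n. S n x) \<longlonglongrightarrow> Blinfun L x" for x by (simp add: P L)
    show "S n o\<^sub>L Blinfun L = S n" for n by (auto intro!: blinfun_eqI simp: P SL)
    show "t o\<^sub>L Blinfun L = Blinfun L o\<^sub>L t" if t: "\<And>n. t o\<^sub>L S n = S n o\<^sub>L t" for t
    proof (rule blinfun_eqI)
      fix x
      have "(\<lambda>n. t (S n x)) \<longlonglongrightarrow> t (L x)" by (intro tendsto_intros L)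
      moreover have "(\<lambda>n. t (S n x)) \<longlonglongrightarrow> L (t x)" using L[of "t x"] by (simp add: commute_opD[OF t])
      ultimately show "(t o\<^sub>L Blinfun L) x = (Blinfun L o\<^sub>L t) x" by (simp add: P LIMSEQ_unique)
    qed
  qed
qed

section \<open>Uniqueness of the spectral measure\<close>

lemma projection_valued_measureD:
  assumes E: "projection_valued_measure E"
  shows "B \<in> sets borel \<Longrightarrow> orth_proj (E B)"
    and "B \<in> sets borel \<Longrightarrow> E B \<in> bounded_ops"
    and "E UNIV = id_blinfun"
    and "A \<in> sets borel \<Longrightarrow> B \<in> sets borel \<Longrightarrow> blinfun_apply (E A) (blinfun_apply (E B) x) = blinfun_apply (E (A \<inter> B)) x"
    and "\<And>B::nat \<Rightarrow> real set. range B \<subseteq> sets borel \<Longrightarrow> disjoint_family B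
      \<Longrightarrow> (\<lambda>n. blinfun_apply (E (B n)) x) sums blinfun_apply (E (\<Union>n. B n)) x"
  using E by (auto simp: projection_valued_measure_def projection_iff)

text \<open>Countable additivity for the family of empty sets gives a convergent series with
  constant terms.\<close>

lemma projection_valued_measure_empty:
  assumes E: "projection_valued_measure E"
  shows "E {} = 0"
proof (rule blinfun_eqI)
  fix x
  have "(\<lambda>n::nat. E {} x) sums E (\<Union>n::nat. {}) x"
    by (rule projection_valued_measureD(5)[OF E]) (auto simp: disjoint_family_on_def)
  then have "(\<lambda>n::nat. E {} x) \<longlonglongrightarrow> 0" using sums_summable summable_LIMSEQ_zero by blast
  then show "E {} x = blinfun_apply 0 x" by (simp add: LIMSEQ_const_iff)
qed

lemma sets_diagonal_measure [simp]: "sets (diagonal_measure E x) = sets borel"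
  and space_diagonal_measure [simp]: "space (diagonal_measure E x) = UNIV"
  using sets.sigma_sets_eq[of "borel :: real measure"] by (simp_all add: diagonal_measure_def)

lemma emeasure_diagonal_measure:
  assumes E: "projection_valued_measure E" and B: "B \<in> sets borel"
  shows "emeasure (diagonal_measure E x) B = ennreal (norm (E B x)^2)"
proof -
  have eq: "Re (cinner x (E B x)) = norm (E B x)^2" if "B \<in> sets borel" for B
    using orth_proj_norm_sqr[OF projection_valued_measureD(1)[OF E that], of x] by (simp add: inner_eq_Re_cinner)
  have "emeasure (diagonal_measure E x) B = ennreal (Re (cinner x (E B x)))"
  proof (rule emeasure_measure_of[OF diagonal_measure_def])
    show "positive (sets (diagonal_measure E x)) (\<lambda>B. ennreal (Re (cinner x (E B x))))"
      by (simp add: positive_def projection_valued_measure_empty[OF E] flip: inner_eq_Re_cinner)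
    show "countably_additive (sets (diagonal_measure E x)) (\<lambda>B. ennreal (Re (cinner x (E B x))))"
    proof (rule countably_additiveI)
      fix A :: "nat \<Rightarrow> real set"
      assume "range A \<subseteq> sets (diagonal_measure E x)" and d: "disjoint_family A"
      then have A: "range A \<subseteq> sets borel" by simp
      have "(\<lambda>i. E (A i) x) sums E (\<Union>i. A i) x" by (rule projection_valued_measureD(5)[OF E A d])
      then have "(\<lambda>i. inner x (E (A i) x)) sums inner x (E (\<Union>i. A i) x)"
        by (rule bounded_linear.sums[OF bounded_linear_inner_right])
      then have "(\<lambda>i. Re (cinner x (E (A i) x))) sums Re (cinner x (E (\<Union>i. A i) x))"
        by (simp add: inner_eq_Re_cinner)
      then show "(\<Sum>i. ennreal (Re (cinner x (E (A i) x)))) = ennreal (Re (cinner x (E (\<Union>i. A i) x)))"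
        using A by (intro suminf_ennreal_eq) (auto simp: eq)
    qed
  qed (use B in auto)
  then show ?thesis by (simp add: eq[OF B])
qed

lemma finite_measure_diagonal_measure:
  "projection_valued_measure E \<Longrightarrow> finite_measure (diagonal_measure E x)"
  by (rule finite_measureI) (simp add: emeasure_diagonal_measure)

lemma AE_diagonal_measure:
  assumes E: "projection_valued_measure E" and B: "B \<in> sets borel" and x: "E B x = x"
  shows "AE t in diagonal_measure E x. t \<in> B"
proof (rule AE_I')
  have "E (- B) x = E (- B) (E B x)" by (simp add: x)
  also have "\<dots> = 0"
    using B projection_valued_measureD(4)[OF E, of "- B" B x]
    by (simp add: borel_comp projection_valued_measure_empty[OF E])
  finally show "- B \<in> null_sets (diagonal_measure E x)"
    using B by (intro null_setsI) (auto simp: emeasure_diagonal_measure[OF E] borel_comp)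
qed auto

lemma measure_diagonal_measure_UNIV:
  assumes E: "projection_valued_measure E"
  shows "measure (diagonal_measure E x) UNIV = inner x x"
  using emeasure_diagonal_measure[OF E, of UNIV x]
  by (simp add: measure_def projection_valued_measureD(3)[OF E] power2_norm_eq_inner)

text \<open>For \<open>u\<close> in the range of \<open>p = E B\<close> and \<open>v\<close> in its kernel, \<open>E\<close> has the same diagonal measure
  at \<open>u + v\<close> and \<open>u - v\<close>, so the form of \<open>a\<close> vanishes at \<open>(u, v)\<close>.\<close>

lemma spectral_measure_commute:
  fixes a :: "'h::chilbert_space oper"
  assumes a: "selfadjoint a" and sm: "spectral_measure_of a E" and B: "B \<in> sets borel"
  shows "E B o\<^sub>L a = a o\<^sub>L E B"
proof -
  have E: "projection_valued_measure E" using sm by (simp add: spectral_measure_of_def)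
  have sym: "symmetric_op a" using a by (simp add: selfadjoint_iff)
  define p where "p = E B"
  have p: "orth_proj p" by (simp add: p_def projection_valued_measureD(1)[OF E B])
  have form: "inner x (a x) = (LINT t|diagonal_measure E x. t)" for x
    using sm by (simp add: spectral_measure_of_def inner_eq_Re_cinner)
  have zero: "inner u (a v) = 0" if u: "p u = u" and v: "p v = 0" for u v
  proof -
    have "norm (E C (u + v))^2 = norm (E C (u - v))^2" if C: "C \<in> sets borel" for C
    proof -
      note pC = projection_valued_measureD(1)[OF E C]
      \<comment> \<open>The cross term vanishes: p can be inserted before u and, since it commutes
        with E C, moved onto v, where it gives 0.\<close>
      have "inner (E C u) (E C v) = inner (p u) (E C v)"
        by (simp add: u orth_projD[OF pC])
      also have "\<dots> = inner u (E C (p v))"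
        using projection_valued_measureD(4)[OF E B C, of v] projection_valued_measureD(4)[OF E C B, of v]
        by (simp add: orth_projD(2)[OF p, unfolded p_def] p_def Int_commute)
      finally show ?thesis
        by (simp add: v blinfun.bilinear_simps norm_add_sqr norm_diff_sqr)
    qed
    then have "diagonal_measure E (u + v) = diagonal_measure E (u - v)"
      by (intro measure_eqI) (auto simp: emeasure_diagonal_measure[OF E])
    then have "inner (u + v) (a (u + v)) = inner (u - v) (a (u - v))" by (simp add: form)
    then have "inner u (a v) + inner v (a u) = 0"
      by (simp add: blinfun.bilinear_simps inner_add inner_diff)
    then show ?thesis using symmetric_opD[OF sym, of u v] by (simp add: inner_commute)
  qed
  show "E B o\<^sub>L a = a o\<^sub>L E B"
  proof (rule blinfun_eqI, rule eq_if_inner_eq)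
    fix x y
    have pp: "p (p z) = p z" for z by (rule orth_projD(1)[OF p])
    have 1: "inner (p y) (a (x - p x)) = 0" by (rule zero) (simp_all add: pp blinfun.bilinear_simps)
    have "inner (p x) (a (y - p y)) = 0" by (rule zero) (simp_all add: pp blinfun.bilinear_simps)
    then have 2: "inner (y - p y) (a (p x)) = 0"
      using symmetric_opD[OF sym, of "p x" "y - p y"] by (simp add: inner_commute)
    show "inner y ((E B o\<^sub>L a) x) = inner y ((a o\<^sub>L E B) x)"
      using 1 2 by (simp add: p_def[symmetric] orth_projD(2)[OF p, symmetric] blinfun.bilinear_simps inner_diff)
  qed
qed

text \<open>A vector in the range of E {s<..} has its diagonal measure carried by {s<..}, one in the
  kernel by {..s}; integrating t gives the two form bounds. With \<open>cut_eqI\<close> this is the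
  uniqueness of the spectral projections of half-lines.\<close>

lemma cut_proj_spectral_measure:
  fixes a :: "'h::chilbert_space oper"
  assumes a: "selfadjoint a" and sm: "spectral_measure_of a E"
  shows "cut_proj a s (E {s<..})"
proof -
  have E: "projection_valued_measure E" using sm by (simp add: spectral_measure_of_def)
  have form: "inner x (a x) = (LINT t|diagonal_measure E x. t)"
    and int: "integrable (diagonal_measure E x) (\<lambda>t. t)" for x
    using sm by (simp_all add: spectral_measure_of_def inner_eq_Re_cinner)
  have intc: "integrable (diagonal_measure E x) (\<lambda>t. c)" for c :: real and x
    by (rule finite_measure.integrable_const[OF finite_measure_diagonal_measure[OF E]])
  show ?thesis
    unfolding cut_proj_def
  proof (intro conjI allI impI)
    show "orth_proj (E {s<..})" by (rule projection_valued_measureD(1)[OF E]) simp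
    show "E {s<..} o\<^sub>L a = a o\<^sub>L E {s<..}" by (rule spectral_measure_commute[OF a sm]) simp
    fix x
    show "inner x (a x) \<le> s * inner x x" if x: "E {s<..} x = 0"
    proof -
      have "x = E {..s} x"
      proof -
        \<comment> \<open>Additivity is available for sequences only, so the two half-lines are
          padded with empty sets.\<close>
        define A where "A n = (if n = 0 then {s<..} else if n = 1 then {..s} else {})" for n :: nat
        have "(\<lambda>n. E (A n) x) sums E (\<Union>n. A n) x"
          by (rule projection_valued_measureD(5)[OF E]) (auto simp: A_def disjoint_family_on_def)
        moreover have "(\<Union>n. A n) = UNIV"
        proof -
          have "t \<in> A 0 \<or> t \<in> A 1" for t by (auto simp: A_def)
          then show ?thesis by blast
        qed
        moreover have "(\<lambda>n. E (A n) x) sums (\<Sum>n\<in>{0,1}. E (A n) x)"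
          by (rule sums_finite) (auto simp: A_def projection_valued_measure_empty[OF E])
        ultimately show ?thesis
          using x by (simp add: sums_unique2 A_def projection_valued_measureD(3)[OF E])
      qed
      then have "AE t in diagonal_measure E x. t \<in> {..s}" by (intro AE_diagonal_measure[OF E]) auto
      then have "(LINT t|diagonal_measure E x. t) \<le> (LINT t|diagonal_measure E x. s)"
        by (intro integral_mono_AE int intc) auto
      then show ?thesis by (simp add: form measure_diagonal_measure_UNIV[OF E] mult.commute)
    qed
    show "s * inner x x < inner x (a x)" if x: "E {s<..} x = x" "x \<noteq> 0"
    proof -
      have "AE t in diagonal_measure E x. t \<in> {s<..}" using x by (intro AE_diagonal_measure[OF E]) auto
      then have "(LINT t|diagonal_measure E x. s) < (LINT t|diagonal_measure E x. t)"
        using x emeasure_diagonal_measure[OF E, of UNIV x]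
        by (intro finite_measure.integral_less_AE_space[OF finite_measure_diagonal_measure[OF E]] int intc) (auto simp: projection_valued_measureD(3)[OF E])
      then show ?thesis by (simp add: form measure_diagonal_measure_UNIV[OF E] mult.commute)
    qed
  qed
qed

text \<open>\<open>T1\<close> and \<open>T2\<close> play the role of antiderivatives of \<open>- F\<close>. On a partition into \<open>n\<close> equal parts
  the bounds for \<open>T1 - T2\<close> telescope to \<open>(u - l) (F l - F u) / n\<close>.\<close>

lemma increments_unique:
  fixes F T1 T2 :: "real \<Rightarrow> real"
  assumes 1: "\<And>l u. l < u \<Longrightarrow> (u - l) * F u \<le> T1 l - T1 u \<and> T1 l - T1 u \<le> (u - l) * F l"
    and 2: "\<And>l u. l < u \<Longrightarrow> (u - l) * F u \<le> T2 l - T2 u \<and> T2 l - T2 u \<le> (u - l) * F l"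
    and lu: "l < u"
  shows "T1 l - T1 u = T2 l - T2 u"
proof -
  define D where "D x = T1 x - T2 x" for x
  have D: "\<bar>D x - D y\<bar> \<le> (y - x) * (F x - F y)" if "x < y" for x y
    using 1[OF that] 2[OF that] unfolding D_def right_diff_distrib abs_le_iff by linarith
  have bound: "\<bar>D l - D u\<bar> \<le> ((u - l) * (F l - F u)) / real (Suc n)" for n
  proof -
    define h where "h = (u - l) / real (Suc n)"
    have h: "h > 0" using lu by (simp add: h_def)
    define x where "x k = l + real k * h" for k
    have x0: "x 0 = l" and xn: "x (Suc n) = u" using lu by (simp_all add: x_def h_def)
    have xs: "x (Suc k) - x k = h" "x k < x (Suc k)" for k using h by (simp_all add: x_def algebra_simps)
    have "D l - D u = (\<Sum>k<Suc n. D (x k) - D (x (Suc k)))"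
      by (subst sum_lessThan_telescope') (simp only: x0 xn)
    also have "\<bar>\<dots>\<bar> \<le> (\<Sum>k<Suc n. \<bar>D (x k) - D (x (Suc k))\<bar>)" by (rule sum_abs)
    also have "\<dots> \<le> (\<Sum>k<Suc n. h * (F (x k) - F (x (Suc k))))"
      using D[OF xs(2)] by (intro sum_mono) (simp only: xs)
    also have "\<dots> = h * (F l - F u)"
      by (subst sum_distrib_left[symmetric], subst sum_lessThan_telescope') (simp only: x0 xn)
    finally show ?thesis by (simp add: h_def)
  qed
  have "(\<lambda>n. ((u - l) * (F l - F u)) / real (Suc n)) \<longlonglongrightarrow> 0"
    by (rule LIMSEQ_Suc[OF lim_const_over_n])
  then have "\<bar>D l - D u\<bar> \<le> 0" by (rule LIMSEQ_le_const) (use bound in blast)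
  then show ?thesis by (simp add: D_def)
qed

text \<open>Let P be the strong limit of the cuts from the right. A vector v in the gap between P
  and \<open>upcut a s\<close> is killed by every cut above s, so its form is at most s |v|^2 in the
  limit; being in the range at s, it must be zero.\<close>

lemma upcut_right_continuous:
  fixes a :: "'a::{real_inner,banach} \<Rightarrow>\<^sub>L 'a"
  assumes a: "symmetric_op a"
  shows "(\<lambda>n. upcut a (s + inverse (real (Suc n))) x) \<longlonglongrightarrow> upcut a s x"
proof -
  define S where "S n = upcut a (s + inverse (real (Suc n)))" for n
  have S: "orth_proj (S n)" for n by (simp add: S_def orth_proj_cut[OF a])
  have le: "S m o\<^sub>L S n = S n" if "n \<le> m" for n m
    unfolding S_def using that by (intro cut_antimono[OF a] add_left_mono le_imp_inverse_le) auto
  obtain P where P: "orth_proj P" "\<And>x. (\<lambda>n. S n x) \<longlonglongrightarrow> P x" "\<And>n. S n o\<^sub>L P = S n"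
    by (rule increasing_projections_converge[of S, OF S le]) (assumption, rule that)
  have Sle: "upcut a s o\<^sub>L S n = S n" for n unfolding S_def by (intro cut_antimono[OF a]) simp
  have SP: "S n (P x) = S n x" for n x using P(3)[of n] by (metis blinfun_apply_blinfun_compose)
  have Sc: "S n (upcut a s x) = S n x" for n x
    using orth_proj_le_commute[OF orth_proj_cut[OF a] S Sle] by (metis blinfun_apply_blinfun_compose)
  have cP: "upcut a s (P x) = P x"
  proof (rule LIMSEQ_unique)
    show "(\<lambda>n. upcut a s (S n x)) \<longlonglongrightarrow> upcut a s (P x)" by (intro tendsto_intros P)
    show "(\<lambda>n. upcut a s (S n x)) \<longlonglongrightarrow> P x"
      using P(2)[of x] unfolding blinfun_apply_blinfun_compose[symmetric] Sle .
  qed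
  define v where "v = upcut a s x - P x"
  have "inner v (a v) \<le> (s + inverse (real (Suc n))) * inner v v" for n
  proof (rule cut_zero_le[OF a])
    show "upcut a (s + inverse (real (Suc n))) v = 0"
      unfolding S_def[symmetric] v_def by (simp add: blinfun.bilinear_simps SP Sc)
  qed
  moreover have "(\<lambda>n. (s + inverse (real (Suc n))) * inner v v) \<longlonglongrightarrow> (s + 0) * inner v v"
    by (intro tendsto_intros LIMSEQ_inverse_real_of_nat)
  ultimately have "inner v (a v) \<le> (s + 0) * inner v v" by (intro LIMSEQ_le_const) auto
  moreover have "upcut a s v = v"
    by (simp add: v_def blinfun.bilinear_simps orth_projD(1)[OF orth_proj_cut[OF a]] cP)
  ultimately have "v = 0" using cut_fix_gt[OF a, of s v] by force
  then have "P x = upcut a s x" by (simp add: v_def)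
  then show ?thesis using P(2)[of x] by (simp add: S_def)
qed

section \<open>Existence of the spectral measure\<close>

lemma upcut_norm_antimono:
  fixes a :: "'a::{real_inner,banach} \<Rightarrow>\<^sub>L 'a"
  assumes a: "symmetric_op a" and st: "s \<le> t"
  shows "norm (upcut a t x)^2 \<le> norm (upcut a s x)^2"
  using orth_proj_diff(2)[OF orth_proj_cut[OF a] orth_proj_cut[OF a] cut_antimono[OF a st], of x]
    zero_le_power2[of "norm (upcut a s x - upcut a t x)"] by linarith

text \<open>The distribution function is the squared norm of the part of x belonging to (-infinity,
  s], so this is the diagonal measure that a spectral measure of a must have at x.\<close>

definition spectral_mass :: "('a::real_inner \<Rightarrow>\<^sub>L 'a) \<Rightarrow> 'a \<Rightarrow> real measure" where
  "spectral_mass a x = interval_measure (\<lambda>s. norm x^2 - norm (upcut a s x)^2)"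

lemma sets_spectral_mass [simp, measurable_cong]: "sets (spectral_mass a x) = sets borel"
  and space_spectral_mass [simp]: "space (spectral_mass a x) = UNIV"
  by (simp_all add: spectral_mass_def)

lemma emeasure_spectral_mass_Ioc:
  fixes a :: "'a::{real_inner,banach} \<Rightarrow>\<^sub>L 'a"
  assumes a: "symmetric_op a" and lu: "l \<le> u"
  shows "emeasure (spectral_mass a x) {l<..u} = ennreal (norm (upcut a l x)^2 - norm (upcut a u x)^2)"
proof -
  let ?F = "\<lambda>s. norm x^2 - norm (upcut a s x)^2"
  have mono: "?F s \<le> ?F t" if "s \<le> t" for s t
    using upcut_norm_antimono[OF a that] by simp
  have "continuous (at_right s) ?F \<longleftrightarrow> (\<forall>e>0. \<exists>d>0. ?F (s + d) - ?F s < e)" for s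
    by (rule continuous_at_right_real_increasing) (rule mono)
  moreover have "\<forall>e>0. \<exists>d>0. ?F (s + d) - ?F s < e" for s
  proof (intro allI impI)
    fix e :: real assume e: "e > 0"
    have "(\<lambda>n. norm (upcut a (s + inverse (real (Suc n))) x)^2) \<longlonglongrightarrow> norm (upcut a s x)^2"
      by (intro tendsto_intros upcut_right_continuous[OF a])
    then have "eventually (\<lambda>n. norm (upcut a s x)^2 - e < norm (upcut a (s + inverse (real (Suc n))) x)^2) sequentially"
      using e by (intro order_tendstoD) auto
    then obtain n where "norm (upcut a s x)^2 - e < norm (upcut a (s + inverse (real (Suc n))) x)^2"
      by (auto simp: eventually_sequentially)
    then show "\<exists>d>0. ?F (s + d) - ?F s < e"
      by (intro exI[of _ "inverse (real (Suc n))"]) auto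
  qed
  ultimately have cont: "continuous (at_right s) ?F" for s by blast
  show ?thesis
    unfolding spectral_mass_def using emeasure_interval_measure_Ioc[OF lu mono cont] by simp
qed

lemma
  fixes a :: "'a::{real_inner,banach} \<Rightarrow>\<^sub>L 'a"
  assumes a: "symmetric_op a"
  shows emeasure_spectral_mass_UNIV: "emeasure (spectral_mass a x) UNIV = ennreal (norm x^2)"
    and finite_measure_spectral_mass: "finite_measure (spectral_mass a x)"
    and AE_spectral_mass: "AE t in spectral_mass a x. \<bar>t\<bar> \<le> norm a + 1"
proof -
  let ?\<mu> = "spectral_mass a x"
  \<comment> \<open>The margin 1 is there because \<open>cut_below_norm\<close> needs a level
    strictly below - norm a.\<close>
  have A: "emeasure ?\<mu> {-R<..R} = ennreal (norm x^2)" if "R \<ge> norm a + 1" for R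
  proof -
    have "norm a \<ge> 0" "-R \<le> R" using that norm_ge_zero[of a] by linarith+
    then show ?thesis
      using that by (simp add: emeasure_spectral_mass_Ioc[OF a] cut_above_norm[OF a] cut_below_norm[OF a])
  qed
  have "(\<lambda>n. emeasure ?\<mu> {-(norm a + 1 + real n)<..norm a + 1 + real n})
      \<longlonglongrightarrow> emeasure ?\<mu> (\<Union>n. {-(norm a + 1 + real n)<..norm a + 1 + real n})"
    by (rule Lim_emeasure_incseq) (auto simp: incseq_def)
  moreover have "(\<Union>n. {-(norm a + 1 + real n)<..norm a + 1 + real n}) = UNIV"
  proof -
    have "\<exists>n. t \<in> {-(norm a + 1 + real n)<..norm a + 1 + real n}" for t
    proof -
      obtain n where n: "real n > \<bar>t\<bar>" using reals_Archimedean2 by blast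
      show ?thesis using n norm_ge_zero[of a] by (intro exI[of _ n]) (simp only: greaterThanAtMost_iff, linarith)
    qed
    then show ?thesis by blast
  qed
  moreover have "emeasure ?\<mu> {-(norm a + 1 + real n)<..norm a + 1 + real n} = ennreal (norm x^2)" for n
    by (rule A) simp
  ultimately show U: "emeasure ?\<mu> UNIV = ennreal (norm x^2)"
    by (simp only: LIMSEQ_const_iff)
  show F: "finite_measure ?\<mu>" by (rule finite_measureI) (simp add: U)
  show "AE t in ?\<mu>. \<bar>t\<bar> \<le> norm a + 1"
  proof (rule AE_I')
    have "emeasure ?\<mu> {-(norm a + 1)<..norm a + 1} = ennreal (norm x^2)" by (rule A) simp
    then have "emeasure ?\<mu> (space ?\<mu> - {-(norm a + 1)<..norm a + 1}) = 0"
      by (subst emeasure_compl) (simp_all add: U)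
    then show "space ?\<mu> - {-(norm a + 1)<..norm a + 1} \<in> null_sets ?\<mu>"
      by (intro null_setsI) auto
  qed auto
qed

lemma measure_spectral_mass_UNIV:
  fixes a :: "'a::{real_inner,banach} \<Rightarrow>\<^sub>L 'a"
  shows "symmetric_op a \<Longrightarrow> measure (spectral_mass a x) UNIV = norm x^2"
  by (simp add: measure_def emeasure_spectral_mass_UNIV)

lemma sum_orthogonal_projections:
  fixes P :: "nat \<Rightarrow> 'a::real_inner \<Rightarrow>\<^sub>L 'a"
  assumes P: "\<And>i. orth_proj (P i)" and orth: "\<And>i j x. i \<noteq> j \<Longrightarrow> P i (P j x) = 0"
  shows "orth_proj (\<Sum>i<n. P i)"
    and "n \<le> m \<Longrightarrow> (\<Sum>i<m. P i) o\<^sub>L (\<Sum>i<n. P i) = (\<Sum>i<n. P i)"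
    and "norm ((\<Sum>i<n. P i) x)^2 = (\<Sum>i<n. norm (P i x)^2)"
proof -
  have PS: "P i (\<Sum>j<n. P j x) = (if i < n then P i x else 0)" for i n x
  proof -
    have "P i (\<Sum>j<n. P j x) = (\<Sum>j<n. if i = j then P i x else 0)"
      unfolding blinfun.sum_right
      by (intro sum.cong) (auto simp: orth orth_projD(1)[OF P])
    then show ?thesis by simp
  qed
  show comp: "(\<Sum>i<m. P i) o\<^sub>L (\<Sum>i<n. P i) = (\<Sum>i<n. P i)" if "n \<le> m" for n m
  proof (rule blinfun_eqI)
    fix x
    have "((\<Sum>i<m. P i) o\<^sub>L (\<Sum>i<n. P i)) x = (\<Sum>i<m. if i < n then P i x else 0)"
      by (simp add: blinfun.sum_left PS)
    also have "\<dots> = (\<Sum>i<n. P i x)"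
      using that by (intro sum.mono_neutral_cong_right) auto
    finally show "((\<Sum>i<m. P i) o\<^sub>L (\<Sum>i<n. P i)) x = (\<Sum>i<n. P i) x" by (simp add: blinfun.sum_left)
  qed
  show S: "orth_proj (\<Sum>i<n. P i)"
    unfolding orth_proj_def symmetric_op_def using comp
    by (simp add: blinfun.sum_left inner_sum_left inner_sum_right orth_projD(2)[OF P])
  show "norm ((\<Sum>i<n. P i) x)^2 = (\<Sum>i<n. norm (P i x)^2)"
    unfolding orth_proj_norm_sqr[OF S] by (simp add: blinfun.sum_left inner_sum_right orth_proj_norm_sqr[OF P])
qed

lemma orth_proj_add:
  assumes "orth_proj p" "orth_proj q" "\<And>x. q (p x) = 0"
  shows "orth_proj (p + q)" "norm ((p + q) x)^2 = norm (p x)^2 + norm (q x)^2"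
proof -
  have pq: "p (q x) = 0" for x
    by (rule eq_if_inner_eq) (simp add: orth_projD(2)[OF assms(1), symmetric] orth_projD(2)[OF assms(2), symmetric] assms(3))
  show P: "orth_proj (p + q)"
    using assms(1,2) by (auto simp: orth_proj_def[of "p + q"] blinfun.bilinear_simps assms(3) pq orth_projD(1)
        intro!: blinfun_eqI symmetric_op_add) (simp_all add: orth_proj_def)
  show "norm ((p + q) x)^2 = norm (p x)^2 + norm (q x)^2"
    unfolding orth_proj_norm_sqr[OF P] orth_proj_norm_sqr[OF assms(1)] orth_proj_norm_sqr[OF assms(2)]
    by (simp add: blinfun.bilinear_simps inner_add)
qed

text \<open>The commutation clause is carried along the induction over Borel sets because at the end
  it makes the projections complex-linear. The measures at all x determine P
  (\<open>represents_unique\<close>).\<close>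

definition represents :: "('a::real_inner \<Rightarrow>\<^sub>L 'a) \<Rightarrow> real set \<Rightarrow> ('a \<Rightarrow>\<^sub>L 'a) \<Rightarrow> bool" where
  "represents a B P \<longleftrightarrow> orth_proj P \<and> (\<forall>t. t o\<^sub>L a = a o\<^sub>L t \<longrightarrow> t o\<^sub>L P = P o\<^sub>L t) \<and>
     (\<forall>x. measure (spectral_mass a x) B = norm (P x)^2)"

lemma represents_unique: "represents a B P \<Longrightarrow> represents a B Q \<Longrightarrow> P = Q"
proof (rule orth_proj_eqI)
  assume P: "represents a B P" and Q: "represents a B Q"
  show "orth_proj P" "orth_proj Q" using P Q by (simp_all add: represents_def)
  fix x
  have "norm (P x)^2 = norm (Q x)^2" using P Q by (metis represents_def)
  then show "norm (P x) = norm (Q x)" by (simp add: power2_eq_iff_nonneg)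
qed

text \<open>The masses of disjoint sets add up to at most the total mass |y|^2, which is the
  criterion of \<open>orth_proj_orthogonal\<close>.\<close>

lemma represents_orthogonal:
  fixes a :: "'a::{real_inner,banach} \<Rightarrow>\<^sub>L 'a"
  assumes a: "symmetric_op a" and P: "represents a A P" and Q: "represents a B Q"
    and AB: "A \<in> sets borel" "B \<in> sets borel" "A \<inter> B = {}"
  shows "Q (P x) = 0"
proof (rule orth_proj_orthogonal)
  show "orth_proj P" "orth_proj Q" using P Q by (auto simp: represents_def)
  fix y
  interpret finite_measure "spectral_mass a y" by (rule finite_measure_spectral_mass[OF a])
  have "norm (P y)^2 + norm (Q y)^2 = measure (spectral_mass a y) (A \<union> B)"
    using P Q AB by (simp add: represents_def finite_measure_Union)
  also have "\<dots> \<le> measure (spectral_mass a y) UNIV"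
    by (rule finite_measure_mono) auto
  finally show "norm (P y)^2 + norm (Q y)^2 \<le> norm y^2"
    by (simp add: measure_spectral_mass_UNIV[OF a])
qed

lemma represents_Un:
  fixes a :: "'a::{real_inner,banach} \<Rightarrow>\<^sub>L 'a"
  assumes a: "symmetric_op a" and P: "represents a A P" and Q: "represents a B Q"
    and AB: "A \<in> sets borel" "B \<in> sets borel" "A \<inter> B = {}"
  shows "represents a (A \<union> B) (P + Q)"
proof -
  have o: "orth_proj P" "orth_proj Q" using P Q by (auto simp: represents_def)
  note add = orth_proj_add[OF o represents_orthogonal[OF a P Q AB]]
  show ?thesis
    unfolding represents_def
  proof (intro conjI allI impI)
    fix x
    interpret finite_measure "spectral_mass a x" by (rule finite_measure_spectral_mass[OF a])
    show "measure (spectral_mass a x) (A \<union> B) = norm ((P + Q) x)^2"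
      using P Q AB unfolding add(2) by (simp add: represents_def finite_measure_Union)
  qed (use add(1) P Q in \<open>auto simp: represents_def blinfun_compose.add_left blinfun_compose.add_right\<close>)
qed

text \<open>Partial sums of mutually orthogonal projections increase, so they converge strongly;
  their squared norms are the partial sums of the measures, which identifies the limit.\<close>

lemma represents_UN:
  fixes a :: "'a::{real_inner,banach} \<Rightarrow>\<^sub>L 'a"
  assumes a: "symmetric_op a" and P: "\<And>i::nat. represents a (A i) (P i)"
    and A: "range A \<subseteq> sets borel" "disjoint_family A"
  obtains Q where "represents a (\<Union>i. A i) Q" "\<And>x. (\<lambda>i. P i x) sums Q x"
proof -
  have o: "orth_proj (P i)" for i using P by (auto simp: represents_def)
  have orth: "P i (P j x) = 0" if "i \<noteq> j" for i j x
    by (rule represents_orthogonal[OF a P P]) (use A that in \<open>auto simp: disjoint_family_on_def\<close>)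
  have S: "orth_proj (\<Sum>i<n. P i)"
    "n \<le> m \<Longrightarrow> (\<Sum>i<m. P i) o\<^sub>L (\<Sum>i<n. P i) = (\<Sum>i<n. P i)"
    "norm ((\<Sum>i<n. P i) x)^2 = (\<Sum>i<n. norm (P i x)^2)" for n m x
    using sum_orthogonal_projections[of P, OF o] orth by blast+
  obtain Q where Q: "orth_proj Q" "\<And>x. (\<lambda>n. (\<Sum>i<n. P i) x) \<longlonglongrightarrow> Q x"
    "\<And>t. (\<And>n. t o\<^sub>L (\<Sum>i<n. P i) = (\<Sum>i<n. P i) o\<^sub>L t) \<Longrightarrow> t o\<^sub>L Q = Q o\<^sub>L t"
    by (rule increasing_projections_converge[of "\<lambda>n. \<Sum>i<n. P i"])
       (rule S(1), rule S(2), assumption, (rule that; blast))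
  show ?thesis
  proof
    show sums: "(\<lambda>i. P i x) sums Q x" for x using Q(2)[of x] by (simp add: sums_def blinfun.sum_left)
    show "represents a (\<Union>i. A i) Q"
      unfolding represents_def
    proof (intro conjI allI impI)
      show "orth_proj Q" by (fact Q)
      fix t assume t: "t o\<^sub>L a = a o\<^sub>L t"
      have "t o\<^sub>L P i = P i o\<^sub>L t" for i using P t by (auto simp: represents_def)
      then show "t o\<^sub>L Q = Q o\<^sub>L t"
        by (intro Q(3)) (simp add: blinfun_compose.sum_left blinfun_compose.sum_right)
    next
      fix x
      interpret finite_measure "spectral_mass a x" by (rule finite_measure_spectral_mass[OF a])
      have "(\<lambda>i. measure (spectral_mass a x) (A i)) sums measure (spectral_mass a x) (\<Union>i. A i)"
        using A by (intro finite_measure_UNION) auto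
      then have "(\<lambda>n. \<Sum>i<n. norm (P i x)^2) \<longlonglongrightarrow> measure (spectral_mass a x) (\<Union>i. A i)"
        using P by (simp add: represents_def sums_def)
      moreover have "(\<lambda>n. \<Sum>i<n. norm (P i x)^2) \<longlonglongrightarrow> norm (Q x)^2"
        unfolding S(3)[symmetric] by (intro tendsto_intros Q(2))
      ultimately show "measure (spectral_mass a x) (\<Union>i. A i) = norm (Q x)^2" by (rule LIMSEQ_unique)
    qed
  qed
qed

text \<open>Dynkin induction from the intersection-stable half-open intervals, whose projections are
  differences of two cuts. Only complements and disjoint unions then remain, and these are exactly
  the operations that orthogonal projections respect additively.\<close>

lemma represents_exists:
  fixes a :: "'a::{real_inner,banach} \<Rightarrow>\<^sub>L 'a"
  assumes a: "symmetric_op a" and B: "B \<in> sets borel"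
  shows "\<exists>P. represents a B P"
proof -
  let ?G = "range (\<lambda>(l, u). {l<..u::real})"
  have sigma: "sigma_sets UNIV ?G = sets borel" by (simp add: borel_sigma_sets_Ioc)
  have stable: "Int_stable ?G"
    by (rule Int_stableI) (force simp: image_iff Int_greaterThanAtMost)
  have zero: "represents a {} 0" by (simp add: represents_def orth_proj_def symmetric_op_def)
  have "?G \<subseteq> Pow UNIV" "B \<in> sigma_sets UNIV ?G" using B by (simp_all add: sigma)
  with stable show ?thesis
  proof (induction rule: sigma_sets_induct_disjoint)
    case (basic A)
    then obtain l u where A: "A = {l<..u}" by auto
    show ?case
    proof (cases "l \<le> u")
      case True
      note d = orth_proj_diff[OF orth_proj_cut[OF a] orth_proj_cut[OF a] cut_antimono[OF a True]]
      have "represents a A (upcut a l - upcut a u)"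
        unfolding represents_def A
      proof (intro conjI allI impI)
        show "t o\<^sub>L (upcut a l - upcut a u) = (upcut a l - upcut a u) o\<^sub>L t" if "t o\<^sub>L a = a o\<^sub>L t" for t
          by (simp add: blinfun_compose.diff_left blinfun_compose.diff_right cut_commute[OF a that])
        show "measure (spectral_mass a x) {l<..u} = norm ((upcut a l - upcut a u) x)^2" for x
          using emeasure_spectral_mass_Ioc[OF a True, of x] d(2)[of x] upcut_norm_antimono[OF a True, of x]
          by (simp add: measure_def blinfun.bilinear_simps)
      qed (rule d(1))
      then show ?thesis by blast
    qed (use A zero in auto)
  next
    case empty
    show ?case using zero by blast
  next
    case (compl A)
    then obtain P where P: "represents a A P" by blast
    have A: "A \<in> sets borel" using compl sigma by blast
    have "represents a (UNIV - A) (id_blinfun - P)"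
      unfolding represents_def
    proof (intro conjI allI impI)
      show "orth_proj (id_blinfun - P)" using P by (simp add: represents_def orth_proj_compl)
      show "t o\<^sub>L (id_blinfun - P) = (id_blinfun - P) o\<^sub>L t" if "t o\<^sub>L a = a o\<^sub>L t" for t
        using P that by (auto simp: represents_def blinfun_compose.diff_left blinfun_compose.diff_right intro!: blinfun_eqI)
      fix x
      interpret finite_measure "spectral_mass a x" by (rule finite_measure_spectral_mass[OF a])
      show "measure (spectral_mass a x) (UNIV - A) = norm ((id_blinfun - P) x)^2"
        using finite_measure_compl[of A] A P orth_proj_pythagoras[of P x]
        by (simp add: measure_spectral_mass_UNIV[OF a] represents_def blinfun.bilinear_simps)
    qed
    then show ?case by blast
  next
    case (union A)
    then obtain P where P: "\<And>i. represents a (A i) (P i)" by metis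
    show ?case
      by (rule represents_UN[OF a P]) (use union sigma in auto)
  qed
qed

definition spectral_pvm :: "('a::real_inner \<Rightarrow>\<^sub>L 'a) \<Rightarrow> real set \<Rightarrow> ('a \<Rightarrow>\<^sub>L 'a)" where
  "spectral_pvm a B = (SOME P. represents a B P)"

lemma represents_spectral_pvm:
  fixes a :: "'a::{real_inner,banach} \<Rightarrow>\<^sub>L 'a"
  shows "symmetric_op a \<Longrightarrow> B \<in> sets borel \<Longrightarrow> represents a B (spectral_pvm a B)"
  unfolding spectral_pvm_def by (rule someI_ex[OF represents_exists])

lemma projection_valued_measure_spectral_pvm:
  fixes a :: "'h::chilbert_space oper"
  assumes sa: "selfadjoint a"
  shows "projection_valued_measure (spectral_pvm a)"
proof -
  have a: "symmetric_op a" using sa by (simp add: selfadjoint_iff)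
  note rep = represents_spectral_pvm[OF a]
  have o: "orth_proj (spectral_pvm a B)" if "B \<in> sets borel" for B
    using rep[OF that] by (simp add: represents_def)
  show ?thesis
    unfolding projection_valued_measure_def
  proof (intro conjI ballI allI impI)
    show "projection (spectral_pvm a B)" if B: "B \<in> sets borel" for B
      using rep[OF B] sa by (auto simp: projection_iff represents_def bounded_ops_iff_commute selfadjoint_iff)
    show "spectral_pvm a UNIV = id_blinfun"
      by (rule represents_unique[OF rep])
        (simp_all add: represents_def measure_spectral_mass_UNIV[OF a] orth_proj_def symmetric_op_id blinfun_eqI)
    show "spectral_pvm a (A \<inter> B) = spectral_pvm a A o\<^sub>L spectral_pvm a B"
      if A: "A \<in> sets borel" and B: "B \<in> sets borel" for A B
    proof (rule blinfun_eqI)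
      fix x
      have I: "A \<inter> B \<in> sets borel" "A - B \<in> sets borel" "B - A \<in> sets borel" using A B by auto
      \<comment> \<open>Splitting A and B along their intersection expands the product into four
        terms; three vanish by orthogonality and the fourth is an idempotent square.\<close>
      have "spectral_pvm a ((A \<inter> B) \<union> (A - B)) = spectral_pvm a (A \<inter> B) + spectral_pvm a (A - B)"
        by (rule represents_unique[OF rep represents_Un[OF a rep rep]]) (use I in auto)
      moreover have "spectral_pvm a ((A \<inter> B) \<union> (B - A)) = spectral_pvm a (A \<inter> B) + spectral_pvm a (B - A)"
        by (rule represents_unique[OF rep represents_Un[OF a rep rep]]) (use I in auto)
      moreover have "(A \<inter> B) \<union> (A - B) = A" "(A \<inter> B) \<union> (B - A) = B" by auto
      moreover have "spectral_pvm a (A \<inter> B) (spectral_pvm a (B - A) x) = 0"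
        "spectral_pvm a (A - B) (spectral_pvm a (A \<inter> B) x) = 0"
        "spectral_pvm a (A - B) (spectral_pvm a (B - A) x) = 0"
        by (rule represents_orthogonal[OF a rep rep]; use I in auto)+
      ultimately show "spectral_pvm a (A \<inter> B) x = (spectral_pvm a A o\<^sub>L spectral_pvm a B) x"
        by (simp add: blinfun.bilinear_simps orth_projD(1)[OF o[OF I(1)]])
    qed
    fix B :: "nat \<Rightarrow> real set" and x
    assume B: "range B \<subseteq> sets borel" "disjoint_family B"
    then have "\<And>i. represents a (B i) (spectral_pvm a (B i))" by (intro rep) auto
    from represents_UN[OF a this B] obtain Q where Q: "represents a (\<Union>i. B i) Q"
      "\<And>x. (\<lambda>i. spectral_pvm a (B i) x) sums Q x" by blast
    have "Q = spectral_pvm a (\<Union>i. B i)"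
      by (rule represents_unique[OF Q(1) rep]) (use B in auto)
    then show "(\<lambda>n. spectral_pvm a (B n) x) sums spectral_pvm a (\<Union>n. B n) x" using Q(2) by simp
  qed
qed

text \<open>\<open>T s\<close> is the form at x of the positive part of a - s. Writing the cut at l
  as the cut at u plus w, where w has form between l |w|^2 and u |w|^2, the two pieces are
  orthogonal also for the form of a, so T l - T u is (u - l) |y|^2 plus the form of a - l at
  w.\<close>

lemma upcut_form_increments:
  fixes a :: "'a::{real_inner,banach} \<Rightarrow>\<^sub>L 'a"
    and x :: 'a
  assumes a: "symmetric_op a" and lu: "l < u"
  defines "T \<equiv> \<lambda>s. inner (upcut a s x) (a (upcut a s x)) - s * norm (upcut a s x)^2"
  shows "(u - l) * norm (upcut a u x)^2 \<le> T l - T u \<and> T l - T u \<le> (u - l) * norm (upcut a l x)^2"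
proof -
  define y where "y = upcut a u x"
  define w where "w = upcut a l x - y"
  note o = orth_proj_cut[OF a]
  note le = cut_antimono[OF a less_imp_le[OF lu]]
  have lq: "upcut a l y = y" unfolding y_def using le by (metis blinfun_apply_blinfun_compose)
  have uw: "upcut a u w = 0"
    using orth_proj_le_commute[OF o o le] unfolding w_def y_def
    by (simp add: blinfun.bilinear_simps orth_projD(1)[OF o]) (metis blinfun_apply_blinfun_compose)
  have uy: "upcut a u y = y" unfolding y_def by (rule orth_projD(1)[OF o])
  have lw: "upcut a l w = w" by (simp add: w_def blinfun.bilinear_simps orth_projD(1)[OF o] lq)
  have yw: "inner y w = 0" using orth_projD(2)[OF o, of u y w] by (simp add: uy uw)
  have yaw: "inner y (a w) = 0"
    using orth_projD(2)[OF o, of u y "a w"] commute_opD[OF cut_commute_self[OF a], of u w]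
    by (simp add: uy uw blinfun.bilinear_simps)
  have way: "inner w (a y) = 0" using yaw symmetric_opD[OF a, of w y] by (simp add: inner_commute)
  have x: "upcut a l x = y + w" by (simp add: w_def)
  have n: "norm (upcut a l x)^2 = norm y^2 + norm w^2" by (simp add: x norm_add_sqr yw)
  have f: "inner (upcut a l x) (a (upcut a l x)) = inner y (a y) + inner w (a w)"
    by (simp add: x blinfun.bilinear_simps inner_add yaw way)
  have 1: "inner w (a w) \<le> u * norm w^2" using cut_zero_le[OF a uw] by (simp add: power2_norm_eq_inner)
  have 2: "l * norm w^2 \<le> inner w (a w)"
    using cut_fix_gt[OF a lw] by (cases "w = 0") (simp_all add: power2_norm_eq_inner less_imp_le)
  show ?thesis
    unfolding T_def n f y_def[symmetric] using 1 2 by (simp add: algebra_simps)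
qed

text \<open>The form of the positive part of a - s (T1) and the integral of max (t - s) 0 (T2) obey
  the same increment bounds, hence agree between -R and R. At R both vanish; at -R they are the two
  sides of the claim, each increased by R |x|^2.\<close>

lemma integral_spectral_mass:
  fixes a :: "'a::{real_inner,banach} \<Rightarrow>\<^sub>L 'a"
  assumes a: "symmetric_op a"
  shows "integrable (spectral_mass a x) (\<lambda>t. t)"
    and "inner x (a x) = (LINT t|spectral_mass a x. t)"
proof -
  let ?\<mu> = "spectral_mass a x"
  interpret finite_measure ?\<mu> by (rule finite_measure_spectral_mass[OF a])
  define R where "R = norm a + 1"
  have R: "R > norm a" "R > 0" "-R < R" using norm_ge_zero[of a] unfolding R_def by linarith+
  have AE: "AE t in ?\<mu>. \<bar>t\<bar> \<le> R" unfolding R_def by (rule AE_spectral_mass[OF a])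
  show int: "integrable ?\<mu> (\<lambda>t. t)"
    using AE by (intro integrable_const_bound[where B=R]) auto
  have intm: "integrable ?\<mu> (\<lambda>t. max (t - l) 0)" for l
    using int by (intro integrable_max Bochner_Integration.integrable_diff) auto
  define F where "F s = norm (upcut a s x)^2" for s
  define T1 where "T1 s = inner (upcut a s x) (a (upcut a s x)) - s * norm (upcut a s x)^2" for s
  define T2 where "T2 s = (LINT t|?\<mu>. max (t - s) 0)" for s
  have meas: "measure ?\<mu> {s<..} = F s" for s
  proof -
    define u where "u = max s R"
    have u: "s \<le> u" "R \<le> u" by (auto simp: u_def)
    have "measure ?\<mu> {s<..} = measure ?\<mu> {s<..u}"
    proof (rule measure_eq_AE)
      show "AE t in ?\<mu>. (t \<in> {s<..}) = (t \<in> {s<..u})"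
        using AE by eventually_elim (use u in auto)
    qed auto
    also have "\<dots> = F s"
      using emeasure_spectral_mass_Ioc[OF a u(1), of x] u R
      by (simp add: measure_def F_def cut_above_norm[OF a])
    finally show ?thesis .
  qed
  have ind: "(LINT t|?\<mu>. c * indicator {s<..} t) = c * F s" "integrable ?\<mu> (\<lambda>t. c * indicator {s<..} t)" for c s :: real
    by (simp_all add: meas less_top[symmetric])
  have "T1 (-R) - T1 R = T2 (-R) - T2 R"
  proof (rule increments_unique[where F=F])
    show "(u - l) * F u \<le> T1 l - T1 u \<and> T1 l - T1 u \<le> (u - l) * F l" if "l < u" for l u
      unfolding T1_def F_def by (rule upcut_form_increments[OF a that])
    show "(u - l) * F u \<le> T2 l - T2 u \<and> T2 l - T2 u \<le> (u - l) * F l" if "l < u" for l u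
    proof -
      have T: "T2 l - T2 u = (LINT t|?\<mu>. max (t - l) 0 - max (t - u) 0)"
        unfolding T2_def by (rule Bochner_Integration.integral_diff[symmetric]) (rule intm)+
      have i: "integrable ?\<mu> (\<lambda>t. max (t - l) 0 - max (t - u) 0)"
        by (rule Bochner_Integration.integrable_diff) (rule intm)+
      have "(LINT t|?\<mu>. (u - l) * indicator {u<..} t) \<le> T2 l - T2 u"
        unfolding T by (rule integral_mono[OF ind(2) i]) (use that in \<open>auto simp: indicator_def\<close>)
      moreover have "T2 l - T2 u \<le> (LINT t|?\<mu>. (u - l) * indicator {l<..} t)"
        unfolding T by (rule integral_mono[OF i ind(2)]) (use that in \<open>auto simp: indicator_def\<close>)
      ultimately show ?thesis by (simp only: ind)
    qed
  qed (rule R)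
  moreover have "T1 R = 0" "T1 (-R) = inner x (a x) + R * norm x^2"
    using R by (simp_all add: T1_def cut_above_norm[OF a] cut_below_norm[OF a] blinfun.bilinear_simps)
  moreover have "T2 R = 0"
    unfolding T2_def by (rule integral_eq_zero_AE) (use AE in \<open>eventually_elim; auto\<close>)
  moreover have "T2 (-R) = (LINT t|?\<mu>. t) + R * norm x^2"
  proof -
    have "T2 (-R) = (LINT t|?\<mu>. t + R)"
      unfolding T2_def using AE by (intro integral_cong_AE) (auto elim!: eventually_mono)
    then show ?thesis using int by (simp add: measure_spectral_mass_UNIV[OF a])
  qed
  ultimately show "inner x (a x) = (LINT t|?\<mu>. t)" by simp
qed

lemma selfadjoint_cinner_real:
  fixes a :: "'h::chilbert_space oper"
  assumes "selfadjoint a"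
  shows "cinner x (a x) = of_real (inner x (a x))"
proof -
  have a: "a \<in> bounded_ops" "symmetric_op a" using assms by (auto simp: selfadjoint_iff)
  have "inner x (a (\<i> *\<^sub>C x)) = inner (\<i> *\<^sub>C x) (a x)"
    using symmetric_opD[OF a(2), of x "\<i> *\<^sub>C x"] by (simp add: inner_commute)
  then have "Im (cinner x (a x)) = 0"
    by (simp add: bounded_opsD[OF a(1)] inner_scaleC_i inner_scaleC_i_left)
  then show ?thesis by (simp add: complex_eq_iff inner_eq_Re_cinner)
qed

lemma spectral_measure_of_spectral_pvm:
  fixes a :: "'h::chilbert_space oper"
  assumes sa: "selfadjoint a"
  shows "spectral_measure_of a (spectral_pvm a)"
proof -
  have a: "symmetric_op a" using sa by (simp add: selfadjoint_iff)
  note E = projection_valued_measure_spectral_pvm[OF sa]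
  have "diagonal_measure (spectral_pvm a) x = spectral_mass a x" for x
  proof (rule measure_eqI)
    fix B assume "B \<in> sets (diagonal_measure (spectral_pvm a) x)"
    then have B: "B \<in> sets borel" by simp
    interpret finite_measure "spectral_mass a x" by (rule finite_measure_spectral_mass[OF a])
    show "emeasure (diagonal_measure (spectral_pvm a) x) B = emeasure (spectral_mass a x) B"
      using represents_spectral_pvm[OF a B] by (simp add: emeasure_diagonal_measure[OF E B] represents_def emeasure_eq_measure)
  qed simp
  then show ?thesis
    using E integral_spectral_mass[OF a] selfadjoint_cinner_real[OF sa] by (simp add: spectral_measure_of_def)
qed

text \<open>Evaluating the definite description takes both halves of the spectral theorem:
  \<open>spectral_pvm\<close> supplies a spectral measure, and every spectral measure has the cut as
  its value on the half-line.\<close>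

lemma spectral_projection_eq_upcut:
  fixes a :: "'h::chilbert_space oper"
  assumes sa: "selfadjoint a"
  shows "spectral_projection a {s<..} = upcut a s"
proof -
  have "E {s<..} = upcut a s" if "spectral_measure_of a E" for E
    using cut_eqI[OF _ cut_proj_spectral_measure[OF sa that]] sa by (simp add: selfadjoint_iff)
  then show ?thesis
    unfolding spectral_projection_def using spectral_measure_of_spectral_pvm[OF sa]
    by (intro the_equality) (metis, metis)
qed

section \<open>Distribution functions in a tracial von Neumann algebra\<close>

lemma commute_compose:
  assumes "b o\<^sub>L x = x o\<^sub>L b" "b o\<^sub>L y = y o\<^sub>L b"
  shows "b o\<^sub>L (x o\<^sub>L y) = x o\<^sub>L y o\<^sub>L b"
  by (rule blinfun_eqI) (simp add: commute_opD[OF assms(1)] commute_opD[OF assms(2)])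

lemma bounded_ops_add: "a \<in> bounded_ops \<Longrightarrow> b \<in> bounded_ops \<Longrightarrow> a + b \<in> bounded_ops"
  and bounded_ops_scaleR: "a \<in> bounded_ops \<Longrightarrow> r *\<^sub>R a \<in> bounded_ops"
  by (simp_all add: bounded_ops_iff_commute blinfun_compose.add_left blinfun_compose.add_right
      blinfun_compose.scaleR_left blinfun_compose.scaleR_right)

lemma bounded_ops_compose: "a \<in> bounded_ops \<Longrightarrow> b \<in> bounded_ops \<Longrightarrow> a o\<^sub>L b \<in> bounded_ops"
  and bounded_ops_id: "id_blinfun \<in> bounded_ops"
  by (simp_all add: bounded_ops_def)

text \<open>The bicommutant condition as a commutation test, the form in which
  \<open>cut_commute\<close> delivers membership of the cuts.\<close>

lemma vna_mem_iff:
  assumes "von_neumann_algebra M"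
  shows "x \<in> M \<longleftrightarrow> x \<in> bounded_ops \<and> (\<forall>b\<in>commutant M. b o\<^sub>L x = x o\<^sub>L b)"
proof -
  have "x \<in> M \<longleftrightarrow> x \<in> commutant (commutant M)" using assms by (simp add: von_neumann_algebra_def)
  then show ?thesis by (simp add: commutant_def[of "commutant M"])
qed

locale tracial_vna =
  fixes M :: "'h::chilbert_space oper set" and \<tau> :: "'h oper \<Rightarrow> complex"
  assumes vna: "von_neumann_algebra M" and state: "faithful_normal_tracial_state M \<tau>"
begin

lemma mem_add: "x \<in> M \<Longrightarrow> y \<in> M \<Longrightarrow> x + y \<in> M"
  and mem_scaleR: "x \<in> M \<Longrightarrow> r *\<^sub>R x \<in> M"
  and mem_compose: "x \<in> M \<Longrightarrow> y \<in> M \<Longrightarrow> x o\<^sub>L y \<in> M"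
  and mem_id: "id_blinfun \<in> M"
  by (simp_all add: vna_mem_iff[OF vna] bounded_ops_add bounded_ops_scaleR bounded_ops_compose bounded_ops_id
      blinfun_compose.add_left blinfun_compose.add_right commute_compose
      blinfun_compose.scaleR_left blinfun_compose.scaleR_right) (auto intro: blinfun_eqI)

lemma mem_diff: "x \<in> M \<Longrightarrow> y \<in> M \<Longrightarrow> x - y \<in> M"
  using mem_add[of x "-1 *\<^sub>R y"] mem_scaleR[of y "-1"] by simp

lemma mem_zero: "0 \<in> M"
  using mem_scaleR[OF mem_id, of 0] by simp

lemma mem_sum: "(\<And>i. i \<in> A \<Longrightarrow> f i \<in> M) \<Longrightarrow> sum f A \<in> M"
  by (induction A rule: infinite_finite_induct) (auto simp: mem_zero mem_add)

lemma mem_bounded_ops: "x \<in> M \<Longrightarrow> x \<in> bounded_ops"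
  and mem_adj: "x \<in> M \<Longrightarrow> adj x \<in> M"
  using vna by (auto simp: von_neumann_algebra_def)

lemma sa_part_iff: "x \<in> sa_part M \<longleftrightarrow> x \<in> M \<and> symmetric_op x"
  using mem_bounded_ops by (auto simp: sa_part_def selfadjoint_iff)

lemma sa_part_selfadjoint: "x \<in> sa_part M \<Longrightarrow> selfadjoint x"
  by (simp add: sa_part_def)

lemma mem_upcut:
  assumes "a \<in> sa_part M"
  shows "upcut a s \<in> M"
  using assms cut_bounded_ops[of a s] cut_commute[of a]
  by (auto simp: vna_mem_iff[OF vna] sa_part_def selfadjoint_iff)

lemma sa_part_add: "x \<in> sa_part M \<Longrightarrow> y \<in> sa_part M \<Longrightarrow> x + y \<in> sa_part M"
  and sa_part_scaleR: "x \<in> sa_part M \<Longrightarrow> r *\<^sub>R x \<in> sa_part M"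
  and sa_part_shift: "x \<in> sa_part M \<Longrightarrow> x + r *\<^sub>R id_blinfun \<in> sa_part M"
  and sa_part_zero: "0 \<in> sa_part M"
  by (auto simp: sa_part_iff mem_add mem_scaleR mem_id mem_zero symmetric_op_add symmetric_op_scaleR symmetric_op_id)
     (simp add: symmetric_op_def)

definition tr :: "'h oper \<Rightarrow> real" where "tr x = Re (\<tau> x)"

lemma tr_add: "x \<in> M \<Longrightarrow> y \<in> M \<Longrightarrow> tr (x + y) = tr x + tr y"
  and tr_nonneg: "x \<in> M \<Longrightarrow> positive_op x \<Longrightarrow> tr x \<ge> 0"
  and tr_id: "tr id_blinfun = 1"
  and tr_commute: "x \<in> M \<Longrightarrow> y \<in> M \<Longrightarrow> tr (x o\<^sub>L y) = tr (y o\<^sub>L x)"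
  using state by (auto simp: tr_def faithful_normal_tracial_state_def positive_functional_on_def complex_nonneg_Reals_iff)

lemma tr_scaleR: "x \<in> M \<Longrightarrow> tr (r *\<^sub>R x) = r * tr x"
proof -
  assume "x \<in> M"
  then have "\<tau> (scaleC_op (of_real r) x) = of_real r * \<tau> x"
    using state unfolding faithful_normal_tracial_state_def positive_functional_on_def by blast
  then show ?thesis by (simp add: scaleC_op_of_real tr_def)
qed

lemma tr_diff: "x \<in> M \<Longrightarrow> y \<in> M \<Longrightarrow> tr (x - y) = tr x - tr y"
  using tr_add[of x "-1 *\<^sub>R y"] tr_scaleR[of y "-1"] mem_scaleR[of y "-1"] by simp

lemma tr_zero: "tr 0 = 0"
  using tr_scaleR[OF mem_id, of 0] by simp

lemma positive_opI: "x \<in> M \<Longrightarrow> symmetric_op x \<Longrightarrow> (\<And>v. inner v (x v) \<ge> 0) \<Longrightarrow> positive_op x"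
  by (simp add: positive_op_iff selfadjoint_iff mem_bounded_ops)

text \<open>The product of q and z need not be positive, but by the trace property it has the same
  trace as q z q, which is.\<close>

lemma tr_projection_compose_nonneg:
  assumes q: "q \<in> M" "orth_proj q" and z: "z \<in> M" "positive_op z"
  shows "tr (q o\<^sub>L z) \<ge> 0"
proof -
  have "tr (q o\<^sub>L z) = tr (q o\<^sub>L (q o\<^sub>L z))"
    using q by (intro arg_cong[of _ _ tr] blinfun_eqI) (simp add: orth_projD)
  also have "\<dots> = tr ((q o\<^sub>L z) o\<^sub>L q)" by (intro tr_commute mem_compose q z)
  also have "\<dots> \<ge> 0"
  proof (intro tr_nonneg positive_opI mem_compose q z)
    have s: "symmetric_op z" and p: "\<And>v. inner v (z v) \<ge> 0" using z by (auto simp: positive_op_iff selfadjoint_iff)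
    show "symmetric_op (q o\<^sub>L z o\<^sub>L q)"
      by (simp add: symmetric_op_def orth_projD(2)[OF q(2)] symmetric_opD[OF s])
    show "inner v ((q o\<^sub>L z o\<^sub>L q) v) \<ge> 0" for v
      using p[of "q v"] by (simp add: orth_projD(2)[OF q(2), symmetric])
  qed
  finally show ?thesis .
qed

lemma tr_projection_compose_le:
  assumes q: "q \<in> M" "orth_proj q" and z: "z \<in> M" "positive_op z"
  shows "tr (q o\<^sub>L z) \<le> tr z"
proof -
  have "0 \<le> tr ((id_blinfun - q) o\<^sub>L z)"
    by (intro tr_projection_compose_nonneg mem_diff mem_id orth_proj_compl q z)
  also have "(id_blinfun - q) o\<^sub>L z = z - (q o\<^sub>L z)" by (rule blinfun_eqI) (simp add: blinfun.bilinear_simps)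
  finally show ?thesis using q z by (simp add: tr_diff mem_compose)
qed

text \<open>\<open>excess a l\<close> is the trace of the positive part of \<open>a - l\<close>.\<close>

definition excess :: "'h oper \<Rightarrow> real \<Rightarrow> real" where
  "excess a l = tr (upcut a l o\<^sub>L (a - l *\<^sub>R id_blinfun))"

definition distr_fun :: "'h oper \<Rightarrow> real \<Rightarrow> real" where
  "distr_fun a s = tr (upcut a s)"

text \<open>With p the cut at l, p b and (p - 1) b are the positive and negative parts of b = a - l.
  Compressing by q cannot raise the trace of the first, and the second only subtracts.\<close>

lemma tr_compose_shift_le_excess:
  assumes a: "a \<in> sa_part M" and q: "q \<in> M" "orth_proj q"
  shows "tr (q o\<^sub>L (a - l *\<^sub>R id_blinfun)) \<le> excess a l"
proof -
  have s: "symmetric_op a" and aM: "a \<in> M" using a by (auto simp: sa_part_iff)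
  define p where "p = upcut a l"
  define b where "b = a - l *\<^sub>R id_blinfun"
  have pM: "p \<in> M" by (simp add: p_def mem_upcut[OF a])
  have bM: "b \<in> M" by (simp add: b_def mem_diff mem_scaleR mem_id aM)
  have p: "orth_proj p" by (simp add: p_def orth_proj_cut[OF s])
  have b: "symmetric_op b" by (simp add: b_def symmetric_op_diff s symmetric_op_scaleR symmetric_op_id)
  have pb: "p (b x) = b (p x)" for x
    using commute_opD[OF cut_commute_self[OF s], of l x] by (simp add: p_def b_def blinfun.bilinear_simps)
  have bx: "inner v (b v) = inner v (a v) - l * inner v v" for v
    by (simp add: b_def blinfun.bilinear_simps inner_diff)
  have pos: "positive_op (p o\<^sub>L b)"
  proof (intro positive_opI mem_compose pM bM)
    show "symmetric_op (p o\<^sub>L b)"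
      by (simp add: symmetric_op_def orth_projD(2)[OF p] symmetric_opD[OF b] pb)
    show "inner v ((p o\<^sub>L b) v) \<ge> 0" for v
    proof -
      have "inner v ((p o\<^sub>L b) v) = inner (p v) (b (p v))"
        by (simp add: orth_projD[OF p] pb[symmetric])
      moreover have "inner (p v) (b (p v)) \<ge> 0"
        using cut_fix_gt[OF s, of l "p v"] orth_projD(1)[OF p, of v] unfolding bx p_def
        by (cases "upcut a l v = 0") auto
      ultimately show ?thesis by simp
    qed
  qed
  have neg: "positive_op ((p - id_blinfun) o\<^sub>L b)"
  proof (intro positive_opI mem_compose mem_diff mem_id pM bM)
    show "symmetric_op ((p - id_blinfun) o\<^sub>L b)"
      by (simp add: symmetric_op_def orth_projD(2)[OF p] symmetric_opD[OF b] pb blinfun.bilinear_simps inner_diff)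
    show "inner v (((p - id_blinfun) o\<^sub>L b) v) \<ge> 0" for v
    proof -
      define w where "w = v - p v"
      have pw: "p w = 0" by (simp add: w_def blinfun.bilinear_simps orth_projD(1)[OF p])
      have v: "v = w + p v" by (simp add: w_def)
      have "((p - id_blinfun) o\<^sub>L b) v = - b w"
        by (simp add: w_def blinfun.bilinear_simps pb)
      moreover have "inner (p v) (b w) = 0"
        by (simp add: orth_projD(2)[OF p] pb pw blinfun.bilinear_simps)
      ultimately have "inner v (((p - id_blinfun) o\<^sub>L b) v) = - inner w (b w)"
        using inner_add_left[of w "p v" "b w"] v by simp
      moreover have "inner w (b w) \<le> 0" using cut_zero_le[OF s, of l w] pw by (simp add: bx p_def)
      ultimately show ?thesis by simp
    qed
  qed
  have "q o\<^sub>L b = (q o\<^sub>L (p o\<^sub>L b)) - (q o\<^sub>L ((p - id_blinfun) o\<^sub>L b))"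
    by (rule blinfun_eqI) (simp add: blinfun.bilinear_simps)
  then have "tr (q o\<^sub>L b) = tr (q o\<^sub>L (p o\<^sub>L b)) - tr (q o\<^sub>L ((p - id_blinfun) o\<^sub>L b))"
    by (simp add: tr_diff mem_compose mem_diff mem_id q pM bM)
  moreover have "tr (q o\<^sub>L (p o\<^sub>L b)) \<le> tr (p o\<^sub>L b)"
    by (intro tr_projection_compose_le q mem_compose pM bM pos)
  moreover have "tr (q o\<^sub>L ((p - id_blinfun) o\<^sub>L b)) \<ge> 0"
    by (intro tr_projection_compose_nonneg q mem_compose mem_diff mem_id pM bM neg)
  ultimately show ?thesis by (simp add: excess_def p_def b_def)
qed

text \<open>The projection that is optimal for a + b is merely a competitor for a and for b.\<close>

lemma excess_subadditive:
  assumes a: "a \<in> sa_part M" and b: "b \<in> sa_part M"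
  shows "excess (a + b) (l + u) \<le> excess a l + excess b u"
proof -
  have ab: "a + b \<in> sa_part M" by (rule sa_part_add[OF a b])
  have s: "symmetric_op (a + b)" using ab by (simp add: sa_part_iff)
  let ?p = "upcut (a + b) (l + u)"
  have M: "a \<in> M" "b \<in> M" "?p \<in> M" using a b mem_upcut[OF ab] by (auto simp: sa_part_iff)
  have "?p o\<^sub>L (a + b - (l + u) *\<^sub>R id_blinfun) = (?p o\<^sub>L (a - l *\<^sub>R id_blinfun)) + (?p o\<^sub>L (b - u *\<^sub>R id_blinfun))"
    by (rule blinfun_eqI) (simp add: blinfun.bilinear_simps algebra_simps)
  then have "excess (a + b) (l + u) = tr (?p o\<^sub>L (a - l *\<^sub>R id_blinfun)) + tr (?p o\<^sub>L (b - u *\<^sub>R id_blinfun))"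
    unfolding excess_def by (simp add: tr_add mem_compose mem_diff mem_scaleR mem_id M)
  also have "\<dots> \<le> excess a l + excess b u"
    by (intro add_mono tr_compose_shift_le_excess a b M orth_proj_cut[OF s])
  finally show ?thesis .
qed

text \<open>Each bound uses the cut of one level as a competitor at the other level.\<close>

lemma excess_increments:
  assumes a: "a \<in> sa_part M"
  shows "(u - l) * distr_fun a u \<le> excess a l - excess a u \<and> excess a l - excess a u \<le> (u - l) * distr_fun a l"
proof -
  have s: "symmetric_op a" and M: "a \<in> M" using a by (auto simp: sa_part_iff)
  have shift: "tr (upcut a v o\<^sub>L (a - w *\<^sub>R id_blinfun)) = excess a v + (v - w) * distr_fun a v" for v w
  proof -
    have "upcut a v o\<^sub>L (a - w *\<^sub>R id_blinfun) = (upcut a v o\<^sub>L (a - v *\<^sub>R id_blinfun)) + (v - w) *\<^sub>R upcut a v"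
      by (rule blinfun_eqI) (simp add: blinfun.bilinear_simps algebra_simps)
    then show ?thesis
      by (simp add: excess_def distr_fun_def tr_add tr_scaleR mem_compose mem_diff mem_scaleR mem_id mem_upcut[OF a] M)
  qed
  show ?thesis
    using tr_compose_shift_le_excess[OF a mem_upcut[OF a] orth_proj_cut[OF s], of u l]
      tr_compose_shift_le_excess[OF a mem_upcut[OF a] orth_proj_cut[OF s], of l u]
    unfolding shift by (simp add: algebra_simps)
qed

lemma distr_fun_antimono:
  assumes a: "a \<in> sa_part M" and st: "s \<le> t"
  shows "distr_fun a t \<le> distr_fun a s"
proof -
  have s: "symmetric_op a" using a by (simp add: sa_part_iff)
  note d = orth_proj_diff[OF orth_proj_cut[OF s] orth_proj_cut[OF s] cut_antimono[OF s st]]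
  have "0 \<le> tr ((upcut a s - upcut a t) o\<^sub>L id_blinfun)"
    by (intro tr_projection_compose_nonneg mem_diff mem_upcut[OF a] d mem_id positive_opI symmetric_op_id) simp
  also have "(upcut a s - upcut a t) o\<^sub>L id_blinfun = upcut a s - upcut a t" by (rule blinfun_eqI) simp
  finally show ?thesis by (simp add: tr_diff mem_upcut[OF a] distr_fun_def)
qed

lemma distr_fun_above: "a \<in> sa_part M \<Longrightarrow> norm a \<le> s \<Longrightarrow> distr_fun a s = 0"
  and distr_fun_below: "a \<in> sa_part M \<Longrightarrow> s < - norm a \<Longrightarrow> distr_fun a s = 1"
  by (simp_all add: distr_fun_def cut_above_norm cut_below_norm sa_part_iff tr_zero tr_id)

lemma distr_fun_range:
  assumes a: "a \<in> sa_part M"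
  shows "distr_fun a s \<in> {0..1}"
proof -
  have "distr_fun a (max s (norm a)) \<le> distr_fun a s" "distr_fun a s \<le> distr_fun a (min s (- norm a - 1))"
    by (rule distr_fun_antimono[OF a], simp)+
  then show ?thesis by (simp add: distr_fun_above[OF a] distr_fun_below[OF a])
qed

lemma distr_fun_measurable:
  assumes a: "a \<in> sa_part M"
  shows "distr_fun a \<in> borel_measurable borel"
proof -
  have "(\<lambda>s. - distr_fun a s) \<in> borel_measurable borel"
    by (rule borel_measurable_mono) (auto simp: mono_def distr_fun_antimono[OF a])
  then show ?thesis by simp
qed

end

section \<open>Choquet integrals of distribution functions\<close>

lemma integrable_bounded_support:
  fixes f :: "real \<Rightarrow> real"
  assumes "f \<in> borel_measurable borel" "\<And>s. \<bar>f s\<bar> \<le> B" "\<And>s. s \<notin> {l..u} \<Longrightarrow> f s = 0"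
  shows "integrable lborel f"
  using assms by (intro integrableI_bounded_set[where A="{l..u}" and B=B]) (auto simp: emeasure_lborel_Icc_eq)

lemma integral_indicator_shift:
  fixes c :: real
  shows "integrable lborel (\<lambda>s. indicator {..<c} s - indicator {..<0} s :: real)"
    and "(LBINT s. indicator {..<c} s - indicator {..<0} s) = c"
proof -
  show "integrable lborel (\<lambda>s. indicator {..<c} s - indicator {..<0} s :: real)"
    by (rule integrable_bounded_support[where B=1 and l="min c 0" and u="max c 0"]) (auto simp: indicator_def)
  show "(LBINT s. indicator {..<c} s - indicator {..<0} s) = c"
  proof (cases "c \<ge> 0")
    case True
    have "(LBINT s. indicator {..<c} s - indicator {..<0} s) = (LBINT s. indicator {0..<c} s :: real)"
      using True by (intro Bochner_Integration.integral_cong) (auto simp: indicator_def)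
    then show ?thesis using True by simp
  next
    case False
    have "(LBINT s. indicator {..<c} s - indicator {..<0} s) = (LBINT s. - (indicator {c..<0} s :: real))"
      using False by (intro Bochner_Integration.integral_cong) (auto simp: indicator_def)
    then show ?thesis using False by simp
  qed
qed

text \<open>Wide enough for - \<alpha>, which handles convex weights, for the hinges min t r, and
  for the difference between a weight and its approximant; such functions may decrease and take any
  value at 1.\<close>

definition weight :: "(real \<Rightarrow> real) \<Rightarrow> bool" where
  "weight g \<longleftrightarrow> continuous_on {0..1} g \<and> g 0 = 0"

lemma weight_bounded:
  assumes "weight g"
  obtains B where "\<And>t. t \<in> {0..1} \<Longrightarrow> \<bar>g t\<bar> \<le> B"
proof -
  have "compact (g ` {0..1})" using assms by (auto simp: weight_def intro: compact_continuous_image)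
  then have "bounded (g ` {0..1})" by (rule compact_imp_bounded)
  then obtain B where "\<forall>y\<in>g ` {0..1}. norm y \<le> B" unfolding bounded_iff by blast
  then have "\<bar>g t\<bar> \<le> B" if "t \<in> {0..1}" for t using that by simp
  then show ?thesis by (rule that)
qed

lemma weight_add: "weight g \<Longrightarrow> weight h \<Longrightarrow> weight (\<lambda>t. g t + h t)"
  and weight_cmult: "weight g \<Longrightarrow> weight (\<lambda>t. c * g t)"
  and weight_diff: "weight g \<Longrightarrow> weight h \<Longrightarrow> weight (\<lambda>t. g t - h t)"
  and weight_uminus: "weight g \<Longrightarrow> weight (\<lambda>t. - g t)"
  and weight_id: "weight (\<lambda>t. t)"
  and weight_min: "0 \<le> r \<Longrightarrow> weight (\<lambda>t. min t r)"
  by (auto simp: weight_def intro!: continuous_intros)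

lemma weight_sum: "(\<And>j. j \<in> A \<Longrightarrow> weight (g j)) \<Longrightarrow> weight (\<lambda>t. \<Sum>j\<in>A. g j t)"
  by (auto simp: weight_def intro!: continuous_intros)

context tracial_vna
begin

text \<open>Subtracting \<open>g 1\<close> on the negative half-line makes the Choquet integral translatable.\<close>

definition layer :: "(real \<Rightarrow> real) \<Rightarrow> 'h oper \<Rightarrow> real" where
  "layer g a = (LBINT s. g (distr_fun a s) - g 1 * indicator {..<0} s)"

lemma layer_integrable:
  assumes g: "weight g" and a: "a \<in> sa_part M"
  shows "integrable lborel (\<lambda>s. g (distr_fun a s) - g 1 * indicator {..<0} s)"
proof -
  obtain B where B: "\<And>t. t \<in> {0..1} \<Longrightarrow> \<bar>g t\<bar> \<le> B" using weight_bounded[OF g] by blast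
  \<comment> \<open>g is constrained only on [0,1]; clamping gives a continuous function on the line
    that can be composed with a measurable one.\<close>
  define g' where "g' t = g (max 0 (min 1 t))" for t
  have "continuous_on UNIV g'"
    unfolding g'_def
    by (rule continuous_on_compose2[of "{0..1}" g UNIV "\<lambda>t. max 0 (min 1 t)"])
       (use g in \<open>auto simp: weight_def intro!: continuous_intros\<close>)
  then have "(\<lambda>s. g' (distr_fun a s)) \<in> borel_measurable borel"
    using distr_fun_measurable[OF a] by (rule borel_measurable_continuous_on)
  moreover have "g' (distr_fun a s) = g (distr_fun a s)" for s
    using distr_fun_range[OF a, of s] by (simp add: g'_def)
  ultimately have m: "(\<lambda>s. g (distr_fun a s)) \<in> borel_measurable borel" by simp
  show ?thesis
  proof (rule integrable_bounded_support[where B="2 * B" and l="- norm a" and u="norm a"])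
    show "(\<lambda>s. g (distr_fun a s) - g 1 * indicator {..<0} s) \<in> borel_measurable borel" using m by measurable
    show "\<bar>g (distr_fun a s) - g 1 * indicator {..<0} s\<bar> \<le> 2 * B" for s
      using B[OF distr_fun_range[OF a, of s]] B[of 1] by (auto simp: indicator_def)
    show "g (distr_fun a s) - g 1 * indicator {..<0} s = 0" if "s \<notin> {- norm a..norm a}" for s
    proof (cases "s < - norm a")
      case True
      then have "s < 0" using norm_ge_zero[of a] by linarith
      then show ?thesis using True by (simp add: distr_fun_below[OF a])
    next
      case False
      then have "norm a \<le> s" "\<not> s < 0" using that norm_ge_zero[of a] by auto
      then show ?thesis using g by (simp add: distr_fun_above[OF a] weight_def)
    qed
  qed
qed

lemma layer_add: "weight g \<Longrightarrow> weight h \<Longrightarrow> a \<in> sa_part M \<Longrightarrow> layer (\<lambda>t. g t + h t) a = layer g a + layer h a"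
  unfolding layer_def
  by (subst Bochner_Integration.integral_add[symmetric]) (auto intro: layer_integrable simp: algebra_simps)

lemma layer_cmult: "layer (\<lambda>t. c * g t) a = c * layer g a"
  unfolding layer_def by (simp add: algebra_simps flip: integral_mult_right_zero)

lemma layer_diff: "weight g \<Longrightarrow> weight h \<Longrightarrow> a \<in> sa_part M \<Longrightarrow> layer (\<lambda>t. g t - h t) a = layer g a - layer h a"
  using layer_add[of g "\<lambda>t. -1 * h t" a] layer_cmult[of "-1" h a] weight_cmult[of h "-1"] by simp

lemma layer_sum:
  assumes "\<And>j. j \<in> A \<Longrightarrow> weight (g j)" "a \<in> sa_part M"
  shows "layer (\<lambda>t. \<Sum>j\<in>A. g j t) a = (\<Sum>j\<in>A. layer (g j) a)"
  using assms
proof (induction A rule: infinite_finite_induct)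
  case (insert j A)
  then show ?case by (simp add: layer_add weight_sum)
qed (simp_all add: layer_def)

lemma layer_mono:
  assumes "weight g" "weight h" "a \<in> sa_part M" "\<And>t. t \<in> {0..1} \<Longrightarrow> g t \<le> h t" "g 1 = h 1"
  shows "layer g a \<le> layer h a"
  unfolding layer_def using assms distr_fun_range[OF assms(3)]
  by (intro integral_mono layer_integrable) auto

text \<open>The integrand is at most 2 B on an interval of length 2 R and vanishes outside
  it.\<close>

lemma abs_layer_le:
  assumes g: "weight g" and a: "a \<in> sa_part M" and B: "\<And>t. t \<in> {0..1} \<Longrightarrow> \<bar>g t\<bar> \<le> B" and R: "norm a \<le> R"
  shows "\<bar>layer g a\<bar> \<le> 4 * B * R"
proof -
  have R0: "R \<ge> 0" using R norm_ge_zero order_trans by blast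
  have "\<bar>layer g a\<bar> \<le> (LBINT s. \<bar>g (distr_fun a s) - g 1 * indicator {..<0} s\<bar>)"
    unfolding layer_def by (rule integral_abs_bound)
  also have "\<dots> \<le> (LBINT s. 2 * B * indicator {-R..R} s)"
  proof (rule integral_mono)
    show "integrable lborel (\<lambda>s. \<bar>g (distr_fun a s) - g 1 * indicator {..<0} s\<bar>)"
      by (intro integrable_abs layer_integrable g a)
    show "integrable lborel (\<lambda>s. 2 * B * indicator {-R..R} s)"
      by (rule integrable_mult_right) (simp add: integrable_indicator_iff emeasure_lborel_Icc_eq)
    show "\<bar>g (distr_fun a s) - g 1 * indicator {..<0} s\<bar> \<le> 2 * B * indicator {-R..R} s" for s
    proof (cases "s \<in> {-R..R}")
      case True
      then show ?thesis using B[OF distr_fun_range[OF a, of s]] B[of 1] by (auto simp: indicator_def)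
    next
      case False
      then show ?thesis using R R0 g
        by (cases "s < -R") (auto simp: distr_fun_below[OF a] distr_fun_above[OF a] weight_def indicator_def)
    qed
  qed
  also have "\<dots> = 4 * B * R" using R0 by simp
  finally show ?thesis .
qed

text \<open>Layer-cake formula. The excess and the tail integral of the distribution function obey
  the same increment bounds and both vanish at R, which is chosen beyond the norm and strictly above
  l.\<close>

lemma excess_eq_integral:
  assumes a: "a \<in> sa_part M"
  shows "integrable lborel (\<lambda>s. distr_fun a s * indicator {l..} s)"
    and "excess a l = (LBINT s. distr_fun a s * indicator {l..} s)"
proof -
  note F = distr_fun_range[OF a]
  have meas[measurable]: "distr_fun a \<in> borel_measurable borel" by (rule distr_fun_measurable[OF a])
  show int: "integrable lborel (\<lambda>s. distr_fun a s * indicator {l..} s)" for l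
    by (rule integrable_bounded_support[where B=1 and l=l and u="norm a"])
       (use F in \<open>auto simp: indicator_def distr_fun_above[OF a]\<close>)
  define T where "T l = (LBINT s. distr_fun a s * indicator {l..} s)" for l
  define R where "R = max l (norm a) + 1"
  have R: "l < R" "norm a \<le> R" by (auto simp: R_def)
  have "excess a l - excess a R = T l - T R"
  proof (rule increments_unique[where F="distr_fun a"])
    show "(u - l) * distr_fun a u \<le> excess a l - excess a u \<and> excess a l - excess a u \<le> (u - l) * distr_fun a l" for l u
      by (rule excess_increments[OF a])
    show "(u - l) * distr_fun a u \<le> T l - T u \<and> T l - T u \<le> (u - l) * distr_fun a l" if lu: "l < u" for l u
    proof -
      have T: "T l - T u = (LBINT s. distr_fun a s * indicator {l..} s - distr_fun a s * indicator {u..} s)"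
        unfolding T_def by (rule Bochner_Integration.integral_diff[symmetric]) (rule int)+
      have i: "integrable lborel (\<lambda>s. distr_fun a s * indicator {l..} s - distr_fun a s * indicator {u..} s)"
        by (rule Bochner_Integration.integrable_diff) (rule int)+
      have c: "(LBINT s. c * indicator {l..<u} s) = (u - l) * c" "integrable lborel (\<lambda>s. c * indicator {l..<u} s)" for c :: real
        using lu by simp_all
      have "(LBINT s. distr_fun a u * indicator {l..<u} s) \<le> T l - T u"
        unfolding T by (rule integral_mono[OF c(2) i]) (use lu in \<open>auto simp: indicator_def intro: distr_fun_antimono[OF a]\<close>)
      moreover have "T l - T u \<le> (LBINT s. distr_fun a l * indicator {l..<u} s)"
        unfolding T by (rule integral_mono[OF i c(2)]) (use lu in \<open>auto simp: indicator_def intro: distr_fun_antimono[OF a]\<close>)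
      ultimately show ?thesis by (simp only: c)
    qed
  qed (rule R)
  moreover have "excess a R = 0"
    using R a by (simp add: excess_def cut_above_norm sa_part_iff tr_zero)
  moreover have "T R = 0"
  proof -
    have "distr_fun a s * indicator {R..} s = 0" for s
      using R by (auto simp: indicator_def distr_fun_above[OF a])
    then show ?thesis unfolding T_def by (simp only: Bochner_Integration.integral_zero)
  qed
  ultimately show "excess a l = (LBINT s. distr_fun a s * indicator {l..} s)" by (simp add: T_def)
qed

lemma layer_id:
  assumes a: "a \<in> sa_part M"
  shows "layer (\<lambda>t. t) a = tr a"
proof -
  define R where "R = norm a + 1"
  have R: "R > 0" "- R < - norm a" using norm_ge_zero[of a] unfolding R_def by linarith+
  have s: "symmetric_op a" and M: "a \<in> M" using a by (auto simp: sa_part_iff)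
  have "layer (\<lambda>t. t) a = (LBINT s. distr_fun a s * indicator {-R..} s + (indicator {..<-R} s - indicator {..<0} s))"
    unfolding layer_def using R
    by (intro Bochner_Integration.integral_cong) (auto simp: indicator_def distr_fun_below[OF a])
  also have "\<dots> = excess a (-R) + (- R)"
    unfolding excess_eq_integral(2)[OF a]
    by (subst Bochner_Integration.integral_add) (simp_all only: excess_eq_integral(1)[OF a] integral_indicator_shift)
  also have "excess a (-R) = tr (a + R *\<^sub>R id_blinfun)"
    unfolding excess_def cut_below_norm[OF s R(2)] by (intro arg_cong[of _ _ tr] blinfun_eqI) simp
  also have "\<dots> = tr a + R" by (simp add: tr_add tr_scaleR mem_scaleR mem_id M tr_id)
  finally show ?thesis by simp
qed

text \<open>Pointwise estimate: bound the minimum by r to the left of l and by the distribution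
  function from l onwards.\<close>

lemma layer_min_le:
  assumes a: "a \<in> sa_part M" and r: "0 \<le> r" "r \<le> 1"
  shows "layer (\<lambda>t. min t r) a \<le> r * l + excess a l"
proof -
  let ?f = "\<lambda>s. r * (indicator {..<l} s - indicator {..<0} s) + distr_fun a s * indicator {l..} s"
  have "layer (\<lambda>t. min t r) a \<le> (LBINT s. ?f s)"
    unfolding layer_def
  proof (rule integral_mono)
    show "integrable lborel (\<lambda>s. min (distr_fun a s) r - min 1 r * indicator {..<0} s)"
      by (rule layer_integrable[OF weight_min[OF r(1)] a])
    show "integrable lborel ?f"
      by (intro Bochner_Integration.integrable_add integrable_mult_right integral_indicator_shift excess_eq_integral[OF a])
    show "min (distr_fun a s) r - min 1 r * indicator {..<0} s \<le> ?f s" for s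
      using r by (auto simp: indicator_def)
  qed
  also have "\<dots> = r * l + excess a l"
    unfolding excess_eq_integral(2)[OF a]
    by (subst Bochner_Integration.integral_add)
       (simp_all only: integral_mult_right_zero integral_indicator_shift excess_eq_integral[OF a] integrable_mult_right)
  finally show ?thesis .
qed

text \<open>The estimate of \<open>layer_min_le\<close> is sharp at the level l where the antitone
  distribution function crosses r; only the single point l may be an exception. r < 1 makes the set
  above r nonempty, so its supremum is a genuine level.\<close>

lemma layer_min_eq:
  assumes a: "a \<in> sa_part M" and r: "0 \<le> r" "r < 1"
  shows "\<exists>l. layer (\<lambda>t. min t r) a = r * l + excess a l"
proof -
  define S where "S = {s. r < distr_fun a s}"
  define l where "l = Sup S"
  have "- norm a - 1 \<in> S" using r distr_fun_below[OF a, of "- norm a - 1"] by (simp add: S_def)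
  then have ne: "S \<noteq> {}" by blast
  have bdd: "bdd_above S"
  proof (rule bdd_aboveI)
    show "s \<le> norm a" if "s \<in> S" for s
      using that r distr_fun_above[OF a, of s] by (cases "norm a \<le> s") (auto simp: S_def)
  qed
  have below: "r \<le> distr_fun a s" if sl: "s < l" for s
  proof -
    obtain t where "t \<in> S" "s < t" using sl less_cSup_iff[OF ne bdd, of s] unfolding l_def by blast
    then show ?thesis using distr_fun_antimono[OF a, of s t] by (simp add: S_def)
  qed
  have above: "distr_fun a s \<le> r" if "l < s" for s
    using that cSup_upper[OF _ bdd, of s] by (force simp: l_def S_def)
  let ?f = "\<lambda>s. r * (indicator {..<l} s - indicator {..<0} s) + distr_fun a s * indicator {l..} s"
  have int: "integrable lborel ?f"
    by (intro Bochner_Integration.integrable_add integrable_mult_right integral_indicator_shift excess_eq_integral[OF a])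
  have "AE s in lborel. s \<noteq> l" by (rule AE_lborel_singleton)
  then have "AE s in lborel. min (distr_fun a s) r - min 1 r * indicator {..<0} s = ?f s"
  proof eventually_elim
    case (elim s)
    then show ?case using r below[of s] above[of s] by (cases "s < l") (auto simp: indicator_def)
  qed
  then have "layer (\<lambda>t. min t r) a = (LBINT s. ?f s)"
    unfolding layer_def
    using borel_measurable_integrable[OF int] borel_measurable_integrable[OF layer_integrable[OF weight_min[OF r(1)] a]]
    by (intro integral_cong_AE)
  also have "\<dots> = r * l + excess a l"
    unfolding excess_eq_integral(2)[OF a]
    by (subst Bochner_Integration.integral_add)
       (simp_all only: integral_mult_right_zero integral_indicator_shift excess_eq_integral[OF a] integrable_mult_right)
  finally show ?thesis by blast
qed

text \<open>The sum l + u of the optimal levels for a and b is a competitor for a + b, and the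
  excess is subadditive there.\<close>

lemma layer_min_subadditive:
  assumes a: "a \<in> sa_part M" and b: "b \<in> sa_part M" and r: "0 \<le> r" "r < 1"
  shows "layer (\<lambda>t. min t r) (a + b) \<le> layer (\<lambda>t. min t r) a + layer (\<lambda>t. min t r) b"
proof -
  obtain l u where l: "layer (\<lambda>t. min t r) a = r * l + excess a l" and u: "layer (\<lambda>t. min t r) b = r * u + excess b u"
    using layer_min_eq[OF a r] layer_min_eq[OF b r] by blast
  have "layer (\<lambda>t. min t r) (a + b) \<le> r * (l + u) + excess (a + b) (l + u)"
    using r by (intro layer_min_le sa_part_add a b) auto
  also have "\<dots> \<le> r * (l + u) + (excess a l + excess b u)"
    by (intro add_left_mono excess_subadditive a b)
  finally show ?thesis using l u by (simp add: algebra_simps)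
qed

end

section \<open>Subadditivity of the Choquet trace\<close>

lemma upcut_shift:
  fixes a :: "'a::{real_inner,banach} \<Rightarrow>\<^sub>L 'a"
  assumes a: "symmetric_op a"
  shows "upcut (a + c *\<^sub>R id_blinfun) s = upcut a (s - c)"
proof (rule cut_eqI)
  show "symmetric_op (a + c *\<^sub>R id_blinfun)" by (intro symmetric_op_add symmetric_op_scaleR symmetric_op_id a)
  show "cut_proj (a + c *\<^sub>R id_blinfun) s (upcut a (s - c))"
    unfolding cut_proj_def
  proof (intro conjI allI impI)
    let ?p = "upcut a (s - c)"
    show "orth_proj ?p" by (rule orth_proj_cut[OF a])
    show "?p o\<^sub>L (a + c *\<^sub>R id_blinfun) = (a + c *\<^sub>R id_blinfun) o\<^sub>L ?p"
      by (rule blinfun_eqI) (simp add: blinfun.bilinear_simps commute_opD[OF cut_commute_self[OF a]])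
    show "inner x ((a + c *\<^sub>R id_blinfun) x) \<le> s * inner x x" if "?p x = 0" for x
      using cut_zero_le[OF a that] by (simp add: blinfun.bilinear_simps inner_add algebra_simps)
    show "s * inner x x < inner x ((a + c *\<^sub>R id_blinfun) x)" if "?p x = x" "x \<noteq> 0" for x
      using cut_fix_gt[OF a that] by (simp add: blinfun.bilinear_simps inner_add algebra_simps)
  qed
qed

lemma upcut_scaleR:
  fixes a :: "'a::{real_inner,banach} \<Rightarrow>\<^sub>L 'a"
  assumes a: "symmetric_op a" and c: "c > 0"
  shows "upcut (c *\<^sub>R a) s = upcut a (s / c)"
proof (rule cut_eqI)
  show "symmetric_op (c *\<^sub>R a)" by (rule symmetric_op_scaleR[OF a])
  show "cut_proj (c *\<^sub>R a) s (upcut a (s / c))"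
    unfolding cut_proj_def
  proof (intro conjI allI impI)
    let ?p = "upcut a (s / c)"
    show "orth_proj ?p" by (rule orth_proj_cut[OF a])
    show "?p o\<^sub>L (c *\<^sub>R a) = (c *\<^sub>R a) o\<^sub>L ?p"
      by (rule blinfun_eqI) (simp add: blinfun.bilinear_simps commute_opD[OF cut_commute_self[OF a]])
    show "inner x ((c *\<^sub>R a) x) \<le> s * inner x x" if "?p x = 0" for x
      using cut_zero_le[OF a that] c by (simp add: blinfun.bilinear_simps field_simps)
    show "s * inner x x < inner x ((c *\<^sub>R a) x)" if "?p x = x" "x \<noteq> 0" for x
      using cut_fix_gt[OF a that] c by (simp add: blinfun.bilinear_simps field_simps)
  qed
qed

context tracial_vna
begin

lemma layer_shift:
  assumes g: "weight g" and a: "a \<in> sa_part M"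
  shows "layer g (a + c *\<^sub>R id_blinfun) = layer g a + c * g 1"
proof -
  have s: "symmetric_op a" using a by (simp add: sa_part_iff)
  have "layer g (a + c *\<^sub>R id_blinfun)
      = (LBINT s. g (distr_fun a (s - c)) - g 1 * indicator {..<0} s)"
    by (simp add: layer_def distr_fun_def upcut_shift[OF s])
  also have "\<dots> = (LBINT s. g (distr_fun a s) - g 1 * indicator {..<0} (c + s))"
    by (subst lborel_integral_real_affine[of 1 _ c]) simp_all
  also have "\<dots> = (LBINT s. (g (distr_fun a s) - g 1 * indicator {..<0} s)
      - g 1 * (indicator {..<-c} s - indicator {..<0} s))"
    by (intro Bochner_Integration.integral_cong) (auto simp: indicator_def)
  also have "\<dots> = layer g a - g 1 * (- c)"
    unfolding layer_def
    by (subst Bochner_Integration.integral_diff)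
       (simp_all only: layer_integrable[OF g a] integrable_mult_right integral_mult_right_zero integral_indicator_shift)
  finally show ?thesis by simp
qed

lemma layer_scaleR:
  assumes a: "a \<in> sa_part M" and c: "c > 0"
  shows "layer g (c *\<^sub>R a) = c * layer g a"
proof -
  have s: "symmetric_op a" using a by (simp add: sa_part_iff)
  have "layer g (c *\<^sub>R a) = (LBINT s. g (distr_fun a (s / c)) - g 1 * indicator {..<0} s)"
    by (simp add: layer_def distr_fun_def upcut_scaleR[OF s c])
  also have "\<dots> = c * (LBINT s. g (distr_fun a s) - g 1 * indicator {..<0} (c * s))"
    using c by (subst lborel_integral_real_affine[of c _ 0]) simp_all
  also have "(\<lambda>s. g (distr_fun a s) - g 1 * indicator {..<0} (c * s)) = (\<lambda>s. g (distr_fun a s) - g 1 * indicator {..<0} s)"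
    using c by (auto simp: indicator_def mult_less_0_iff fun_eq_iff)
  finally show ?thesis by (simp add: layer_def)
qed

text \<open>For positive a the distribution function is 1 on the negative half-line, where the
  correction term of \<open>layer\<close> therefore cancels it.\<close>

lemma choquet_trace_pos_eq_layer:
  assumes g: "weight g" "g 1 = 1" and a: "a \<in> sa_part M" and pos: "positive_op a"
  shows "choquet_trace_pos \<tau> g a = layer g a"
proof -
  have s: "symmetric_op a" using a by (simp add: sa_part_iff)
  have neg: "distr_fun a s = 1" if "s < 0" for s
  proof -
    have "upcut a s = id_blinfun"
    proof (rule cut_eq_id[OF s])
      fix x :: 'h assume "x \<noteq> 0"
      then have "s * inner x x < 0" using that by (simp add: mult_less_0_iff)
      also have "0 \<le> inner x (a x)" using pos by (simp add: positive_op_iff)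
      finally show "s * inner x x < inner x (a x)" .
    qed
    then show ?thesis by (simp add: distr_fun_def tr_id)
  qed
  have "choquet_trace_pos \<tau> g a = (LBINT s. indicator {0..} s * g (distr_fun a s))"
    by (simp add: choquet_trace_pos_def set_lebesgue_integral_def distr_fun_def tr_def
        spectral_projection_eq_upcut[OF sa_part_selfadjoint[OF a]])
  also have "\<dots> = layer g a"
    unfolding layer_def by (intro Bochner_Integration.integral_cong) (auto simp: indicator_def neg g)
  finally show ?thesis .
qed

text \<open>The shift by \<open>norm a\<close> shows that the choice in \<open>choquet_trace\<close>
  succeeds; whichever shift is picked, \<open>layer_shift\<close> undoes it.\<close>

lemma choquet_trace_eq_layer:
  assumes g: "weight g" "g 1 = 1" and a: "a \<in> sa_part M"
  shows "choquet_trace \<tau> g a = layer g a"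
proof -
  define c where "c = (SOME c. positive_op (a + c *\<^sub>R id_blinfun))"
  have "positive_op (a + norm a *\<^sub>R id_blinfun)"
  proof (rule positive_opI)
    show "a + norm a *\<^sub>R id_blinfun \<in> M" "symmetric_op (a + norm a *\<^sub>R id_blinfun)"
      using sa_part_shift[OF a] by (auto simp: sa_part_iff)
    show "inner v ((a + norm a *\<^sub>R id_blinfun) v) \<ge> 0" for v
      using abs_inner_blinfun_le[of v a] by (simp add: blinfun.bilinear_simps inner_add)
  qed
  then have "positive_op (a + c *\<^sub>R id_blinfun)" unfolding c_def by (rule someI)
  then have "choquet_trace \<tau> g a = layer g (a + c *\<^sub>R id_blinfun) - c"
    by (simp add: choquet_trace_def c_def[symmetric] choquet_trace_pos_eq_layer[OF g sa_part_shift[OF a]])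
  then show ?thesis by (simp add: layer_shift[OF g(1) a] g(2))
qed

end

text \<open>Abel summation of the broken line with slopes \<open>d 0, d 1, \<dots>\<close>.\<close>

lemma hinge_sum:
  fixes d :: "nat \<Rightarrow> real"
  assumes "k \<le> n"
  shows "(\<Sum>j<n. (d j - d (Suc j)) * (if j < k then real (Suc j) else x)) + d n * x
    = (\<Sum>j<k. d j) + (x - real k) * d k"
  using assms
proof (induction n rule: dec_induct)
  case base
  have "(\<Sum>j<k. (d j - d (Suc j)) * real (Suc j)) = (\<Sum>j<k. d j) - real k * d k"
    by (induction k) (simp_all add: algebra_simps)
  then show ?case by (simp add: algebra_simps)
next
  case (step n)
  then show ?case by (simp add: algebra_simps)
qed

text \<open>Piecewise linear interpolation at the nodes j / N with mesh below the modulus \<delta>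
  of uniform continuity; midpoint concavity makes the slopes decrease.\<close>

lemma concave_hinge_approximation:
  assumes g: "weight g" and concave: "concave_on {0..1} g" and e: "e > 0"
  obtains n c r \<kappa> where "\<And>j::nat. j < n \<Longrightarrow> 0 \<le> c j" "\<And>j. j < n \<Longrightarrow> 0 \<le> r j \<and> r j < 1"
    "\<And>t. t \<in> {0..1} \<Longrightarrow> \<bar>g t - (\<kappa> * t + (\<Sum>j<n. c j * min t (r j)))\<bar> \<le> e"
proof -
  have "uniformly_continuous_on {0..1} g"
    using g by (intro compact_uniformly_continuous) (auto simp: weight_def)
  then obtain \<delta> where \<delta>: "\<delta> > 0" "\<And>x y. x \<in> {0..1} \<Longrightarrow> y \<in> {0..1} \<Longrightarrow> dist y x < \<delta> \<Longrightarrow> dist (g y) (g x) < e"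
    unfolding uniformly_continuous_on_def using e by metis
  obtain n where n: "inverse (real (Suc n)) < \<delta>" using reals_Archimedean[OF \<delta>(1)] by blast
  define N where "N = real (Suc n)"
  have N: "N > 0" "1 / N < \<delta>" "N = real n + 1" using n by (simp_all add: N_def inverse_eq_divide)
  define d where "d j = g (real (Suc j) / N) - g (real j / N)" for j
  have d_dec: "d (Suc j) \<le> d j" if "j < n" for j
  proof -
    have "real j + 2 \<le> N" using that N(3) by linarith
    then have in01: "real j / N \<in> {0..1}" "real (Suc (Suc j)) / N \<in> {0..1}" using N by (auto simp: field_simps)
    have "(1 - 1/2) * g (real j / N) + 1/2 * g (real (Suc (Suc j)) / N)
        \<le> g ((1 - 1/2) *\<^sub>R (real j / N) + (1/2) *\<^sub>R (real (Suc (Suc j)) / N))"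
      using concave_onD[OF concave _ _ in01, of "1/2"] by simp
    also have "(1 - 1/2) *\<^sub>R (real j / N) + (1/2) *\<^sub>R (real (Suc (Suc j)) / N) = real (Suc j) / N"
      using N(1) by (simp add: field_simps)
    finally show ?thesis by (simp add: d_def)
  qed
  \<comment> \<open>The slope lost at the node (j+1)/N. The last slope, N * d n, becomes the linear
    coefficient, so all hinges stay strictly below 1.\<close>
  define c where "c j = N * (d j - d (Suc j))" for j
  define r where "r j = real (Suc j) / N" for j
  have approx: "\<bar>g t - (N * d n * t + (\<Sum>j<n. c j * min t (r j)))\<bar> \<le> e" if t: "t \<in> {0..1}" for t
  proof -
    define x where "x = N * t"
    have x: "0 \<le> x" "x \<le> N" using t N(1) by (auto simp: x_def)
    have tx: "t = x / N" using N(1) by (simp add: x_def)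
    obtain k where k: "k \<le> n" "real k \<le> x" "x \<le> real k + 1"
    proof (cases "x < N")
      case True
      define k where "k = nat \<lfloor>x\<rfloor>"
      have k: "real k \<le> x" "x \<le> real k + 1" using x(1) unfolding k_def by linarith+
      moreover have "k \<le> n" using k True N(3) by linarith
      ultimately show ?thesis using that by blast
    next
      case False
      then show ?thesis using x N(3) by (intro that[of n]) auto
    qed
    have "c j * min t (r j) = (d j - d (Suc j)) * (if j < k then real (Suc j) else x)" for j
    proof -
      have "N * min t (r j) = min x (real (Suc j))"
        using N(1) by (simp add: tx r_def min_def field_simps)
      also have "\<dots> = (if j < k then real (Suc j) else x)"
        using k by auto
      finally have "N * min t (r j) = (if j < k then real (Suc j) else x)" .
      moreover have "c j * min t (r j) = (d j - d (Suc j)) * (N * min t (r j))" by (simp add: c_def)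
      ultimately show ?thesis by (simp only:)
    qed
    then have "(\<Sum>j<n. c j * min t (r j)) = (\<Sum>j<n. (d j - d (Suc j)) * (if j < k then real (Suc j) else x))"
      by (simp only:)
    then have "N * d n * t + (\<Sum>j<n. c j * min t (r j)) = (\<Sum>j<k. d j) + (x - real k) * d k"
      using hinge_sum[OF k(1), of d x] by (simp add: x_def mult.commute mult.left_commute)
    also have "(\<Sum>j<k. d j) = g (real k / N)"
      unfolding d_def using g by (subst sum_lessThan_telescope) (simp add: weight_def)
    \<comment> \<open>The interpolation error is a convex combination of the differences from the
      values at the two neighbouring nodes.\<close>
    finally have eq: "g t - (N * d n * t + (\<Sum>j<n. c j * min t (r j)))
        = (1 - (x - real k)) * (g t - g (real k / N)) + (x - real k) * (g t - g (real (Suc k) / N))"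
      by (simp add: d_def algebra_simps)
    have k01: "real k / N \<in> {0..1}" "real (Suc k) / N \<in> {0..1}" using k(1) N by (auto simp: field_simps)
    have near: "\<bar>t - y / N\<bar> \<le> 1 / N" if "\<bar>x - y\<bar> \<le> 1" for y
      using N(1) that unfolding tx diff_divide_distrib[symmetric] abs_divide by (simp add: divide_right_mono)
    have "\<bar>t - real k / N\<bar> \<le> 1 / N" "\<bar>t - real (Suc k) / N\<bar> \<le> 1 / N"
      by (rule near, use k in simp)+
    then have b: "\<bar>g t - g (real k / N)\<bar> \<le> e" "\<bar>g t - g (real (Suc k) / N)\<bar> \<le> e"
      using \<delta>(2)[OF k01(1) t] \<delta>(2)[OF k01(2) t] N(2) unfolding dist_real_def by linarith+
    have "\<bar>(1 - (x - real k)) * (g t - g (real k / N)) + (x - real k) * (g t - g (real (Suc k) / N))\<bar>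
        \<le> (1 - (x - real k)) * e + (x - real k) * e"
    proof (rule order_trans[OF abs_triangle_ineq])
      show "\<bar>(1 - (x - real k)) * (g t - g (real k / N))\<bar> + \<bar>(x - real k) * (g t - g (real (Suc k) / N))\<bar>
        \<le> (1 - (x - real k)) * e + (x - real k) * e"
        unfolding abs_mult using k b by (intro add_mono mult_mono) auto
    qed
    then show ?thesis unfolding eq by (simp add: algebra_simps)
  qed
  show ?thesis
  proof (rule that[of n c r "N * d n"])
    show "0 \<le> c j" if "j < n" for j using d_dec[OF that] N(1) by (simp add: c_def)
    show "0 \<le> r j \<and> r j < 1" if "j < n" for j using that N by (simp add: r_def)
  qed (rule approx)
qed

context tracial_vna
begin

text \<open>The approximant h is handled term by term: the hinges carry nonnegative coefficients,
  whereas \<kappa> may have any sign because \<open>tr\<close> is additive. The negative sign does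
  occur for the decreasing weights - \<alpha>.\<close>

lemma layer_subadditive:
  assumes g: "weight g" and concave: "concave_on {0..1} g" and a: "a \<in> sa_part M" and b: "b \<in> sa_part M"
  shows "layer g (a + b) \<le> layer g a + layer g b"
proof (rule field_le_epsilon)
  fix \<epsilon> :: real assume \<epsilon>: "\<epsilon> > 0"
  define R where "R = norm a + norm b + 1"
  have R: "R > 0" "norm a \<le> R" "norm b \<le> R" "norm (a + b) \<le> R"
    using norm_ge_zero[of a] norm_ge_zero[of b] norm_triangle_ineq[of a b] unfolding R_def by linarith+
  \<comment> \<open>Replacing g by h costs at most 4 e R at each of a, b and a + b, in total
    \<epsilon>.\<close>
  define e where "e = \<epsilon> / (12 * R)"
  have e: "e > 0" "12 * R * e = \<epsilon>" using \<epsilon> R(1) by (simp_all add: e_def)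
  obtain n c r \<kappa> where c: "\<And>j::nat. j < n \<Longrightarrow> 0 \<le> c j" and r: "\<And>j. j < n \<Longrightarrow> 0 \<le> r j \<and> r j < 1"
    and approx: "\<And>t. t \<in> {0..1} \<Longrightarrow> \<bar>g t - (\<kappa> * t + (\<Sum>j<n. c j * min t (r j)))\<bar> \<le> e"
    by (rule concave_hinge_approximation[OF g concave e(1)]) blast
  define h where "h t = \<kappa> * t + (\<Sum>j<n. c j * min t (r j))" for t
  have wj: "weight (\<lambda>t. c j * min t (r j))" if "j < n" for j
    using r[OF that] by (intro weight_cmult weight_min) simp
  have w: "weight h"
    unfolding h_def by (intro weight_add weight_cmult weight_id weight_sum wj) simp
  have layer_h: "layer h x = \<kappa> * tr x + (\<Sum>j<n. c j * layer (\<lambda>t. min t (r j)) x)" if x: "x \<in> sa_part M" for x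
  proof -
    have "layer h x = layer (\<lambda>t. \<kappa> * t) x + layer (\<lambda>t. \<Sum>j<n. c j * min t (r j)) x"
      unfolding h_def by (intro layer_add weight_cmult weight_id weight_sum wj x) simp
    also have "layer (\<lambda>t. \<Sum>j<n. c j * min t (r j)) x = (\<Sum>j<n. layer (\<lambda>t. c j * min t (r j)) x)"
      by (intro layer_sum wj x) simp
    finally show ?thesis by (simp add: layer_cmult layer_id[OF x])
  qed
  have close: "\<bar>layer g x - layer h x\<bar> \<le> 4 * e * R" if x: "x \<in> sa_part M" "norm x \<le> R" for x
  proof -
    have "\<bar>layer (\<lambda>t. g t - h t) x\<bar> \<le> 4 * e * R"
      by (rule abs_layer_le[OF weight_diff[OF g w] x(1) _ x(2)]) (use approx in \<open>simp add: h_def\<close>)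
    then show ?thesis by (simp only: layer_diff[OF g w x(1)])
  qed
  have "layer h (a + b) \<le> layer h a + layer h b"
  proof -
    have "c j * layer (\<lambda>t. min t (r j)) (a + b) \<le> c j * layer (\<lambda>t. min t (r j)) a + c j * layer (\<lambda>t. min t (r j)) b"
      if "j < n" for j
      unfolding distrib_left[symmetric] using c[OF that] r[OF that]
      by (intro mult_left_mono layer_min_subadditive a b) auto
    then have "(\<Sum>j<n. c j * layer (\<lambda>t. min t (r j)) (a + b))
        \<le> (\<Sum>j<n. c j * layer (\<lambda>t. min t (r j)) a) + (\<Sum>j<n. c j * layer (\<lambda>t. min t (r j)) b)"
      unfolding sum.distrib[symmetric] by (intro sum_mono) simp
    moreover have "tr (a + b) = tr a + tr b" using a b by (simp add: sa_part_iff tr_add)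
    ultimately show ?thesis
      by (simp add: layer_h a b sa_part_add distrib_left)
  qed
  moreover have "4 * e * R * 3 = \<epsilon>" using e(2) by (simp add: mult_ac)
  ultimately show "layer g (a + b) \<le> layer g a + layer g b + \<epsilon>"
    using close[OF a R(2)] close[OF b R(3)] close[OF sa_part_add[OF a b] R(4)] by linarith
qed

lemma layer_zero:
  assumes g: "weight g"
  shows "layer g 0 = 0"
proof -
  obtain B where B: "\<And>t. t \<in> {0..1} \<Longrightarrow> \<bar>g t\<bar> \<le> B" using weight_bounded[OF g] by blast
  show ?thesis using abs_layer_le[OF g sa_part_zero B, of 0] by simp
qed

lemma sa_part_sum: "(\<And>i. i \<in> A \<Longrightarrow> f i \<in> sa_part M) \<Longrightarrow> sum f A \<in> sa_part M"
  by (induction A rule: infinite_finite_induct) (auto simp: sa_part_zero sa_part_add)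

lemma layer_sum_le:
  assumes g: "weight g" "concave_on {0..1} g" and f: "\<And>i. i \<in> A \<Longrightarrow> f i \<in> sa_part M"
  shows "layer g (\<Sum>i\<in>A. f i) \<le> (\<Sum>i\<in>A. layer g (f i))"
  using f
proof (induction A rule: infinite_finite_induct)
  case (insert i A)
  have "layer g (f i + (\<Sum>i\<in>A. f i)) \<le> layer g (f i) + layer g (\<Sum>i\<in>A. f i)"
    using insert.prems by (intro layer_subadditive g sa_part_sum) auto
  then show ?case using insert by force
qed (simp_all add: layer_zero[OF g(1)])

end

section \<open>Powers of the means\<close>

lemma op_prod_Nil [simp]: "op_prod [] = id_blinfun"
  and op_prod_Cons [simp]: "op_prod (x # xs) = x o\<^sub>L op_prod xs"
  by (simp_all add: op_prod_def)

lemma op_power_0: "op_power x 0 = id_blinfun"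
  and op_power_Suc: "op_power x (Suc k) = x o\<^sub>L op_power x k"
  by (simp_all add: op_power_def)

lemma op_power_scaleR: "op_power (c *\<^sub>R x) k = (c ^ k) *\<^sub>R op_power x k"
  by (induction k) (simp_all add: op_power_0 op_power_Suc blinfun_compose.scaleR_left blinfun_compose.scaleR_right)

lemma op_power_sum:
  assumes A: "finite A"
  shows "op_power (\<Sum>i\<in>A. a i) k = (\<Sum>is | set is \<subseteq> A \<and> length is = k. op_prod (map a is))"
proof (induction k)
  case 0
  have "{is. set is \<subseteq> A \<and> length is = 0} = {[]}" by auto
  then show ?case by (simp add: op_power_0)
next
  case (Suc k)
  let ?L = "{is. set is \<subseteq> A \<and> length is = k}"
  have "(\<Sum>is | set is \<subseteq> A \<and> length is = Suc k. op_prod (map a is))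
      = (\<Sum>p\<in>?L \<times> A. op_prod (map a (snd p # fst p)))"
    unfolding lists_length_Suc_eq by (subst sum.reindex) (auto simp: inj_on_def case_prod_unfold)
  also have "\<dots> = (\<Sum>is\<in>?L. \<Sum>i\<in>A. a i o\<^sub>L op_prod (map a is))"
    by (simp add: sum.cartesian_product case_prod_unfold)
  also have "\<dots> = (\<Sum>i\<in>A. a i) o\<^sub>L (\<Sum>is\<in>?L. op_prod (map a is))"
    by (simp only: blinfun_compose.sum_left blinfun_compose.sum_right)
  finally show ?case by (simp add: op_power_Suc Suc)
qed

lemma symmetric_op_power:
  assumes x: "symmetric_op x"
  shows "symmetric_op (op_power x k)"
proof (induction k)
  case (Suc k)
  have comm: "x o\<^sub>L op_power x k = op_power x k o\<^sub>L x" for k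
    by (induction k) (simp_all add: op_power_0 op_power_Suc commute_compose blinfun_eqI)
  show ?case
    using commute_opD[OF comm[of k]]
    by (simp add: op_power_Suc symmetric_op_def symmetric_opD[OF x] symmetric_opD[OF Suc])
qed (simp add: op_power_0 symmetric_op_id)

lemma norm_op_prod_le:
  assumes "\<And>i. i \<in> set is \<Longrightarrow> norm (a i) \<le> C" "0 \<le> C"
  shows "norm (op_prod (map a is)) \<le> C ^ length is"
  using assms(1)
proof (induction "is")
  case Nil
  show ?case by (simp add: norm_blinfun_id_le)
next
  case (Cons i "is")
  have "norm (a i o\<^sub>L op_prod (map a is)) \<le> norm (a i) * norm (op_prod (map a is))" by (rule norm_blinfun_compose)
  also have "\<dots> \<le> C * C ^ length is" using Cons assms(2) by (intro mult_mono) auto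
  finally show ?case by simp
qed

text \<open>The count is the falling factorial n (n-1) ... (n-k+1), so the quotient is a product of
  k factors 1 - i/n.\<close>

lemma distinct_lists_asymptotics:
  "(\<lambda>n. real (card {is. length is = k \<and> distinct is \<and> set is \<subseteq> {1..n}}) / real n ^ k) \<longlonglongrightarrow> 1"
proof -
  have lim: "(\<lambda>n. \<Prod>i<k. 1 - real i / real n) \<longlonglongrightarrow> (\<Prod>i<k. 1 - 0)"
    by (intro tendsto_intros lim_const_over_n)
  have "\<forall>\<^sub>F n in sequentially. (\<Prod>i<k. 1 - real i / real n)
      = real (card {is. length is = k \<and> distinct is \<and> set is \<subseteq> {1..n}}) / real n ^ k"
  proof (rule eventually_sequentiallyI)
    \<comment> \<open>This range keeps n nonzero and the natural-number subtractions n - i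
      exact.\<close>
    fix n assume n: "Suc k \<le> n"
    have "card {is. length is = k \<and> distinct is \<and> set is \<subseteq> {1..n}} = \<Prod>{n - k + 1..n}"
      using card_lists_distinct_length_eq[of "{1..n}" k] n by simp
    also have "\<dots> = (\<Prod>i<k. n - i)"
      using n by (intro prod.reindex_bij_witness[of _ "\<lambda>i. n - i" "\<lambda>j. n - j"]) auto
    finally have "real (card {is. length is = k \<and> distinct is \<and> set is \<subseteq> {1..n}}) = (\<Prod>i<k. real n - real i)"
      using n by (simp add: of_nat_diff)
    moreover have "(\<Prod>i<k. 1 - real i / real n) = (\<Prod>i<k. (real n - real i) / real n)"
      using n by (intro prod.cong) (auto simp: field_simps)
    ultimately show "(\<Prod>i<k. 1 - real i / real n)
      = real (card {is. length is = k \<and> distinct is \<and> set is \<subseteq> {1..n}}) / real n ^ k"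
      by (simp add: prod_dividef)
  qed
  from Lim_transform_eventually[OF lim this] show ?thesis by simp
qed

text \<open>The graph lies above the chord from (0,0) to (1,1). Used at t and at 1 - t, this places
  the identity between the dual weight and \<alpha>.\<close>

lemma concave_ge_id:
  assumes "concave_on {0..1} g" "g 0 = 0" "g 1 = 1" "t \<in> {0..1}"
  shows "t \<le> g (t::real)"
  using concave_onD[OF assms(1), of t 0 1] assms(2-4) by simp

lemma weight_dual: "continuous_on {0..1} g \<Longrightarrow> g 1 = 1 \<Longrightarrow> weight (dual_weight g)"
  unfolding weight_def dual_weight_def
  by (auto intro!: continuous_intros continuous_on_compose2[of "{0..1}" g "{0..1}" "\<lambda>t. 1 - t"])

lemma convex_dual:
  assumes "concave_on {0..1} g"
  shows "convex_on {0..1} (dual_weight g)"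
proof (rule convex_onI)
  fix t x y :: real assume *: "0 < t" "t < 1" "x \<in> {0..1}" "y \<in> {0..1}"
  have "(1 - t) * g (1 - x) + t * g (1 - y) \<le> g ((1 - t) *\<^sub>R (1 - x) + t *\<^sub>R (1 - y))"
    using * by (intro concave_onD[OF assms]) auto
  also have "(1 - t) *\<^sub>R (1 - x) + t *\<^sub>R (1 - y) = 1 - ((1 - t) *\<^sub>R x + t *\<^sub>R y)"
    by (simp add: algebra_simps)
  finally show "dual_weight g ((1 - t) *\<^sub>R x + t *\<^sub>R y) \<le> (1 - t) * dual_weight g x + t * dual_weight g y"
    by (simp add: dual_weight_def algebra_simps)
qed simp

text \<open>If l < y < b, the sequence eventually exceeds y, so the neighbourhood {..<y} of l is
  visited only finitely often.\<close>

lemma accumulation_point_ge_liminf: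
  assumes l: "accumulation_point X l" and b: "ereal b \<le> liminf (\<lambda>n. ereal (X n))"
  shows "b \<le> l"
proof (rule ccontr)
  assume "\<not> b \<le> l"
  then obtain y where y: "l < y" "y < b" using dense[of l b] by auto
  then have "ereal y < liminf (\<lambda>n. ereal (X n))" using b less_le_trans[of "ereal y" "ereal b"] by simp
  from less_LiminfD[OF this] have "\<forall>\<^sub>F n in sequentially. y < X n" by simp
  then obtain N where "\<And>n. n \<ge> N \<Longrightarrow> y < X n" unfolding eventually_sequentially by blast
  then have "{n. X n \<in> {..<y}} \<subseteq> {..<N}" by (force simp: not_le[symmetric])
  then have "finite {n. X n \<in> {..<y}}" by (rule finite_subset) simp
  moreover have "infinite {n. X n \<in> {..<y}}" using l[unfolded accumulation_point_def, rule_format, of "{..<y}"] y(1) by simp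
  ultimately show False by simp
qed

lemma accumulation_point_le_limsup:
  assumes l: "accumulation_point X l" and b: "limsup (\<lambda>n. ereal (X n)) \<le> ereal b"
  shows "l \<le> b"
proof -
  have "accumulation_point (\<lambda>n. - X n) (- l)"
    unfolding accumulation_point_def
  proof (intro allI impI)
    fix U :: "real set" assume U: "open U" "- l \<in> U"
    have "open (uminus ` U)" using U(1) by (rule open_negations)
    moreover have "l \<in> uminus ` U" using U(2) by force
    ultimately have "infinite {n. X n \<in> uminus ` U}" using l unfolding accumulation_point_def by blast
    moreover have "{n. X n \<in> uminus ` U} = {n. - X n \<in> U}" by force
    ultimately show "infinite {n. - X n \<in> U}" by simp
  qed
  moreover have "ereal (- b) \<le> liminf (\<lambda>n. ereal (- X n))"
    using b ereal_Limsup_uminus[of sequentially "\<lambda>n. ereal (- X n)"] by (simp add: ereal_uminus_le_reorder)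
  ultimately show ?thesis using accumulation_point_ge_liminf by force
qed

section \<open>Real parts of words and the limit estimates\<close>

context tracial_vna
begin

lemma adj_add: "x \<in> M \<Longrightarrow> y \<in> M \<Longrightarrow> adj (x + y) = adj x + adj y"
  by (rule adj_eqI) (simp_all add: mem_bounded_ops mem_add blinfun.bilinear_simps inner_add inner_adj)

lemma adj_symmetric: "x \<in> M \<Longrightarrow> symmetric_op x \<Longrightarrow> adj x = x"
  by (rule adj_eqI) (simp_all add: mem_bounded_ops symmetric_opD)

lemma re_op_add: "x \<in> M \<Longrightarrow> y \<in> M \<Longrightarrow> re_op (x + y) = re_op x + re_op y"
  by (simp add: re_op_def adj_add scaleR_add_right)

lemma re_op_symmetric: "x \<in> M \<Longrightarrow> symmetric_op x \<Longrightarrow> re_op x = x"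
  by (simp add: re_op_def adj_symmetric flip: scaleR_2)

lemma re_op_sum: "(\<And>i. i \<in> A \<Longrightarrow> f i \<in> M) \<Longrightarrow> re_op (\<Sum>i\<in>A. f i) = (\<Sum>i\<in>A. re_op (f i))"
proof (induction A rule: infinite_finite_induct)
  case (insert i A)
  then show ?case by (simp add: re_op_add mem_sum)
qed (simp_all add: re_op_symmetric mem_zero symmetric_op_def)

lemma re_op_sa_part: "x \<in> M \<Longrightarrow> re_op x \<in> sa_part M"
proof -
  assume x: "x \<in> M"
  have "inner (adj x u) v = inner u (x v)" for u v
    using inner_adj[OF mem_bounded_ops[OF x], of v u] by (simp add: inner_commute)
  then have "symmetric_op (re_op x)"
    by (simp add: symmetric_op_def re_op_def blinfun.bilinear_simps inner_add inner_adj[OF mem_bounded_ops[OF x]])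
  then show ?thesis using x by (simp add: sa_part_iff re_op_def mem_scaleR mem_add mem_adj)
qed

lemma norm_adj_le: "x \<in> M \<Longrightarrow> norm (adj x) \<le> norm x"
proof (rule norm_blinfun_bound)
  fix y assume x: "x \<in> M"
  have "norm (adj x y)^2 = inner (x (adj x y)) y"
    by (simp add: inner_adj[OF mem_bounded_ops[OF x]] power2_norm_eq_inner)
  also have "\<dots> \<le> norm (x (adj x y)) * norm y" by (rule norm_cauchy_schwarz)
  also have "\<dots> \<le> (norm x * norm (adj x y)) * norm y" by (intro mult_right_mono norm_blinfun) simp
  finally show "norm (adj x y) \<le> norm x * norm y"
    by (cases "adj x y = 0") (auto simp: power2_eq_square algebra_simps)
qed simp

lemma norm_re_op_le: "x \<in> M \<Longrightarrow> norm (re_op x) \<le> norm x"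
  using norm_triangle_ineq[of x "adj x"] norm_adj_le[of x] by (simp add: re_op_def)

lemma op_prod_mem: "(\<And>i. i \<in> set is \<Longrightarrow> a i \<in> M) \<Longrightarrow> op_prod (map a is) \<in> M"
  by (induction "is") (auto simp: mem_id mem_compose)

lemma op_power_sa_part: "x \<in> sa_part M \<Longrightarrow> op_power x k \<in> sa_part M"
  using op_prod_mem[of "replicate k x" id] by (auto simp: sa_part_iff symmetric_op_power op_power_def[symmetric])

lemma seq_mean_sa_part: "\<forall>n\<ge>1. a n \<in> sa_part M \<Longrightarrow> seq_mean a n \<in> sa_part M"
  by (auto simp: seq_mean_def intro!: sa_part_scaleR sa_part_sum)

text \<open>All but a vanishing proportion of the \<open>n\<^sup>k\<close> index tuples in the expansion of
  \<open>(a\<^sub>1 + \<dots> + a\<^sub>n)\<^sup>k\<close> are injective.\<close>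

lemma limsup_layer_power_le:
  assumes g: "weight g" "concave_on {0..1} g"
    and a: "\<forall>n\<ge>1. a n \<in> sa_part M" and bdd: "bounded (a ` {1..})"
    and c: "\<And>is. length is = k \<Longrightarrow> distinct is \<Longrightarrow> set is \<subseteq> {1..}
      \<Longrightarrow> layer g (re_op (op_prod (map a is))) \<le> c"
  shows "limsup (\<lambda>n. ereal (layer g (op_power (seq_mean a n) k))) \<le> ereal c"
proof -
  obtain C0 where C0: "\<And>n. n \<ge> 1 \<Longrightarrow> norm (a n) \<le> C0" using bdd by (auto simp: bounded_iff)
  define C where "C = max C0 0"
  have C: "C \<ge> 0" "\<And>n. n \<ge> 1 \<Longrightarrow> norm (a n) \<le> C" using C0 by (auto simp: C_def intro: le_max_iff_disj[THEN iffD2])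
  obtain B where B: "\<And>t. t \<in> {0..1} \<Longrightarrow> \<bar>g t\<bar> \<le> B" using weight_bounded[OF g(1)] by blast
  \<comment> \<open>The bound of \<open>abs_layer_le\<close> for any word of length k, whose norm is
    at most C ^ k; it serves for the words with a repeated index.\<close>
  define K where "K = 4 * B * C ^ k"
  define D where "D n = {is. length is = k \<and> distinct is \<and> set is \<subseteq> {1..n}}" for n :: nat
  define L where "L n = {is. set is \<subseteq> {1..n} \<and> length is = k}" for n :: nat
  define q where "q n = real (card (D n)) / real n ^ k" for n
  let ?f = "\<lambda>is. layer g (re_op (op_prod (map a is)))"
  have q: "q \<longlonglongrightarrow> 1" unfolding q_def D_def by (rule distinct_lists_asymptotics)
  have bound: "layer g (op_power (seq_mean a n) k) \<le> q n * c + (1 - q n) * K" if n: "n \<ge> 1" for n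
  proof -
    have fin: "finite (L n)" unfolding L_def by (rule finite_lists_length_eq) simp
    have DL: "D n \<subseteq> L n" by (auto simp: D_def L_def)
    have L1: "i \<ge> 1" if "is \<in> L n" "i \<in> set is" for "is" i using that by (auto simp: L_def)
    have prodM: "op_prod (map a is) \<in> M" if "is \<in> L n" for "is"
      using a L1[OF that] by (intro op_prod_mem) (auto simp: sa_part_iff)
    have cardL: "real (card (L n)) = real n ^ k"
      using card_lists_length_eq[of "{1..n}" k] by (simp add: L_def)
    have S: "(\<Sum>i=1..n. a i) \<in> sa_part M" using a by (intro sa_part_sum) auto
    note pow = op_power_sa_part[OF S, of k]
    have expand: "op_power (\<Sum>i=1..n. a i) k = (\<Sum>is\<in>L n. op_prod (map a is))"
      unfolding L_def by (rule op_power_sum) simp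
    \<comment> \<open>Single words need not be self-adjoint, so \<open>layer\<close> cannot be split
      over them directly; the whole power is its own real part, and that splits into real parts of
      words.\<close>
    have "op_power (\<Sum>i=1..n. a i) k = re_op (op_power (\<Sum>i=1..n. a i) k)"
      using pow by (simp add: sa_part_iff re_op_symmetric)
    also have "\<dots> = (\<Sum>is\<in>L n. re_op (op_prod (map a is)))"
      unfolding expand by (rule re_op_sum[OF prodM])
    finally have eq: "op_power (\<Sum>i=1..n. a i) k = (\<Sum>is\<in>L n. re_op (op_prod (map a is)))" .
    have "layer g (op_power (\<Sum>i=1..n. a i) k) \<le> (\<Sum>is\<in>L n. ?f is)"
      unfolding eq by (rule layer_sum_le[OF g]) (intro re_op_sa_part prodM)
    also have "\<dots> = (\<Sum>is\<in>D n. ?f is) + (\<Sum>is\<in>L n - D n. ?f is)"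
      using sum.subset_diff[OF DL fin, of ?f] by simp
    also have "(\<Sum>is\<in>D n. ?f is) \<le> real (card (D n)) * c"
      by (rule sum_bounded_above) (rule c, auto simp: D_def)
    also have "(\<Sum>is\<in>L n - D n. ?f is) \<le> real (card (L n - D n)) * K"
    proof (rule sum_bounded_above)
      fix "is" assume "is \<in> L n - D n"
      then have isL: "is \<in> L n" by simp
      have "norm (op_prod (map a is)) \<le> C ^ length is"
        using C L1[OF isL] by (intro norm_op_prod_le) auto
      then have "norm (re_op (op_prod (map a is))) \<le> C ^ k"
        using norm_re_op_le[OF prodM[OF isL]] isL by (auto simp: L_def)
      then have "\<bar>?f is\<bar> \<le> K"
        unfolding K_def by (intro abs_layer_le[OF g(1)] re_op_sa_part prodM isL B)
      then show "?f is \<le> K" by simp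
    qed
    also have "real (card (L n - D n)) = real n ^ k - real (card (D n))"
      using card_Diff_subset[OF finite_subset[OF DL fin] DL] card_mono[OF fin DL] cardL by (simp add: of_nat_diff)
    finally have "layer g (op_power (\<Sum>i=1..n. a i) k)
        \<le> real (card (D n)) * c + (real n ^ k - real (card (D n))) * K" by simp
    then have "(1 / real n) ^ k * layer g (op_power (\<Sum>i=1..n. a i) k)
        \<le> (1 / real n) ^ k * (real (card (D n)) * c + (real n ^ k - real (card (D n))) * K)"
      by (rule mult_left_mono) simp
    also have "\<dots> = q n * c + (1 - q n) * K"
      using n by (simp add: q_def field_simps)
    also have "(1 / real n) ^ k * layer g (op_power (\<Sum>i=1..n. a i) k) = layer g (op_power (seq_mean a n) k)"
      using n unfolding seq_mean_def op_power_scaleR by (intro layer_scaleR[OF pow, symmetric]) simp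
    finally show ?thesis .
  qed
  have "limsup (\<lambda>n. ereal (layer g (op_power (seq_mean a n) k))) \<le> limsup (\<lambda>n. ereal (q n * c + (1 - q n) * K))"
    using bound by (intro Limsup_mono eventually_sequentiallyI[of 1]) simp
  also have "(\<lambda>n. q n * c + (1 - q n) * K) \<longlonglongrightarrow> 1 * c + (1 - 1) * K"
    by (intro tendsto_intros q)
  then have "limsup (\<lambda>n. ereal (q n * c + (1 - q n) * K)) = ereal c"
    by (intro lim_imp_Limsup) simp_all
  finally show ?thesis .
qed

lemma choquet_trace_mean:
  "weight g \<Longrightarrow> g 1 = 1 \<Longrightarrow> \<forall>n\<ge>1. a n \<in> sa_part M
    \<Longrightarrow> choquet_trace \<tau> g (op_power (seq_mean a n) k) = layer g (op_power (seq_mean a n) k)"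
  by (intro choquet_trace_eq_layer op_power_sa_part seq_mean_sa_part)

lemma choquet_trace_re_op_prod:
  assumes "weight g" "g 1 = 1" "\<forall>n\<ge>1. a n \<in> sa_part M" "set is \<subseteq> {1..}"
  shows "choquet_trace \<tau> g (re_op (op_prod (map a is))) = layer g (re_op (op_prod (map a is)))"
proof (intro choquet_trace_eq_layer assms re_op_sa_part op_prod_mem)
  show "a i \<in> M" if "i \<in> set is" for i using assms(3,4) that by (auto simp: sa_part_iff)
qed

lemma prod_list_choquet_trace:
  assumes "\<forall>n\<ge>1. \<phi> (a n) = (m::real)" "set is \<subseteq> {1..}"
  shows "prod_list (map (\<lambda>i. \<phi> (a i)) is) = m ^ length is"
  using assms(2) by (induction "is") (auto simp: assms(1))

lemma limsup_choquet_trace_power_le: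
  assumes g: "weight g" "concave_on {0..1} g" "g 1 = 1"
    and a: "\<forall>n\<ge>1. a n \<in> sa_part M" and bdd: "bounded (a ` {1..})"
    and m: "\<forall>n\<ge>1. choquet_trace \<tau> g (a n) = m"
    and sub: "subindependent (choquet_trace \<tau> g) a" and k: "k \<ge> 1"
  shows "limsup (\<lambda>n. ereal (choquet_trace \<tau> g (op_power (seq_mean a n) k))) \<le> ereal (m ^ k)"
  unfolding choquet_trace_mean[OF g(1,3) a]
proof (rule limsup_layer_power_le[OF g(1,2) a bdd])
  fix "is" :: "nat list" assume "is": "length is = k" "distinct is" "set is \<subseteq> {1..}"
  \<comment> \<open>Subindependence speaks of nonempty products only; here k \<ge> 1 enters.\<close>
  then have "is \<noteq> []" using k by auto
  then have "choquet_trace \<tau> g (re_op (op_prod (map a is))) \<le> prod_list (map (\<lambda>i. choquet_trace \<tau> g (a i)) is)"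
    using sub "is" unfolding subindependent_def by blast
  then show "layer g (re_op (op_prod (map a is))) \<le> m ^ k"
    using "is" by (simp add: prod_list_choquet_trace[where \<phi>="choquet_trace \<tau> g" and a=a, OF m] choquet_trace_re_op_prod[OF g(1,3) a])
qed

text \<open>The upper estimate applied to the concave weight - g, whose \<open>layer\<close> is the
  negative of that of g. The detour has to use \<open>layer\<close>, since
  \<open>choquet_trace\<close> is identified with it only for weights with value 1 at 1.\<close>

lemma liminf_choquet_trace_power_ge:
  assumes g: "weight g" "convex_on {0..1} g" "g 1 = 1"
    and a: "\<forall>n\<ge>1. a n \<in> sa_part M" and bdd: "bounded (a ` {1..})"
    and m: "\<forall>n\<ge>1. choquet_trace \<tau> g (a n) = m"
    and super: "superindependent (choquet_trace \<tau> g) a" and k: "k \<ge> 1"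
  shows "ereal (m ^ k) \<le> liminf (\<lambda>n. ereal (choquet_trace \<tau> g (op_power (seq_mean a n) k)))"
proof -
  have neg: "layer (\<lambda>t. - g t) x = - layer g x" for x using layer_cmult[of "-1" g x] by simp
  have "limsup (\<lambda>n. ereal (layer (\<lambda>t. - g t) (op_power (seq_mean a n) k))) \<le> ereal (- (m ^ k))"
  proof (rule limsup_layer_power_le[OF weight_uminus[OF g(1)] _ a bdd])
    show "concave_on {0..1} (\<lambda>t. - g t)" using g(2) by (simp add: concave_on_def)
    fix "is" :: "nat list" assume "is": "length is = k" "distinct is" "set is \<subseteq> {1..}"
    then have "is \<noteq> []" using k by auto
    then have "prod_list (map (\<lambda>i. choquet_trace \<tau> g (a i)) is) \<le> choquet_trace \<tau> g (re_op (op_prod (map a is)))"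
      using super "is" unfolding superindependent_def by blast
    then show "layer (\<lambda>t. - g t) (re_op (op_prod (map a is))) \<le> - (m ^ k)"
      using "is" by (simp add: neg prod_list_choquet_trace[where \<phi>="choquet_trace \<tau> g" and a=a, OF m] choquet_trace_re_op_prod[OF g(1,3) a])
  qed
  then have "- liminf (\<lambda>n. ereal (layer g (op_power (seq_mean a n) k))) \<le> - ereal (m ^ k)"
    unfolding neg by (simp flip: uminus_ereal.simps(1) add: ereal_Limsup_uminus)
  then show ?thesis
    unfolding choquet_trace_mean[OF g(1,3) a] by (simp only: ereal_minus_le_minus)
qed

end

theorem corollary4p10:
  fixes M :: "'h::chilbert_space oper set"
    and \<tau> :: "'h oper \<Rightarrow> complex"
    and \<alpha> :: "real \<Rightarrow> real"
    and a :: "nat \<Rightarrow> 'h oper"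
    and m :: real
  assumes "type_II1_factor M"
    and "faithful_normal_tracial_state M \<tau>"
    and "mono_on {0..1} \<alpha>" and "continuous_on {0..1} \<alpha>" and "\<alpha> 0 = 0" and "\<alpha> 1 = 1"
    and "\<forall>n\<ge>1. a n \<in> sa_part M"
    and "bounded (a ` {1..})"
    and "\<forall>n\<ge>1. choquet_trace \<tau> \<alpha> (a n) = m"
  shows
    "(concave_on {0..1} \<alpha> \<longrightarrow> subindependent (choquet_trace \<tau> \<alpha>) a \<longrightarrow>
        (\<forall>k\<ge>1. limsup (\<lambda>n. ereal (choquet_trace \<tau> \<alpha> (op_power (seq_mean a n) k))) \<le> ereal (m ^ k)))
     \<and>
     (convex_on {0..1} \<alpha> \<longrightarrow> superindependent (choquet_trace \<tau> \<alpha>) a \<longrightarrow>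
        (\<forall>k\<ge>1. liminf (\<lambda>n. ereal (choquet_trace \<tau> \<alpha> (op_power (seq_mean a n) k))) \<ge> ereal (m ^ k)))
     \<and>
     (\<forall>m'::real.
        concave_on {0..1} \<alpha> \<longrightarrow>
        subindependent (choquet_trace \<tau> \<alpha>) a \<longrightarrow>
        superindependent (choquet_trace \<tau> (dual_weight \<alpha>)) a \<longrightarrow>
        (\<forall>n\<ge>1. choquet_trace \<tau> (dual_weight \<alpha>) (a n) = m') \<longrightarrow>
        (\<forall>k\<ge>1.
           ereal (m' ^ k)
             \<le> liminf (\<lambda>n. ereal (choquet_trace \<tau> (dual_weight \<alpha>) (op_power (seq_mean a n) k))) \<and>
           liminf (\<lambda>n. ereal (choquet_trace \<tau> (dual_weight \<alpha>) (op_power (seq_mean a n) k)))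
             \<le> liminf (\<lambda>n. ereal (choquet_trace \<tau> \<alpha> (op_power (seq_mean a n) k))) \<and>
           liminf (\<lambda>n. ereal (choquet_trace \<tau> \<alpha> (op_power (seq_mean a n) k)))
             \<le> limsup (\<lambda>n. ereal (choquet_trace \<tau> \<alpha> (op_power (seq_mean a n) k))) \<and>
           limsup (\<lambda>n. ereal (choquet_trace \<tau> \<alpha> (op_power (seq_mean a n) k))) \<le> ereal (m ^ k) \<and>
           (\<forall>l. accumulation_point (\<lambda>n. choquet_trace \<tau> \<alpha> (op_power (seq_mean a n) k)) l
                  \<longrightarrow> l \<in> {m' ^ k..m ^ k})))"
proof -
  interpret tracial_vna M \<tau>
    using assms(1,2) by unfold_locales (simp_all add: type_II1_factor_def factor_def)
  note a = assms(7) and bdd = assms(8)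
  have w: "weight \<alpha>" using assms(4,5) by (simp add: weight_def)
  have w': "weight (dual_weight \<alpha>)" by (rule weight_dual[OF assms(4,6)])
  have dual1: "dual_weight \<alpha> 1 = 1" using assms(5) by (simp add: dual_weight_def)
  note upper = limsup_choquet_trace_power_le[OF w _ assms(6) a bdd assms(9)]
  show ?thesis
  proof (intro conjI impI allI)
    show "limsup (\<lambda>n. ereal (choquet_trace \<tau> \<alpha> (op_power (seq_mean a n) k))) \<le> ereal (m ^ k)"
      if "concave_on {0..1} \<alpha>" "subindependent (choquet_trace \<tau> \<alpha>) a" "k \<ge> 1" for k
      by (rule upper[OF that])
    show "ereal (m ^ k) \<le> liminf (\<lambda>n. ereal (choquet_trace \<tau> \<alpha> (op_power (seq_mean a n) k)))"
      if "convex_on {0..1} \<alpha>" "superindependent (choquet_trace \<tau> \<alpha>) a" "k \<ge> 1" for k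
      by (rule liminf_choquet_trace_power_ge[OF w that(1) assms(6) a bdd assms(9) that(2,3)])
    fix m' k
    assume conc: "concave_on {0..1} \<alpha>" and sub: "subindependent (choquet_trace \<tau> \<alpha>) a"
      and super: "superindependent (choquet_trace \<tau> (dual_weight \<alpha>)) a"
      and m': "\<forall>n\<ge>1. choquet_trace \<tau> (dual_weight \<alpha>) (a n) = m'" and k: "(k::nat) \<ge> 1"
    show 1: "ereal (m' ^ k) \<le> liminf (\<lambda>n. ereal (choquet_trace \<tau> (dual_weight \<alpha>) (op_power (seq_mean a n) k)))"
      by (rule liminf_choquet_trace_power_ge[OF w' convex_dual[OF conc] dual1 a bdd m' super k])
    show 2: "liminf (\<lambda>n. ereal (choquet_trace \<tau> (dual_weight \<alpha>) (op_power (seq_mean a n) k)))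
        \<le> liminf (\<lambda>n. ereal (choquet_trace \<tau> \<alpha> (op_power (seq_mean a n) k)))"
    proof (intro Liminf_mono always_eventually allI)
      fix n
      have "dual_weight \<alpha> t \<le> \<alpha> t" if "t \<in> {0..1}" for t
        using concave_ge_id[OF conc assms(5,6) that] concave_ge_id[OF conc assms(5,6), of "1 - t"] that
        by (simp add: dual_weight_def)
      then have "layer (dual_weight \<alpha>) (op_power (seq_mean a n) k) \<le> layer \<alpha> (op_power (seq_mean a n) k)"
        by (intro layer_mono w w' op_power_sa_part seq_mean_sa_part a) (simp_all add: dual1 assms(6))
      then show "ereal (choquet_trace \<tau> (dual_weight \<alpha>) (op_power (seq_mean a n) k))
          \<le> ereal (choquet_trace \<tau> \<alpha> (op_power (seq_mean a n) k))"
        by (simp add: choquet_trace_mean[OF w assms(6) a] choquet_trace_mean[OF w' dual1 a])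
    qed
    show "liminf (\<lambda>n. ereal (choquet_trace \<tau> \<alpha> (op_power (seq_mean a n) k)))
        \<le> limsup (\<lambda>n. ereal (choquet_trace \<tau> \<alpha> (op_power (seq_mean a n) k)))"
      by (rule Liminf_le_Limsup) simp
    show 3: "limsup (\<lambda>n. ereal (choquet_trace \<tau> \<alpha> (op_power (seq_mean a n) k))) \<le> ereal (m ^ k)"
      by (rule upper[OF conc sub k])
    \<comment> \<open>The lower end comes from the dual trace: \<open>1\<close> bounds its liminf
      from below and \<open>2\<close> passes to the liminf for \<alpha>.\<close>
    show "l \<in> {m' ^ k..m ^ k}"
      if "accumulation_point (\<lambda>n. choquet_trace \<tau> \<alpha> (op_power (seq_mean a n) k)) l" for l
      using accumulation_point_ge_liminf[OF that order_trans[OF 1 2]] accumulation_point_le_limsup[OF that 3] by simp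
  qed
qed

end
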